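(* Let $s>2$ be an integer and let $\mathcal{C}$ be a family of plane algebraic curves in $\mathbb{R}^2$ of bounded degree, with constant multiplicity type and $s$ degrees of freedom. Then in any arrangement $C$ of $m$ curves of $\mathcal{C}$, there exists a subset of $\Omega(m^{1-1/s})$ curves of $C$ all passing through one common point, or a subset of $\Omega(m^{1/s})$ curves of $C$ inducing a simple subarrangement, that is, such that at most two of them pass through any one point.
   Context: The number of degrees of freedom of a family $\mathcal{C}$ of algebraic curves is the minimum value $s$ such that for any $s$ points in $\mathbb{R}^2$ there are at most $c$ curves of $\mathcal{C}$ passing through all of them, for some constant $c$. The family has multiplicity type $r$ if any two distinct curves of $\mathcal{C}$ intersect in at most $r$ points; constant multiplicity type means $r$ is a constant. The constants in $\Omega(\cdot)$ depend only on the family $\mathcal{C}$, not on $m$ or $C$. *)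

theory Defs
  imports Complex_Main "HOL-Computational_Algebra.Polynomial"
begin

(* A bivariate polynomial p is an element of R[x][y]: the coefficient of the
   monomial x^i y^j is coeff (coeff p j) i. *)

definition eval2 :: "real poly poly \<Rightarrow> real \<times> real \<Rightarrow> real" where
  "eval2 p z = poly (poly p [:snd z:]) (fst z)"

lemma eval2_altdef:
  "eval2 p (x, y) = (\<Sum>j\<le>degree p. \<Sum>i\<le>degree (coeff p j). coeff (coeff p j) i * x ^ i * y ^ j)"
proof -
  have "eval2 p (x, y) = (\<Sum>j\<le>degree p. poly (coeff p j) x * y ^ j)"
    unfolding eval2_def poly_altdef[of p] by (simp add: poly_sum)
  thus ?thesis by (simp add: poly_altdef sum_distrib_right)
qed

(* The inserted 0 only makes the total degree of the zero polynomial equal to 0. *)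
definition total_degree :: "real poly poly \<Rightarrow> nat" where
  "total_degree p = Max (insert 0 {i + j | i j. coeff (coeff p j) i \<noteq> 0})"

lemma finite_total_degree_set: "finite {i + j | i j. coeff (coeff p j) i \<noteq> (0::real)}"
proof (rule finite_subset)
  show "{i + j | i j. coeff (coeff p j) i \<noteq> 0}
          \<subseteq> (\<lambda>(i, j). i + j) ` (\<Union>j\<le>degree p. {..degree (coeff p j)} \<times> {j})"
  proof (clarify)
    fix i j assume nz: "coeff (coeff p j) i \<noteq> 0"
    hence "coeff p j \<noteq> 0" by auto
    hence "j \<le> degree p" by (rule le_degree)
    moreover have "i \<le> degree (coeff p j)" using nz by (rule le_degree)
    ultimately show "i + j \<in> (\<lambda>(i, j). i + j) ` (\<Union>j\<le>degree p. {..degree (coeff p j)} \<times> {j})"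
      by (intro image_eqI[of _ _ "(i, j)"]) auto
  qed
qed auto

(* The condition 0 < total_degree p says that p is nonconstant. *)
definition plane_algebraic_curve :: "nat \<Rightarrow> (real \<times> real) set \<Rightarrow> bool" where
  "plane_algebraic_curve d \<gamma> \<longleftrightarrow>
     (\<exists>p. 0 < total_degree p \<and> total_degree p \<le> d \<and> \<gamma> = {z. eval2 p z = 0})"

definition bounded_degree_family :: "(real \<times> real) set set \<Rightarrow> bool" where
  "bounded_degree_family \<C> \<longleftrightarrow> (\<exists>d. \<forall>\<gamma>\<in>\<C>. plane_algebraic_curve d \<gamma>)"

definition multiplicity_type :: "(real \<times> real) set set \<Rightarrow> nat \<Rightarrow> bool" where
  "multiplicity_type \<C> r \<longleftrightarrow>
     (\<forall>\<gamma>\<in>\<C>. \<forall>\<delta>\<in>\<C>. \<gamma> \<noteq> \<delta> \<longrightarrow> finite (\<gamma> \<inter> \<delta>) \<and> card (\<gamma> \<inter> \<delta>) \<le> r)"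

definition few_curves_through :: "(real \<times> real) set set \<Rightarrow> nat \<Rightarrow> bool" where
  "few_curves_through \<C> s \<longleftrightarrow>
     (\<exists>c. \<forall>P. finite P \<and> card P = s \<longrightarrow>
        finite {\<gamma>\<in>\<C>. P \<subseteq> \<gamma>} \<and> card {\<gamma>\<in>\<C>. P \<subseteq> \<gamma>} \<le> c)"

definition degrees_of_freedom :: "(real \<times> real) set set \<Rightarrow> nat \<Rightarrow> bool" where
  "degrees_of_freedom \<C> s \<longleftrightarrow>
     few_curves_through \<C> s \<and> (\<forall>t<s. \<not> few_curves_through \<C> t)"

definition simple_arrangement :: "(real \<times> real) set set \<Rightarrow> bool" where
  "simple_arrangement S \<longleftrightarrow> (\<forall>z. finite {\<gamma>\<in>S. z \<in> \<gamma>} \<and> card {\<gamma>\<in>S. z \<in> \<gamma>} \<le> 2)"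

end

theory Submission
  imports Defs
    "HOL-Computational_Algebra.Computational_Algebra"
    "HOL-Computational_Algebra.Field_as_Ring"
    "HOL-Analysis.Analysis"
    "HOL-Real_Asymp.Real_Asymp"
begin

text \<open>
  Put \<open>K = m powr (1 - 1/s)\<close> and assume that no point lies on \<open>K\<close> curves of \<open>C\<close>. It suffices to bound the
  number of concurrent triples of curves by \<open>O(m * K^2)\<close>: colouring the curves randomly with about
  \<open>K\<close> colours then leaves a colour class with more curves than monochromatic triples, by a multiple of
  \<open>m / K\<close>, and deleting one curve from each such triple makes the class simple.

  The triples are counted by the multiplicity of their common point, so one needs a bound of
  Pach--Sharir type on the number of points lying on at least \<open>\<kappa>\<close> curves. The Kovari--Sos--Turan
  inequality alone is sufficient only for \<open>\<kappa>\<close> close to \<open>K\<close>. For smaller \<open>\<kappa>\<close> it is applied inside the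
  cells of the vertical decomposition of a random sample of \<open>t\<close> curves. There are \<open>O(t^2)\<close> cells, and
  each of them is met by few curves of \<open>C\<close>.

  The decomposition needs only that each curve is, away from boundedly many vertical lines, locally a
  disjoint union of graphs. These lines are the roots of a polynomial combination, free of \<open>y\<close>, of the
  squarefree part \<open>u\<close> of the equation and the coprime cofactor of its \<open>y\<close>-derivative; a dimension count
  bounds its degree.
\<close>

subsection \<open>Critical lines of an algebraic curve\<close>

text \<open>For \<open>M\<close> points of multiplicity at least \<kappa>, Kovari--Sos--Turan gives
  \<kappa> M = O(m) + O(K M), which says nothing once \<kappa> is below a multiple of
  \<open>K\<close>. In a cell met by only \<open>B\<close> curves the factor \<open>K\<close>
  becomes B^(1-1/s), so \<open>B\<close> is chosen to make this a fraction of \<kappa>. About m/B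
  sampled curves then suffice, apart from the sampling loss, and the number of points is of order
  (m/K) (K/\<kappa>)^E with E = 2 + 1/(s-1). Triples are counted by summing \<kappa>^2 times this
  bound over \<kappa> up to \<open>K\<close>. For E < 3 the upper end dominates and the sum is of
  order m K^2; E = 3, the value for s = 2, would cost a logarithm. This is the essential use of s >
  2. The distance of E from 3 also leaves room for crude sampling: a union bound over all possible
  cells of one random sample, which loses a small power of m/B, takes the place of an optimal
  cutting.\<close>

definition spec :: "real \<Rightarrow> real poly poly \<Rightarrow> real poly" where
  "spec x p = map_poly (\<lambda>c. poly c x) p"

lemma coeff_spec [simp]: "coeff (spec x p) j = poly (coeff p j) x"
  by (simp add: spec_def coeff_map_poly)

lemma degree_spec_le: "degree (spec x p) \<le> degree p"
  by (rule degree_le) (simp add: coeff_eq_0)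

lemma poly_eq_sum_atMost:
  fixes p :: "'a::comm_semiring_1 poly"
  assumes "degree p \<le> n"
  shows "poly p y = (\<Sum>j\<le>n. coeff p j * y ^ j)"
  unfolding poly_altdef using assms by (intro sum.mono_neutral_left) (auto simp: coeff_eq_0)

lemma poly_spec: "poly (spec x p) y = eval2 p (x, y)"
proof -
  have "poly (spec x p) y = (\<Sum>j\<le>degree p. poly (coeff p j) x * y ^ j)"
    using poly_eq_sum_atMost[OF degree_spec_le[of x p]] by simp
  also have "\<dots> = eval2 p (x, y)"
    unfolding eval2_def poly_altdef[of p] by (simp add: poly_sum)
  finally show ?thesis .
qed

lemma eval2_mult: "eval2 (p * q) z = eval2 p z * eval2 q z"
  by (simp add: eval2_def)

lemma spec_mult: "spec x (p * q) = spec x p * spec x q"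
  by (subst poly_eq_poly_eq_iff[symmetric]) (simp add: fun_eq_iff poly_spec eval2_mult)

lemma spec_add: "spec x (p + q) = spec x p + spec x q"
  by (simp add: poly_eq_iff)

lemma spec_pderiv: "spec x (pderiv p) = pderiv (spec x p)"
  by (simp add: poly_eq_iff coeff_pderiv)

lemma spec_const: "spec x [:h:] = [:poly h x:]"
  by (simp add: poly_eq_iff coeff_pCons split: nat.split)

lemma degree_spec: "poly (lead_coeff p) x \<noteq> 0 \<Longrightarrow> degree (spec x p) = degree p"
  by (intro antisym degree_spec_le le_degree) simp

section \<open>Elimination of y with a degree bound\<close>

lemma underdetermined_system:
  fixes A :: "'i \<Rightarrow> 'j \<Rightarrow> real"
  assumes "finite J" "finite I" "card J < card I"
  shows "\<exists>c. (\<exists>i\<in>I. c i \<noteq> 0) \<and> (\<forall>j\<in>J. (\<Sum>i\<in>I. c i * A i j) = 0)"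
  using assms
proof (induction J arbitrary: I A rule: finite_induct)
  case empty
  then obtain i where "i \<in> I" by fastforce
  then show ?case by (intro exI[of _ "\<lambda>_. 1"]) auto
next
  case (insert j J)
  show ?case
  proof (cases "\<forall>i\<in>I. A i j = 0")
    case True
    obtain c where "\<exists>i\<in>I. c i \<noteq> 0" "\<forall>j\<in>J. (\<Sum>i\<in>I. c i * A i j) = 0"
      using insert.IH[of I A] insert.prems insert.hyps by auto
    then show ?thesis using True by (intro exI[of _ c]) auto
  next
    case False
    then obtain k where k: "k \<in> I" "A k j \<noteq> 0" by auto
    define I' where "I' = I - {k}"
    \<comment> \<open>Gaussian elimination: the unknown \<open>k\<close> has a nonzero coefficient
      in equation \<open>j\<close>, so this equation is solved for it and the result is substituted
      into the others.\<close>
    define A' where "A' i l = A i l - A i j / A k j * A k l" for i l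
    have I: "I = insert k I'" "k \<notin> I'" "finite I'" using k insert.prems by (auto simp: I'_def)
    have "card J < card I'" using insert.prems insert.hyps I by auto
    then obtain c where c: "\<exists>i\<in>I'. c i \<noteq> 0" "\<forall>l\<in>J. (\<Sum>i\<in>I'. c i * A' i l) = 0"
      using insert.IH[of I' A'] I by auto
    define c' where "c' i = (if i = k then - (\<Sum>i\<in>I'. c i * A i j) / A k j else c i)" for i
    have sum': "(\<Sum>i\<in>I'. c' i * A i l) = (\<Sum>i\<in>I'. c i * A i l)" for l
      using I by (intro sum.cong) (auto simp: c'_def)
    have eq: "(\<Sum>i\<in>I. c' i * A i l) = (\<Sum>i\<in>I'. c i * A' i l)" for l
    proof -
      have "(\<Sum>i\<in>I. c' i * A i l) = c' k * A k l + (\<Sum>i\<in>I'. c i * A i l)"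
        using I sum' by simp
      also have "c' k * A k l = - (\<Sum>i\<in>I'. c i * (A i j / A k j * A k l))"
        by (simp add: c'_def sum_divide_distrib sum_distrib_right mult.assoc)
      finally show ?thesis
        by (simp add: A'_def right_diff_distrib sum_subtractf)
    qed
    have "A' i j = 0" for i using k by (simp add: A'_def)
    then have "(\<Sum>i\<in>I. c' i * A i l) = 0" if "l \<in> insert j J" for l
      using that c by (auto simp: eq)
    moreover have "\<exists>i\<in>I. c' i \<noteq> 0" using c I by (auto simp: c'_def)
    ultimately show ?thesis by blast
  qed
qed

text \<open>An elementary stand-in for the resultant: the coefficients of \<open>a\<close> and
  \<open>b\<close> are the unknowns of a linear system whose equations kill all positive powers of y
  in \<open>a * u + b * v\<close>. Keeping the y-degree of \<open>b\<close> below that of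
  \<open>u\<close> excludes \<open>h = 0\<close>, because coprimality would then make
  \<open>u\<close> divide \<open>b\<close>.\<close>

lemma coprime_combination:
  fixes u v :: "real poly poly"
  assumes cop: "coprime u v" and u0: "u \<noteq> 0" and dv: "degree v \<le> degree u"
    and du: "degree u \<le> d" and xu: "\<And>j. degree (coeff u j) \<le> d" and xv: "\<And>j. degree (coeff v j) \<le> d"
  shows "\<exists>a b h. a * u + b * v = [:h:] \<and> h \<noteq> 0 \<and> degree h \<le> 2 * d * d + d"
proof (cases "degree u = 0")
  case True
  then obtain h where "u = [:h:]" by (rule degree_eq_zeroE)
  then have "1 * u + 0 * v = [:h:]" "h \<noteq> 0" "degree h \<le> d"
    using u0 xu[of 0] by auto
  then show ?thesis by (meson trans_le_add2)
next
  case False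
  define n where "n = degree u"
  \<comment> \<open>Large enough for the unknowns to outnumber the equations: there are 2n(X+1)
    unknowns and (2n-1)(X+d+1) equations, and (2n-1)d is at most 2dd = X.\<close>
  define X where "X = 2 * d * d"
  have n: "n > 0" "n \<le> d" using False du by (auto simp: n_def)
  define I where "I = (UNIV :: bool set) \<times> {..<n} \<times> {..X}"
  \<comment> \<open>Starting at 1 spares the coefficients of y^0, which form
    \<open>h\<close>.\<close>
  define J where "J = {1..<2*n} \<times> {..X + d}"
  define w where "w i = (case i of (e, k, l) \<Rightarrow> monom (monom (1::real) l) k * (if e then u else v))"
    for i :: "bool \<times> nat \<times> nat"
  have "(2 * n - 1) * (X + d + 1) < 2 * n * (X + 1)"
  proof -
    have "(2 * n - 1) * d \<le> (2 * d) * d" using n by (intro mult_le_mono1) linarith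
    then have "(2 * n - 1) * (X + 1) + (2 * n - 1) * d < (2 * n - 1) * (X + 1) + (X + 1)"
      by (simp only: X_def)
    also have "\<dots> = (2 * n - 1 + 1) * (X + 1)" by (simp only: distrib_right mult_1)
    also have "2 * n - 1 + 1 = 2 * n" using n by simp
    finally show ?thesis by (simp only: distrib_left add.commute add.left_commute add.assoc)
  qed
  then have card: "card J < card I"
    by (simp add: I_def J_def card_cartesian_product algebra_simps)
  obtain c where c: "\<exists>i\<in>I. c i \<noteq> 0" "\<forall>j\<in>J. (\<Sum>i\<in>I. c i * coeff (coeff (w i) (fst j)) (snd j)) = 0"
    using underdetermined_system[OF _ _ card, of "\<lambda>i j. coeff (coeff (w i) (fst j)) (snd j)"]
    by (auto simp: I_def J_def)
  define a where "a e = (\<Sum>k<n. \<Sum>l\<le>X. monom (monom (c (e, k, l)) l) k)" for e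
  have coeff_a: "coeff (coeff (a e) k) l = (if k < n \<and> l \<le> X then c (e, k, l) else 0)" for e k l
  proof -
    have "coeff (coeff (a e) k) l = (\<Sum>k'<n. \<Sum>l'\<le>X. if k' = k then if l' = l then c (e, k', l') else 0 else 0)"
      unfolding a_def coeff_sum by (intro sum.cong refl) (auto simp: coeff_sum)
    also have "\<dots> = (\<Sum>k'<n. if k' = k then (\<Sum>l'\<le>X. if l' = l then c (e, k', l') else 0) else 0)"
      by (intro sum.cong) auto
    also have "\<dots> = (if k < n \<and> l \<le> X then c (e, k, l) else 0)" by (simp add: sum.delta)
    finally show ?thesis .
  qed
  have dega: "degree (a e) < n" for e
    using n by (intro degree_lessI) (auto simp: poly_eq_iff coeff_a)
  have xdega: "degree (coeff (a e) k) \<le> X" for e k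
    by (intro degree_le) (auto simp: coeff_a)
  define s where "s = a True * u + a False * v"
  have s_eq: "s = (\<Sum>i\<in>I. smult [:c i:] (w i))"
  proof -
    have *: "a e * q = (\<Sum>k<n. \<Sum>l\<le>X. smult [:c (e,k,l):] (monom (monom 1 l) k * q))" for e q
      unfolding a_def sum_distrib_right by (intro sum.cong refl) (simp add: smult_monom flip: mult_smult_left)
    show ?thesis unfolding s_def * I_def
      by (simp add: sum.cartesian_product' UNIV_bool w_def add.commute)
  qed
  have coeff_s: "coeff (coeff s j) l = (\<Sum>i\<in>I. c i * coeff (coeff (w i) j) l)" for j l
    by (simp add: s_eq coeff_sum)
  have xs: "degree (coeff s j) \<le> X + d" for j
  proof -
    have *: "degree (coeff (a e * q) j) \<le> X + d" if "\<And>j. degree (coeff q j) \<le> d" for e q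
      unfolding coeff_mult
      by (intro degree_sum_le order_trans[OF degree_mult_le] add_mono xdega that) auto
    show ?thesis unfolding s_def coeff_add by (intro degree_add_le * xu xv)
  qed
  have ys: "degree s < 2 * n"
  proof -
    have "degree (a e * q) < 2 * n" if "degree q \<le> n" for e q
      using degree_mult_le[of "a e" q] dega[of e] that by linarith
    then show ?thesis unfolding s_def using dv n by (intro degree_add_less) (auto simp: n_def)
  qed
  have zero: "coeff s j = 0" if "j > 0" for j
  proof (rule poly_eqI, goal_cases)
    case (1 l)
    show ?case
    proof (cases "j < 2 * n \<and> l \<le> X + d")
      case True
      then have "(j, l) \<in> J" using that by (auto simp: J_def)
      then show ?thesis using c(2) by (auto simp: coeff_s)
    next
      case False
      then show ?thesis using ys xs[of j] by (auto simp: coeff_eq_0)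
    qed
  qed
  define h where "h = coeff s 0"
  have s_h: "s = [:h:]"
    using zero by (auto simp: poly_eq_iff[of s] coeff_pCons h_def split: nat.split)
  have "h \<noteq> 0"
  proof
    assume "h = 0"
    then have eq: "a True * u = - (a False * v)" using s_h by (simp add: s_def eq_neg_iff_add_eq_0)
    then have "u dvd a False * v" by (metis dvd_minus_iff dvd_triv_right)
    then have "u dvd a False" using cop by (simp add: coprime_dvd_mult_left_iff)
    then have F: "a False = 0" using dega[of False] by (auto simp: n_def dest: dvd_imp_degree_le)
    then have T: "a True = 0" using eq u0 by auto
    obtain e k l where "(e,k,l) \<in> I" "c (e, k, l) \<noteq> 0" using c(1) by auto
    then have "coeff (coeff (a e) k) l \<noteq> 0" by (auto simp: coeff_a I_def)
    then show False using F T by (cases e) auto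
  qed
  then show ?thesis using s_h xs[of 0] unfolding s_def h_def X_def by blast
qed

lemma finite_zero_fibres:
  fixes p :: "real poly poly"
  assumes "coeff (coeff p j) i \<noteq> 0"
  shows "finite {y. coeff (poly p [:y:]) i = 0}"
proof -
  define w where "w = map_poly (\<lambda>c. coeff c i) p"
  have "coeff w j \<noteq> 0" using assms by (simp add: w_def coeff_map_poly)
  then have "w \<noteq> 0" by auto
  have "coeff (poly p [:y:]) i = poly w y" for y
  proof -
    have c: "coeff (q * [:y:] ^ j) i = coeff q i * y ^ j" for q :: "real poly" and j
      by (induction j arbitrary: q) (simp_all flip: mult.assoc add: mult.commute[of _ "[:y:]"])
    have "degree w \<le> degree p" by (rule degree_le) (simp add: w_def coeff_map_poly coeff_eq_0)
    then show ?thesis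
      by (subst poly_eq_sum_atMost, assumption) (simp add: poly_altdef[of p] coeff_sum c w_def coeff_map_poly)
  qed
  then show ?thesis using poly_roots_finite[OF \<open>w \<noteq> 0\<close>] by simp
qed

text \<open>Degrees in x are additive too, but \<open>degree\<close> only sees the outer variable y.
  Substituting a generic real number for y preserves the relevant nonzero coefficients and leaves
  ordinary polynomials in x.\<close>

lemma factor_xdegree_le:
  fixes g u :: "real poly poly"
  assumes "g * u \<noteq> 0" and xp: "\<And>j. degree (coeff (g * u) j) \<le> d"
  shows "degree (coeff u j) \<le> d"
proof (rule degree_le, intro allI impI, rule ccontr)
  fix i assume i: "d < i" "coeff (coeff u j) i \<noteq> 0"
  have "g \<noteq> 0" using assms by auto
  then obtain k l where kl: "coeff (coeff g k) l \<noteq> 0" by (metis leading_coeff_0_iff)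
  have "finite ({y. coeff (poly u [:y:]) i = 0} \<union> {y. coeff (poly g [:y:]) l = 0})"
    using finite_zero_fibres[OF i(2)] finite_zero_fibres[OF kl] by simp
  then obtain y where y: "coeff (poly u [:y:]) i \<noteq> 0" "coeff (poly g [:y:]) l \<noteq> 0"
    by (metis (mono_tags, lifting) UnI1 UnI2 infinite_UNIV_char_0 mem_Collect_eq ex_new_if_finite)
  have "i \<le> degree (poly u [:y:])" using y by (simp add: le_degree)
  also have "\<dots> \<le> degree (poly (g * u) [:y:])"
    using y by (simp, subst degree_mult_eq) auto
  also have "\<dots> \<le> d"
    unfolding poly_altdef[of "g * u"]
    by (intro degree_sum_le order_trans[OF degree_mult_le])
       (use xp in \<open>auto intro!: order_trans[OF add_mono[OF xp degree_power_le]]\<close>)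
  finally show False using i by simp
qed

text \<open>The polynomial \<open>u\<close> is the squarefree part of \<open>p\<close> with respect to the outer variable.\<close>

lemma squarefree_part:
  fixes p :: "real poly poly"
  assumes "p \<noteq> 0" "degree p \<le> d" and xp: "\<And>j. degree (coeff p j) \<le> d"
  shows "\<exists>u h. h \<noteq> 0 \<and> degree h \<le> 2 * d * d + 2 * d \<and>
     (\<forall>x. poly h x \<noteq> 0 \<longrightarrow> poly (lead_coeff u) x \<noteq> 0 \<and> spec x p \<noteq> 0 \<and>
        (\<forall>y. eval2 p (x, y) = 0 \<longleftrightarrow> eval2 u (x, y) = 0) \<and>
        (\<forall>y. eval2 u (x, y) = 0 \<longrightarrow> eval2 (pderiv u) (x, y) \<noteq> 0))"
proof -
  define g where "g = gcd p (pderiv p)"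
  have g0: "g \<noteq> 0" unfolding g_def using assms(1) gcd_eq_0_iff by blast
  obtain u v where uv: "p = u * g" "pderiv p = v * g" "coprime u v"
    using gcd_coprime_exists[of p "pderiv p"] g0 unfolding g_def by blast
  have u0: "u \<noteq> 0" using uv assms by auto
  have du: "degree u \<le> d" using assms(1,2) u0 g0 by (simp add: uv degree_mult_eq)
  have dv: "degree v \<le> degree u"
  proof (cases "v = 0")
    case False
    have "degree v + degree g \<le> degree p" 
      using degree_pderiv[of p] False g0 by (simp add: uv(2) degree_mult_eq)
    then show ?thesis using u0 g0 by (simp add: uv(1) degree_mult_eq)
  qed auto
  have xu: "degree (coeff u j) \<le> d" for j
    using factor_xdegree_le[of g u d j] assms xp uv by (simp add: mult.commute)
  have xv: "degree (coeff v j) \<le> d" for j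
  proof (cases "v = 0")
    case False
    have "degree (coeff (g * v) j) \<le> d" for j
    proof -
      have "g * v = pderiv p" using uv by (simp add: mult.commute)
      then have "coeff (g * v) j = smult (of_nat (Suc j)) (coeff p (Suc j))"
        by (simp add: coeff_pderiv of_nat_poly)
      then show ?thesis using xp[of "Suc j"] by simp
    qed
    then show ?thesis using factor_xdegree_le[of g v d j] False g0 by simp
  qed auto
  obtain a b h where h: "a * u + b * v = [:h:]" "h \<noteq> 0" "degree h \<le> 2 * d * d + d"
    using coprime_combination[OF uv(3) u0 dv du xu xv] by auto
  \<comment> \<open>The roots of the leading coefficient of \<open>p\<close> are excluded besides
    those of \<open>h\<close>: over them the degree in y drops, so that points of the curve may
    escape to infinity or the whole vertical line may lie on it.\<close>
  have "poly (lead_coeff u) x \<noteq> 0 \<and> spec x p \<noteq> 0 \<and>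
        (\<forall>y. eval2 p (x, y) = 0 \<longleftrightarrow> eval2 u (x, y) = 0) \<and>
        (\<forall>y. eval2 u (x, y) = 0 \<longrightarrow> eval2 (pderiv u) (x, y) \<noteq> 0)"
    if x: "poly (h * lead_coeff p) x \<noteq> 0" for x
  proof (intro conjI allI)
    show lu: "poly (lead_coeff u) x \<noteq> 0" using x by (simp add: uv(1) lead_coeff_mult)
    show p0: "spec x p \<noteq> 0" using x by (metis coeff_0 coeff_spec mult_zero_right poly_mult)
    define P U V G where "P = spec x p" "U = spec x u" "V = spec x v" "G = spec x g"
    have PG: "P = U * G" "pderiv P = V * G" "P \<noteq> 0"
      using uv p0 by (simp_all add: P_U_V_G_def flip: spec_mult spec_pderiv)
    have nz: "poly U y \<noteq> 0 \<or> poly V y \<noteq> 0" for y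
    proof -
      have "poly (spec x (a * u + b * v)) y = poly h x" by (simp add: h spec_const)
      then have "poly (spec x a) y * poly U y + poly (spec x b) y * poly V y \<noteq> 0"
        using x by (simp add: spec_add spec_mult P_U_V_G_def)
      then show ?thesis by auto
    qed
    \<comment> \<open>At a root, the order of \<open>P\<close> exceeds that of its derivative by
      one, and the order of \<open>G\<close> cancels. As \<open>U\<close> and \<open>V\<close> have
      no common root, a root of \<open>U\<close> then has order 1.\<close>
    have ord: "order y U = Suc (order y V)" "V \<noteq> 0" if "poly P y = 0" for y
    proof -
      have oP: "order y P = Suc (order y (pderiv P))" using order_pderiv[OF PG(3) that] .
      have "pderiv P \<noteq> 0"
        using PG(3) that by (metis degree_eq_zeroE pderiv_eq_0_iff pCons_0_0 poly_const_conv)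
      then have "order y (pderiv P) = order y V + order y G" "V \<noteq> 0"
        using PG order_mult[of V G y] by auto
      moreover have "order y P = order y U + order y G" using PG order_mult[of U G y] by auto
      ultimately show "order y U = Suc (order y V)" "V \<noteq> 0" using oP by auto
    qed
    have PU: "poly P y = 0 \<longleftrightarrow> poly U y = 0" for y
      using ord[of y] PG by (metis order_root nat.distinct(1) mult_zero_left poly_mult)
    then show "eval2 p (x, y) = 0 \<longleftrightarrow> eval2 u (x, y) = 0" for y
      by (simp add: P_U_V_G_def poly_spec)
    show "eval2 u (x, y) = 0 \<longrightarrow> eval2 (pderiv u) (x, y) \<noteq> 0" for y
    proof
      assume "eval2 u (x, y) = 0"
      then have Uy: "poly U y = 0" by (simp add: P_U_V_G_def poly_spec)
      then have Vy: "poly V y \<noteq> 0" using nz by auto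
      then have "order y V = 0" by (simp add: order_root)
      then have "order y U = 1" using ord Uy PU by auto
      moreover have "U \<noteq> 0" using PG by auto
      ultimately have "order y (pderiv U) = 0" "pderiv U \<noteq> 0" 
        using order_pderiv[of U y] Uy apply auto
        by (metis degree_eq_zeroE pderiv_eq_0_iff pCons_0_0 poly_const_conv)
      then have "poly (pderiv U) y \<noteq> 0" by (simp add: order_root)
      then show "eval2 (pderiv u) (x, y) \<noteq> 0" by (simp add: P_U_V_G_def spec_pderiv flip: poly_spec)
    qed
  qed
  moreover have "h * lead_coeff p \<noteq> 0" using h assms by simp
  moreover have "degree (h * lead_coeff p) \<le> 2 * d * d + 2 * d"
    using degree_mult_le[of h "lead_coeff p"] h xp[of "degree p"] by simp
  ultimately show ?thesis by blast
qed

section \<open>Continuous dependence of simple roots on the vertical line\<close>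

lemma root_bound:
  fixes p :: "real poly"
  assumes "poly p y = 0" "p \<noteq> 0"
  shows "\<bar>y\<bar> \<le> 1 + (\<Sum>k<degree p. \<bar>coeff p k\<bar>) / \<bar>lead_coeff p\<bar>"
proof (cases "\<bar>y\<bar> \<le> 1")
  case True
  then show ?thesis by (simp add: add_increasing2 sum_nonneg)
next
  case False
  define n where "n = degree p"
  have l: "\<bar>lead_coeff p\<bar> > 0" using assms by simp
  have n: "n > 0" using assms by (metis degree_eq_zeroE gr0I n_def poly_const_conv pCons_0_0)
  have "(\<Sum>k<n. coeff p k * y ^ k) + coeff p n * y ^ n = 0"
    using assms(1) by (simp add: poly_altdef n_def lessThan_Suc_atMost[symmetric])
  then have "\<bar>coeff p n\<bar> * \<bar>y\<bar> ^ n = \<bar>\<Sum>k<n. coeff p k * y ^ k\<bar>"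
    by (metis abs_minus_cancel abs_mult eq_neg_iff_add_eq_0 power_abs add.commute)
  also have "\<dots> \<le> (\<Sum>k<n. \<bar>coeff p k\<bar> * \<bar>y\<bar> ^ (n - 1))"
    using False by (intro order_trans[OF sum_abs] sum_mono)
      (auto simp: abs_mult power_abs intro!: mult_left_mono power_increasing)
  also have "\<dots> = (\<Sum>k<n. \<bar>coeff p k\<bar>) * \<bar>y\<bar> ^ (n - 1)" by (simp add: sum_distrib_right)
  finally have "\<bar>coeff p n\<bar> * \<bar>y\<bar> * \<bar>y\<bar> ^ (n - 1) \<le> (\<Sum>k<n. \<bar>coeff p k\<bar>) * \<bar>y\<bar> ^ (n - 1)"
    using n by (cases n) (auto simp: mult_ac)
  moreover have "\<bar>y\<bar> ^ (n - 1) > 0" using False by auto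
  ultimately have "\<bar>coeff p n\<bar> * \<bar>y\<bar> \<le> (\<Sum>k<n. \<bar>coeff p k\<bar>)" by (rule mult_right_le_imp_le)
  then show ?thesis using l by (simp add: n_def field_simps)
qed

lemma continuous_eval2 [continuous_intros]: "continuous_on A (eval2 p)"
proof -
  have "eval2 p z = (\<Sum>j\<le>degree p. poly (coeff p j) (fst z) * snd z ^ j)" for z
    unfolding eval2_def poly_altdef[of p] by (simp add: poly_sum)
  then show ?thesis by (auto intro!: continuous_intros simp: fun_eq_iff[of "eval2 p"] cong: continuous_on_cong)
qed

text \<open>The derivative keeps one sign on the interval, so the mean value theorem gives opposite
  signs on the two sides of the root. A sign change, unlike a root, visibly survives small changes
  of the polynomial.\<close>

lemma simple_root_sign_change:
  fixes p :: "real poly"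
  assumes "poly p y = 0" "0 < \<sigma>" and nz: "\<And>y'. \<bar>y' - y\<bar> \<le> \<sigma> \<Longrightarrow> poly (pderiv p) y' \<noteq> 0"
  shows "poly p (y - \<sigma>) * poly p (y + \<sigma>) < 0"
proof -
  obtain a where a: "y < a" "a < y + \<sigma>" "poly p (y + \<sigma>) = \<sigma> * poly (pderiv p) a"
    using poly_MVT[of y "y + \<sigma>" p] assms by auto
  obtain b where b: "y - \<sigma> < b" "b < y" "- poly p (y - \<sigma>) = \<sigma> * poly (pderiv p) b"
    using poly_MVT[of "y - \<sigma>" y p] assms by auto
  have "poly (pderiv p) b * poly (pderiv p) a > 0"
  proof (rule ccontr)
    assume "\<not> ?thesis"
    moreover have "poly (pderiv p) b * poly (pderiv p) a \<noteq> 0" using nz[of a] nz[of b] a b by simp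
    ultimately have "poly (pderiv p) b * poly (pderiv p) a < 0" by linarith
    from poly_IVT[OF _ this] obtain c where "b < c" "c < a" "poly (pderiv p) c = 0" using a b by auto
    then show False using nz[of c] a b by auto
  qed
  then have "- (\<sigma> * poly (pderiv p) b) * (\<sigma> * poly (pderiv p) a) < 0"
    using assms(2) by (auto simp: mult_less_0_iff zero_less_mult_iff)
  then show ?thesis using a(3) b(3) by (metis minus_minus)
qed

lemma at_most_one_root:
  fixes p :: "real poly"
  assumes nz: "\<And>y'. \<bar>y' - y\<bar> \<le> \<sigma> \<Longrightarrow> poly (pderiv p) y' \<noteq> 0"
    and "poly p a = 0" "poly p b = 0" "\<bar>a - y\<bar> \<le> \<sigma>" "\<bar>b - y\<bar> \<le> \<sigma>"
  shows "a = b"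
proof -
  have False if "a < b" "poly p a = 0" "poly p b = 0" "\<bar>a - y\<bar> \<le> \<sigma>" "\<bar>b - y\<bar> \<le> \<sigma>" for a b
    using poly_MVT[OF that(1), of p] that nz by force
  then show ?thesis using assms by (metis linorder_neqE_linordered_idom)
qed

text \<open>Disjoint intervals of radius \<sigma> are put around the roots over \<open>a\<close>.
  Over a nearby x, each contains a root by the sign change and only one since the derivative does
  not vanish there; a compactness argument excludes roots elsewhere.\<close>

lemma local_roots:
  fixes u :: "real poly poly"
  assumes lc: "poly (lead_coeff u) a \<noteq> 0"
    and simple: "\<And>y. eval2 u (a, y) = 0 \<Longrightarrow> eval2 (pderiv u) (a, y) \<noteq> 0" and "\<rho> > 0"
  shows "\<forall>\<^sub>F x in nhds a. \<exists>f. bij_betw f {y. eval2 u (a, y) = 0} {y. eval2 u (x, y) = 0} \<and>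
           (\<forall>y. eval2 u (a, y) = 0 \<longrightarrow> \<bar>f y - y\<bar> < \<rho>)"
proof -
  define Y where "Y = {y. eval2 u (a, y) = 0}"
  have cont: "isCont (eval2 p) z" for p z
    using continuous_eval2[of UNIV p] continuous_on_eq_continuous_at[OF open_UNIV] by blast
  have Y: "finite Y"
    using poly_roots_finite[of "spec a u"] lc unfolding Y_def
    by (metis (no_types, lifting) Collect_cong coeff_0 coeff_spec poly_spec)
  have lim: "((\<lambda>x. eval2 p (x, y)) \<longlongrightarrow> eval2 p (a, y)) (nhds a)" for p y
    using cont[of "(a, y)" p] by (simp add: tendsto_nhds_iff)
       (rule isCont_tendsto_compose[OF cont], auto intro!: tendsto_eq_intros)
  have e_ex: "\<exists>e>0. \<forall>x y'. \<bar>x - a\<bar> < e \<longrightarrow> \<bar>y' - y\<bar> < e \<longrightarrow> eval2 (pderiv u) (x, y') \<noteq> 0"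
    if "y \<in> Y" for y
  proof -
    have "\<forall>\<^sub>F z in nhds (a, y). eval2 (pderiv u) z \<noteq> 0"
      using cont[of "(a,y)" "pderiv u"] simple that
      by (intro tendsto_imp_eventually_ne[where c = "eval2 (pderiv u) (a, y)"])
         (auto simp: Y_def tendsto_nhds_iff isCont_def)
    then obtain e where e: "e > 0" "\<And>z. dist z (a, y) < e \<Longrightarrow> eval2 (pderiv u) z \<noteq> 0"
      by (auto simp: eventually_nhds_metric)
    show ?thesis
    proof (intro exI[of _ "e/2"] conjI allI impI)
      fix x y' assume "\<bar>x - a\<bar> < e/2" "\<bar>y' - y\<bar> < e/2"
      then have "dist (x, y') (a, y) < e"
        using sqrt_sum_squares_le_sum_abs[of "x - a" "y' - y"] by (auto simp: dist_Pair_Pair dist_real_def)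
      then show "eval2 (pderiv u) (x, y') \<noteq> 0" by (rule e)
    qed (use e in auto)
  qed
  then obtain e where e: "\<And>y. y \<in> Y \<Longrightarrow> e y > 0"
      "\<And>y x y'. y \<in> Y \<Longrightarrow> \<bar>x - a\<bar> < e y \<Longrightarrow> \<bar>y' - y\<bar> < e y \<Longrightarrow> eval2 (pderiv u) (x, y') \<noteq> 0"
    by metis
  have near0: "\<forall>\<^sub>F \<sigma> in at_right 0. \<sigma> < c" if "c > 0" for c :: real
    using that by (auto simp: eventually_at_right_field)
  have "\<forall>\<^sub>F \<sigma> in at_right 0. \<sigma> > 0 \<and> \<sigma> < \<rho> \<and>
      (\<forall>y\<in>Y. \<sigma> < e y \<and> (\<forall>y'\<in>Y - {y}. \<sigma> < \<bar>y - y'\<bar> / 2))"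
    using e(1) \<open>\<rho> > 0\<close>
    by (intro eventually_conj eventually_at_right_less eventually_ball_finite finite_Diff Y ballI near0) auto
  from eventually_happens'[OF _ this] obtain \<sigma> where \<sigma>0: "\<sigma> > 0" "\<sigma> < \<rho>"
    "\<forall>y\<in>Y. \<sigma> < e y \<and> (\<forall>y'\<in>Y - {y}. \<sigma> < \<bar>y - y'\<bar> / 2)" by auto
  have \<sigma>4: "2 * \<sigma> < \<bar>y - y'\<bar>" if "y \<in> Y" "y' \<in> Y" "y \<noteq> y'" for y y'
  proof -
    have "\<sigma> < \<bar>y - y'\<bar> / 2" using \<sigma>0(3) that by blast
    then show ?thesis by simp
  qed
  have \<sigma>: "\<sigma> > 0" "\<sigma> < \<rho>" "\<And>y. y \<in> Y \<Longrightarrow> \<sigma> < e y"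
    using \<sigma>0 by auto
  \<comment> \<open>The bound of \<open>root_bound\<close>, continuous in x where the leading
    coefficient is nonzero; it stops roots from coming in from infinity.\<close>
  define bnd where "bnd x = 1 + (\<Sum>k<degree u. \<bar>poly (coeff u k) x\<bar>) / \<bar>poly (lead_coeff u) x\<bar>" for x
  \<comment> \<open>The remaining range of possible roots, enlarged by 1 to allow for the variation
    of \<open>bnd\<close>. It is compact and free of roots over \<open>a\<close>, so by the tube
    lemma it stays free of them over nearby lines.\<close>
  define K where "K = {- (bnd a + 1)..bnd a + 1} - (\<Union>y\<in>Y. {y - \<sigma><..<y + \<sigma>})"
  have E1: "\<forall>\<^sub>F x in nhds a. \<bar>x - a\<bar> < e y" if "y \<in> Y" for y
    using e(1)[OF that] by (auto simp: eventually_nhds_metric dist_real_def)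
  have E2: "\<forall>\<^sub>F x in nhds a. eval2 u (x, y - \<sigma>) * eval2 u (x, y + \<sigma>) < 0" if "y \<in> Y" for y
  proof -
    have "eval2 u (a, y - \<sigma>) * eval2 u (a, y + \<sigma>) < 0"
      using simple_root_sign_change[of "spec a u" y \<sigma>] that \<sigma>(1,3) e(2)[OF that, of a] e(1)[OF that]
      by (force simp: poly_spec Y_def simp flip: spec_pderiv)
    then show ?thesis
      by (intro order_tendstoD(2)[OF tendsto_mult[OF lim lim]])
  qed
  have E3: "\<forall>\<^sub>F x in nhds a. poly (lead_coeff u) x \<noteq> 0"
    by (rule tendsto_imp_eventually_ne[OF _ lc]) (auto intro!: tendsto_intros simp: tendsto_nhds_iff)
  have E4: "\<forall>\<^sub>F x in nhds a. bnd x < bnd a + 1"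
  proof -
    have "isCont bnd a" unfolding bnd_def using lc by (intro continuous_intros) auto
    then have "(bnd \<longlongrightarrow> bnd a) (nhds a)" by (simp add: isCont_def tendsto_nhds_iff)
    then show ?thesis by (rule order_tendstoD) simp
  qed
  have E5: "\<forall>\<^sub>F x in nhds a. \<forall>y\<in>K. eval2 u (x, y) \<noteq> 0"
  proof -
    have "compact K" unfolding K_def
      by (intro compact_diff) auto
    moreover have "open {z. eval2 u z \<noteq> 0}" by (intro open_Collect_neq continuous_intros)
    moreover have "{a} \<times> K \<subseteq> {z. eval2 u z \<noteq> 0}" using \<sigma>(1) by (auto simp: K_def Y_def)
    ultimately obtain X where "a \<in> X" "open X" "X \<times> K \<subseteq> {z. eval2 u z \<noteq> 0}"
      using Elementary_Topology.tube_lemma by metis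
    then show ?thesis by (auto simp: eventually_nhds intro!: exI[of _ X])
  qed
  have "\<forall>\<^sub>F x in nhds a. \<forall>y\<in>Y. \<bar>x - a\<bar> < e y \<and> eval2 u (x, y - \<sigma>) * eval2 u (x, y + \<sigma>) < 0"
    by (intro eventually_ball_finite Y ballI eventually_conj E1 E2)
  with E3 E4 E5 show ?thesis
  proof eventually_elim
    case (elim x)
    define P where "P = spec x u"
    have P: "poly P y = eval2 u (x, y)" "poly (pderiv P) y = eval2 (pderiv u) (x, y)" for y
      by (simp_all add: P_def poly_spec flip: spec_pderiv)
    have nz: "poly (pderiv P) y' \<noteq> 0" if "y \<in> Y" "\<bar>y' - y\<bar> \<le> \<sigma>" for y y'
      using e(2)[OF that(1), of x y'] elim(4) \<sigma>(3)[OF that(1)] that P by auto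
    have uniq: "y1 = y2" if "y \<in> Y" "\<bar>y1 - y\<bar> \<le> \<sigma>" "\<bar>y2 - y\<bar> \<le> \<sigma>" "poly P y1 = 0" "poly P y2 = 0" for y y1 y2
      using at_most_one_root[of y \<sigma> P y1 y2] nz that by blast
    have "\<exists>y'. \<bar>y' - y\<bar> < \<sigma> \<and> poly P y' = 0" if "y \<in> Y" for y
      using poly_IVT[of "y - \<sigma>" "y + \<sigma>" P] elim(4) that \<sigma>(1) by (force simp: P)
    then obtain f where f: "\<And>y. y \<in> Y \<Longrightarrow> \<bar>f y - y\<bar> < \<sigma> \<and> poly P (f y) = 0" by metis
    have "inj_on f Y"
    proof (rule inj_onI, rule ccontr)
      fix y y' assume "y \<in> Y" "y' \<in> Y" "f y = f y'" "y \<noteq> y'"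
      then show False using f[of y] f[of y'] \<sigma>4[of y y'] by linarith
    qed
    moreover have "f ` Y = {y. eval2 u (x, y) = 0}"
    proof (intro equalityI subsetI)
      fix y assume y: "y \<in> {y. eval2 u (x, y) = 0}"
      have "P \<noteq> 0" using elim(1) by (auto simp: P_def poly_eq_iff)
      have dP: "degree P = degree u" using elim(1) by (simp add: P_def degree_spec)
      have "\<bar>y\<bar> \<le> bnd x" using root_bound[OF _ \<open>P \<noteq> 0\<close>, of y] y dP by (simp add: P bnd_def) (simp add: P_def)
      then have "y \<in> {- (bnd a + 1)..bnd a + 1}" using elim(2) by auto
      moreover have "y \<notin> K" using elim(3) y by auto
      ultimately obtain y' where y': "y' \<in> Y" "\<bar>y - y'\<bar> < \<sigma>" by (force simp: K_def)
      then have "y = f y'" using uniq[of y' y "f y'"] f[of y'] y by (auto simp: P)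
      then show "y \<in> f ` Y" using y' by auto
    qed (use f P in auto)
    ultimately have "bij_betw f Y {y. eval2 u (x, y) = 0}" by (simp add: bij_betw_def)
    then show ?case using f \<sigma>(2) unfolding Y_def by (intro exI[of _ f]) fastforce
  qed
qed

subsection \<open>Branches\<close>

definition fibre :: "(real \<times> real) set \<Rightarrow> real \<Rightarrow> real set" where
  "fibre \<gamma> x = {y. (x, y) \<in> \<gamma>}"

text \<open>The \<open>k\<close>-th point from below on a vertical line, counted from 1; the junk values at the two
  ends make the regions below the lowest and above the highest point uniform with the others.\<close>

definition branch :: "(real \<times> real) set \<Rightarrow> nat \<Rightarrow> real \<Rightarrow> ereal" where
  "branch \<gamma> k x = (if k = 0 then -\<infinity> else if k \<le> card (fibre \<gamma> x)
     then ereal (sorted_list_of_set (fibre \<gamma> x) ! (k - 1)) else \<infinity>)"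

lemma branch_in_fibre: "branch \<gamma> k x = ereal y \<Longrightarrow> y \<in> fibre \<gamma> x"
proof -
  assume *: "branch \<gamma> k x = ereal y"
  then have k: "k \<noteq> 0" "k \<le> card (fibre \<gamma> x)" by (auto simp: branch_def split: if_splits)
  then have "finite (fibre \<gamma> x)" by (intro card_ge_0_finite) simp
  then show ?thesis using * k nth_mem[of "k - 1" "sorted_list_of_set (fibre \<gamma> x)"]
    by (auto simp: branch_def)
qed

lemma fibre_branch:
  assumes "finite (fibre \<gamma> x)" "y \<in> fibre \<gamma> x"
  obtains k where "0 < k" "k \<le> card (fibre \<gamma> x)" "branch \<gamma> k x = ereal y"
proof -
  obtain i where "i < card (fibre \<gamma> x)" "sorted_list_of_set (fibre \<gamma> x) ! i = y"
    using assms by (metis in_set_conv_nth set_sorted_list_of_set length_sorted_list_of_set)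
  then show ?thesis by (intro that[of "Suc i"]) (auto simp: branch_def)
qed

lemma branch_inj:
  assumes "branch \<gamma> j x = ereal y" "branch \<gamma> k x = ereal y"
  shows "j = k"
proof -
  have "j \<noteq> 0" "k \<noteq> 0" "j \<le> card (fibre \<gamma> x)" "k \<le> card (fibre \<gamma> x)"
    using assms by (auto simp: branch_def split: if_splits)
  then show ?thesis
    using assms nth_eq_iff_index_eq[of "sorted_list_of_set (fibre \<gamma> x)" "j - 1" "k - 1"]
    by (cases j; cases k) (auto simp: branch_def)
qed

lemma branch_eq_minf: "branch \<gamma> k x = -\<infinity> \<longleftrightarrow> k = 0"
  by (auto simp: branch_def)

lemma branch_eq_pinf: "branch \<gamma> k x = \<infinity> \<longleftrightarrow> card (fibre \<gamma> x) < k"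
  by (auto simp: branch_def)

lemma branch_0: "branch \<gamma> 0 = (\<lambda>_. -\<infinity>)"
  by (auto simp: branch_def)

text \<open>The second case is that of a vertical line contained in the curve.\<close>

definition bounded_fibres :: "nat \<Rightarrow> (real \<times> real) set \<Rightarrow> bool" where
  "bounded_fibres d \<gamma> \<longleftrightarrow> (\<forall>x. if finite (fibre \<gamma> x) then card (fibre \<gamma> x) \<le> d else fibre \<gamma> x = UNIV)"

text \<open>Away from \<open>Z\<close> the curve is locally a disjoint union of graphs of continuous functions.\<close>

definition regular_off :: "real set \<Rightarrow> (real \<times> real) set \<Rightarrow> bool" where
  "regular_off Z \<gamma> \<longleftrightarrow> (\<forall>a. a \<notin> Z \<longrightarrow> finite (fibre \<gamma> a) \<and> (\<forall>\<rho>>0. \<forall>\<^sub>F x in nhds a.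
     \<exists>f. bij_betw f (fibre \<gamma> a) (fibre \<gamma> x) \<and> (\<forall>y\<in>fibre \<gamma> a. \<bar>f y - y\<bar> < \<rho>)))"

lemma sorted_list_of_set_image_strict_mono:
  fixes f :: "'a::linorder \<Rightarrow> 'b::linorder"
  assumes "finite A" "strict_mono_on A f"
  shows "sorted_list_of_set (f ` A) = map f (sorted_list_of_set A)"
proof (rule sorted_distinct_set_unique)
  show "sorted (map f (sorted_list_of_set A))"
    unfolding sorted_map
  proof (rule sorted_wrt_mono_rel[OF _ sorted_sorted_list_of_set[of A]])
    fix x y assume "x \<in> set (sorted_list_of_set A)" "y \<in> set (sorted_list_of_set A)" "x \<le> y"
    then show "f x \<le> f y" using assms strict_mono_onD[OF assms(2), of x y]
      by (cases "x = y") (auto intro: less_imp_le)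
  qed
  show "distinct (map f (sorted_list_of_set A))"
    using assms by (auto simp: distinct_map intro: strict_mono_on_imp_inj_on)
qed (use assms in auto)

text \<open>A bijection moving every point by less than half the smallest distance between two
  points is increasing, so it matches points of equal rank.\<close>

lemma branch_close:
  assumes "regular_off Z \<gamma>" "a \<notin> Z" "\<rho> > 0"
  shows "\<forall>\<^sub>F x in nhds a. card (fibre \<gamma> x) = card (fibre \<gamma> a) \<and>
     (\<forall>k y. branch \<gamma> k a = ereal y \<longrightarrow> (\<exists>y'. branch \<gamma> k x = ereal y' \<and> \<bar>y' - y\<bar> < \<rho>))"
proof -
  define Y where "Y = fibre \<gamma> a"
  have Y: "finite Y" using assms by (auto simp: regular_off_def Y_def)
  have near0: "\<forall>\<^sub>F \<sigma> in at_right 0. \<sigma> < c" if "c > 0" for c :: real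
    using that by (auto simp: eventually_at_right_field)
  have "\<forall>\<^sub>F \<sigma> in at_right 0. \<sigma> > 0 \<and> \<sigma> < \<rho> \<and> (\<forall>y\<in>Y. \<forall>y'\<in>Y - {y}. \<sigma> < \<bar>y - y'\<bar> / 2)"
    using \<open>\<rho> > 0\<close>
    by (intro eventually_conj eventually_at_right_less eventually_ball_finite finite_Diff Y ballI near0) auto
  from eventually_happens'[OF _ this] obtain \<sigma> where \<sigma>: "\<sigma> > 0" "\<sigma> < \<rho>"
    "\<forall>y\<in>Y. \<forall>y'\<in>Y - {y}. \<sigma> < \<bar>y - y'\<bar> / 2" by auto
  have "\<forall>\<^sub>F x in nhds a. \<exists>f. bij_betw f Y (fibre \<gamma> x) \<and> (\<forall>y\<in>Y. \<bar>f y - y\<bar> < \<sigma>)"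
    using assms \<sigma>(1) by (auto simp: regular_off_def Y_def)
  then show ?thesis
  proof eventually_elim
    case (elim x)
    then obtain f where f: "bij_betw f Y (fibre \<gamma> x)" "\<And>y. y \<in> Y \<Longrightarrow> \<bar>f y - y\<bar> < \<sigma>" by auto
    have mono: "strict_mono_on Y f"
    proof (rule strict_mono_onI)
      fix y y' assume y: "y \<in> Y" "y' \<in> Y" "y < y'"
      then have "\<sigma> < \<bar>y - y'\<bar> / 2" using \<sigma>(3) by blast
      then show "f y < f y'" using y f(2)[of y] f(2)[of y'] by (simp add: field_simps)
    qed
    have fx: "fibre \<gamma> x = f ` Y" using f by (simp add: bij_betw_def)
    have card: "card (fibre \<gamma> x) = card Y" using bij_betw_same_card[OF f(1)] by simp
    have sl: "sorted_list_of_set (fibre \<gamma> x) = map f (sorted_list_of_set Y)"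
      unfolding fx by (rule sorted_list_of_set_image_strict_mono[OF Y mono])
    show ?case
    proof (intro conjI allI impI)
      fix k y assume k: "branch \<gamma> k a = ereal y"
      then have "0 < k" "k \<le> card Y" "y \<in> Y" using branch_in_fibre[OF k]
        by (auto simp: branch_def Y_def split: if_splits)
      moreover from this have "branch \<gamma> k x = ereal (f y)"
        using k by (auto simp: branch_def card sl Y_def[symmetric])
      ultimately show "\<exists>y'. branch \<gamma> k x = ereal y' \<and> \<bar>y' - y\<bar> < \<rho>"
        using f(2)[of y] \<sigma>(2) by force
    qed (simp add: card Y_def)
  qed
qed

lemma eventually_branch_infinite:
  assumes "regular_off Z \<gamma>" "a \<notin> Z" "branch \<gamma> k a = \<infinity>"
  shows "\<forall>\<^sub>F x in nhds a. branch \<gamma> k x = \<infinity>"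
proof -
  have "\<forall>\<^sub>F x in nhds a. card (fibre \<gamma> x) = card (fibre \<gamma> a)"
    using branch_close[OF assms(1,2) zero_less_one] by (rule eventually_mono) blast
  then show ?thesis by (rule eventually_mono) (metis assms(3) branch_eq_pinf)
qed

lemma tendsto_branch:
  assumes "regular_off Z \<gamma>" "a \<notin> Z"
  shows "(branch \<gamma> k \<longlongrightarrow> branch \<gamma> k a) (nhds a)"
proof (cases "branch \<gamma> k a")
  case (real y)
  have ev: "\<forall>\<^sub>F x in nhds a. ereal (real_of_ereal (branch \<gamma> k x)) = branch \<gamma> k x"
    using branch_close[OF assms zero_less_one]
    by eventually_elim (metis real real_of_ereal.simps(1))
  have "((\<lambda>x. real_of_ereal (branch \<gamma> k x)) \<longlongrightarrow> y) (nhds a)"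
  proof (rule tendstoI)
    fix e :: real assume "e > 0"
    from branch_close[OF assms this] show "\<forall>\<^sub>F x in nhds a. dist (real_of_ereal (branch \<gamma> k x)) y < e"
      by eventually_elim (metis real real_of_ereal.simps(1) dist_real_def)
  qed
  then have "((\<lambda>x. ereal (real_of_ereal (branch \<gamma> k x))) \<longlongrightarrow> ereal y) (nhds a)"
    by (rule tendsto_ereal)
  then show ?thesis unfolding real
    by (rule Lim_transform_eventually[OF _ ev])
next
  case PInf
  show ?thesis unfolding PInf by (rule tendsto_eventually[OF eventually_branch_infinite[OF assms PInf]])
next
  case MInf
  then have "k = 0" using branch_eq_minf by blast
  then show ?thesis by (simp only: branch_0 tendsto_const)
qed

text \<open>The sets \<open>I e\<close> of points reachable from \<open>x\<close> without leaving
  \<open>Q e\<close> are intervals around \<open>x\<close>. On either side of \<open>x\<close> such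
  sets are nested, so one index attains the smallest on the right and one the smallest on the
  left.\<close>

lemma common_subinterval:
  fixes Q :: "'e \<Rightarrow> real \<Rightarrow> bool"
  assumes "finite E" "E \<noteq> {}"
  shows "\<exists>e\<^sub>1\<in>E. \<exists>e\<^sub>2\<in>E. \<forall>x'. (\<forall>w\<in>closed_segment x x'. Q e\<^sub>1 w \<and> Q e\<^sub>2 w) \<longrightarrow>
           (\<forall>w\<in>closed_segment x x'. \<forall>e\<in>E. Q e w)"
proof -
  define I where "I e = {x'. \<forall>w\<in>closed_segment x x'. Q e w}" for e
  have sub: "w \<in> I e" if "x' \<in> I e" "w \<in> closed_segment x x'" for w x' e
  proof -
    have "closed_segment x w \<subseteq> closed_segment x x'" using that by (simp add: subset_closed_segment)
    then show ?thesis using that by (auto simp: I_def)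
  qed
  have R: "\<exists>e\<in>E. \<forall>e'\<in>E. I e \<inter> {x..} \<subseteq> I e'"
    using assms
  proof (induction rule: finite_ne_induct)
    case (insert e F)
    then obtain e1 where e1: "e1 \<in> F" "\<forall>e'\<in>F. I e1 \<inter> {x..} \<subseteq> I e'" by auto
    show ?case
    proof (cases "I e1 \<inter> {x..} \<subseteq> I e")
      case False
      then obtain p where p: "p \<in> I e1" "p \<ge> x" "p \<notin> I e" by auto
      have "q \<in> I e1" if "q \<in> I e" "q \<ge> x" for q
        using sub[OF that(1), of p] sub[OF p(1), of q] p that
        by (cases "q \<le> p") (auto simp: closed_segment_eq_real_ivl)
      then show ?thesis using e1 by (intro bexI[of _ e]) auto
    qed (use e1 in auto)
  qed auto
  have L: "\<exists>e\<in>E. \<forall>e'\<in>E. I e \<inter> {..x} \<subseteq> I e'"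
    using assms
  proof (induction rule: finite_ne_induct)
    case (insert e F)
    then obtain e1 where e1: "e1 \<in> F" "\<forall>e'\<in>F. I e1 \<inter> {..x} \<subseteq> I e'" by auto
    show ?case
    proof (cases "I e1 \<inter> {..x} \<subseteq> I e")
      case False
      then obtain p where p: "p \<in> I e1" "p \<le> x" "p \<notin> I e" by auto
      have "q \<in> I e1" if "q \<in> I e" "q \<le> x" for q
        using sub[OF that(1), of p] sub[OF p(1), of q] p that
        by (cases "q \<ge> p") (auto simp: closed_segment_eq_real_ivl)
      then show ?thesis using e1 by (intro bexI[of _ e]) auto
    qed (use e1 in auto)
  qed auto
  from R L obtain e1 e2 where e: "e1 \<in> E" "e2 \<in> E" "\<forall>e'\<in>E. I e1 \<inter> {x..} \<subseteq> I e'" "\<forall>e'\<in>E. I e2 \<inter> {..x} \<subseteq> I e'"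
    by blast
  have "\<forall>w\<in>closed_segment x x'. \<forall>e\<in>E. Q e w" if "\<forall>w\<in>closed_segment x x'. Q e1 w \<and> Q e2 w" for x'
  proof -
    have "x' \<in> I e1" "x' \<in> I e2" using that by (auto simp: I_def)
    then have "\<forall>e'\<in>E. x' \<in> I e'" using e by (cases x x' rule: le_cases) auto
    then show ?thesis by (auto simp: I_def)
  qed
  then show ?thesis using e by blast
qed

subsection \<open>Vertical decomposition\<close>

text \<open>All that the incidence bounds use about algebraic curves: \<open>d\<close> bounds the
  points on a vertical line, \<open>D\<close> the critical lines of a curve and \<open>r\<close> the
  points common to two curves.\<close>

locale curve_family =
  fixes \<C> :: "(real \<times> real) set set" and crit :: "(real \<times> real) set \<Rightarrow> real set" and d D r :: nat
  assumes finite_crit: "\<gamma> \<in> \<C> \<Longrightarrow> finite (crit \<gamma>)"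
    and card_crit: "\<gamma> \<in> \<C> \<Longrightarrow> card (crit \<gamma>) \<le> D"
    and closed_curve: "\<gamma> \<in> \<C> \<Longrightarrow> closed \<gamma>"
    and bounded_fibres: "\<gamma> \<in> \<C> \<Longrightarrow> bounded_fibres d \<gamma>"
    and regular: "\<gamma> \<in> \<C> \<Longrightarrow> regular_off (crit \<gamma>) \<gamma>"
    and finite_Int: "\<gamma> \<in> \<C> \<Longrightarrow> \<delta> \<in> \<C> \<Longrightarrow> \<gamma> \<noteq> \<delta> \<Longrightarrow> finite (\<gamma> \<inter> \<delta>)"
    and card_Int: "\<gamma> \<in> \<C> \<Longrightarrow> \<delta> \<in> \<C> \<Longrightarrow> \<gamma> \<noteq> \<delta> \<Longrightarrow> card (\<gamma> \<inter> \<delta>) \<le> r"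
begin

text \<open>The indices 0 and \<open>Suc d\<close> contribute the constants -\<infinity> and
  \<infinity>, so that unbounded regions also have a bottom and a top branch.\<close>

definition branches :: "(real \<times> real) set set \<Rightarrow> (real \<Rightarrow> ereal) set" where
  "branches S = {branch \<gamma> k | \<gamma> k. \<gamma> \<in> S \<and> k \<le> Suc d}"

definition vertex_at :: "(real \<times> real) set set \<Rightarrow> real \<Rightarrow> ereal \<Rightarrow> bool" where
  "vertex_at S x v \<longleftrightarrow> (\<exists>\<gamma>\<in>S. \<exists>\<delta>\<in>S. \<gamma> \<noteq> \<delta> \<and> (\<exists>y. v = ereal y \<and> (x, y) \<in> \<gamma> \<inter> \<delta>))"

text \<open>Over \<open>x\<close> the branch \<open>g\<close> is the next one above \<open>f\<close>, and no other curve passes through their end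
  points. The last clause singles out one of the many branches with constant value \<open>\<infinity>\<close>, so that \<open>f\<close>
  determines \<open>g\<close>.\<close>

definition gap :: "(real \<times> real) set set \<Rightarrow> (real \<Rightarrow> ereal) \<Rightarrow> (real \<Rightarrow> ereal) \<Rightarrow> real \<Rightarrow> bool" where
  "gap S f g x \<longleftrightarrow> (\<forall>\<gamma>\<in>S. x \<notin> crit \<gamma>) \<and> f x < g x \<and> (\<forall>h\<in>branches S. h x \<le> f x \<or> g x \<le> h x) \<and>
     \<not> vertex_at S x (f x) \<and> \<not> vertex_at S x (g x) \<and> (g x = \<infinity> \<longrightarrow> g = (\<lambda>_. \<infinity>))"

text \<open>The connected component of \<open>x\<close> in the set where \<open>gap S f g\<close>
  holds.\<close>

definition gap_interval :: "(real \<times> real) set set \<Rightarrow> (real \<Rightarrow> ereal) \<Rightarrow> (real \<Rightarrow> ereal) \<Rightarrow> real \<Rightarrow> real set" where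
  "gap_interval S f g x = {x'. \<forall>w\<in>closed_segment x x'. gap S f g w}"

definition region :: "(real \<times> real) set set \<Rightarrow> (real \<Rightarrow> ereal) \<Rightarrow> (real \<Rightarrow> ereal) \<Rightarrow> real \<Rightarrow> (real \<times> real) set" where
  "region S f g x = {(x', y). x' \<in> gap_interval S f g x \<and> f x' < ereal y \<and> ereal y < g x'}"

text \<open>The trapezoids of the vertical decomposition, cut in addition along the full vertical line
  through every critical abscissa of a curve of \<open>S\<close>.\<close>

definition cells :: "(real \<times> real) set set \<Rightarrow> (real \<times> real) set set" where
  "cells S = {region S f g x | f g x. f \<in> branches S \<and> g \<in> branches S \<and> gap S f g x}"

section \<open>Branches of a finite set of curves\<close>

lemma branch_top: "\<gamma> \<in> \<C> \<Longrightarrow> branch \<gamma> (Suc d) = (\<lambda>_. \<infinity>)"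
proof
  fix x assume "\<gamma> \<in> \<C>"
  then have "card (fibre \<gamma> x) < Suc d"
    using bounded_fibres[of \<gamma>] by (auto simp: bounded_fibres_def less_Suc_eq_le split: if_splits)
  then show "branch \<gamma> (Suc d) x = \<infinity>" by (simp add: branch_eq_pinf)
qed

lemma top_in_branches: "S \<subseteq> \<C> \<Longrightarrow> S \<noteq> {} \<Longrightarrow> (\<lambda>_. \<infinity>) \<in> branches S"
proof -
  assume "S \<subseteq> \<C>" "S \<noteq> {}"
  then obtain \<gamma> where "\<gamma> \<in> S" "\<gamma> \<in> \<C>" by auto
  then have "branch \<gamma> (Suc d) \<in> branches S" unfolding branches_def by blast
  then show ?thesis using branch_top[OF \<open>\<gamma> \<in> \<C>\<close>] by simp
qed

lemma bot_in_branches: "S \<noteq> {} \<Longrightarrow> (\<lambda>_. -\<infinity>) \<in> branches S"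
proof -
  assume "S \<noteq> {}"
  then obtain \<gamma> where "\<gamma> \<in> S" by auto
  then have "branch \<gamma> 0 \<in> branches S" unfolding branches_def by blast
  then show ?thesis by (simp add: branch_0)
qed

lemma finite_branches: "finite S \<Longrightarrow> finite (branches S)"
  and card_branches: "finite S \<Longrightarrow> card (branches S) \<le> card S * (d + 2)"
proof -
  have eq: "branches S = case_prod branch ` (S \<times> {..Suc d})" by (auto simp: branches_def)
  assume "finite S"
  then show "finite (branches S)" "card (branches S) \<le> card S * (d + 2)" unfolding eq
    by (auto intro: order_trans[OF card_image_le] simp: card_cartesian_product)
qed

lemma on_curve_branch:
  assumes "\<gamma> \<in> S" "S \<subseteq> \<C>" "finite (fibre \<gamma> x)" "(x, y) \<in> \<gamma>"
  shows "\<exists>h\<in>branches S. h x = ereal y"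
proof -
  obtain k where k: "k \<le> card (fibre \<gamma> x)" "branch \<gamma> k x = ereal y"
    using fibre_branch[of \<gamma> x y] assms by (auto simp: fibre_def)
  have "card (fibre \<gamma> x) \<le> d" using assms bounded_fibres[of \<gamma>] by (auto simp: bounded_fibres_def)
  then have "branch \<gamma> k \<in> branches S" using k(1) assms(1) unfolding branches_def by fastforce
  then show ?thesis using k(2) by blast
qed

section \<open>Stability of gaps when the abscissa moves\<close>

lemma finite_fibre: "\<gamma> \<in> \<C> \<Longrightarrow> x \<notin> crit \<gamma> \<Longrightarrow> finite (fibre \<gamma> x)"
  by (rule regular[unfolded regular_off_def, THEN spec, THEN mp, THEN conjunct1])

lemma tendsto_branches:
  assumes "S \<subseteq> \<C>" "h \<in> branches S" "\<forall>\<gamma>\<in>S. a \<notin> crit \<gamma>"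
  shows "(h \<longlongrightarrow> h a) (nhds a)"
proof -
  obtain \<gamma> k where h: "h = branch \<gamma> k" "\<gamma> \<in> S" using assms(2) unfolding branches_def by blast
  then have "\<gamma> \<in> \<C>" "a \<notin> crit \<gamma>" using assms by auto
  then show ?thesis unfolding h(1) using tendsto_branch[OF regular] by blast
qed

text \<open>Two branches with the same real value away from a vertex belong to one curve and hence
  have the same index. The value \<infinity> may be shared by different branches, but it persists
  nearby.\<close>

lemma branches_eventually_eq:
  assumes "S \<subseteq> \<C>" "h \<in> branches S" "h' \<in> branches S" "\<forall>\<gamma>\<in>S. a \<notin> crit \<gamma>"
    "h a = h' a" "\<not> vertex_at S a (h a)"
  shows "\<forall>\<^sub>F x in nhds a. h x = h' x"
proof -
  obtain \<gamma> k \<gamma>' k' where h: "h = branch \<gamma> k" "\<gamma> \<in> S" "h' = branch \<gamma>' k'" "\<gamma>' \<in> S"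
    using assms(2,3) by (auto simp: branches_def)
  show ?thesis
  proof (cases "h a")
    case (real y)
    have "y \<in> fibre \<gamma> a" "y \<in> fibre \<gamma>' a" using real assms(5) h branch_in_fibre by metis+
    then have "\<gamma> = \<gamma>'" using assms(6) h real by (auto simp: vertex_at_def fibre_def)
    then have "h = h'" using branch_inj real assms(5) h by metis
    then show ?thesis by simp
  next
    case PInf
    have "\<forall>\<^sub>F x in nhds a. h x = \<infinity>" "\<forall>\<^sub>F x in nhds a. h' x = \<infinity>"
      using PInf assms h eventually_branch_infinite[OF regular] by auto
    then show ?thesis by eventually_elim simp
  next
    case MInf
    then have "k = 0" "k' = 0" using h assms(5) branch_eq_minf by metis+
    then show ?thesis using h by (simp add: branch_0)
  qed
qed

lemma branches_eventually_less:
  assumes "S \<subseteq> \<C>" "h \<in> branches S" "h' \<in> branches S" "\<forall>\<gamma>\<in>S. a \<notin> crit \<gamma>" "h a < h' a"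
  shows "\<forall>\<^sub>F x in nhds a. h x < h' x"
proof -
  obtain z where z: "h a < z" "z < h' a" using assms(5) dense by blast
  have "\<forall>\<^sub>F x in nhds a. h x < z" "\<forall>\<^sub>F x in nhds a. z < h' x"
    using order_tendstoD[OF tendsto_branches[OF assms(1,2,4)]] order_tendstoD[OF tendsto_branches[OF assms(1,3,4)]] z
    by auto
  then show ?thesis by eventually_elim simp
qed

lemma branches_order_locally_constant:
  assumes "S \<subseteq> \<C>" "h \<in> branches S" "h' \<in> branches S" "\<forall>\<gamma>\<in>S. a \<notin> crit \<gamma>" "\<not> vertex_at S a (h a)"
  shows "\<forall>\<^sub>F x in nhds a. (h x < h' x \<longleftrightarrow> h a < h' a) \<and> (h x = h' x \<longleftrightarrow> h a = h' a)"
proof -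
  consider "h a < h' a" | "h a = h' a" | "h' a < h a" by fastforce
  then show ?thesis
  proof cases
    case 1
    from branches_eventually_less[OF assms(1-4) 1] show ?thesis
      by eventually_elim (use 1 in auto)
  next
    case 2
    from branches_eventually_eq[OF assms(1-4) 2 assms(5)] show ?thesis
      by eventually_elim (use 2 in auto)
  next
    case 3
    from branches_eventually_less[OF assms(1,3,2,4) 3] show ?thesis
      by eventually_elim (use 3 in auto)
  qed
qed

lemma finite_vertex_lines:
  assumes "S \<subseteq> \<C>" "finite S"
  shows "finite {x. \<exists>v. vertex_at S x v}"
proof -
  have "{x. \<exists>v. vertex_at S x v} \<subseteq> (\<Union>\<gamma>\<in>S. \<Union>\<delta>\<in>S - {\<gamma>}. fst ` (\<gamma> \<inter> \<delta>))"
  proof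
    fix x assume "x \<in> {x. \<exists>v. vertex_at S x v}"
    then obtain \<gamma> \<delta> y where "\<gamma> \<in> S" "\<delta> \<in> S" "\<gamma> \<noteq> \<delta>" "(x, y) \<in> \<gamma> \<inter> \<delta>" unfolding vertex_at_def by blast
    then show "x \<in> (\<Union>\<gamma>\<in>S. \<Union>\<delta>\<in>S - {\<gamma>}. fst ` (\<gamma> \<inter> \<delta>))"
      by (intro UN_I[of \<gamma>] UN_I[of \<delta>] image_eqI[of _ _ "(x, y)"]) auto
  qed
  moreover have "finite \<dots>" using assms finite_Int by (intro finite_UN_I finite_imageI) auto
  ultimately show ?thesis by (rule finite_subset)
qed

lemma eventually_not_in_finite:
  fixes A :: "real set"
  assumes "finite A"
  shows "\<forall>\<^sub>F x in nhds a. x \<noteq> a \<longrightarrow> x \<notin> A"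
proof -
  have "open (- (A - {a}))" using assms by (intro open_Compl finite_imp_closed) auto
  then show ?thesis by (auto simp: eventually_nhds intro!: exI[of _ "- (A - {a})"])
qed

text \<open>The order relations that define a gap are locally constant, so a single nearby instance
  carries over to \<open>a\<close> and from there to a neighbourhood. Hence a gap can end only at a
  critical line or at a vertex on \<open>f\<close> or \<open>g\<close>.\<close>

lemma eventually_gap:
  assumes S: "S \<subseteq> \<C>" "finite S" "S \<noteq> {}" and fg: "f \<in> branches S" "g \<in> branches S"
    and a: "\<forall>\<gamma>\<in>S. a \<notin> crit \<gamma>" "\<not> vertex_at S a (f a)" "\<not> vertex_at S a (g a)"
    and freq: "\<exists>\<^sub>F x in nhds a. gap S f g x"
  shows "\<forall>\<^sub>F x in nhds a. gap S f g x"
proof -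
  \<comment> \<open>The point \<open>a\<close> is exempt from the vertex condition, since its
    vertical line may contain vertices away from \<open>f\<close> and \<open>g\<close>.\<close>
  have "\<forall>\<^sub>F x in nhds a. (x \<noteq> a \<longrightarrow> x \<notin> (\<Union>\<gamma>\<in>S. crit \<gamma>)) \<and> (x \<noteq> a \<longrightarrow> x \<notin> {x. \<exists>v. vertex_at S x v}) \<and>
     (\<forall>h\<in>branches S. ((f x < h x \<longleftrightarrow> f a < h a) \<and> (f x = h x \<longleftrightarrow> f a = h a)) \<and>
                      ((g x < h x \<longleftrightarrow> g a < h a) \<and> (g x = h x \<longleftrightarrow> g a = h a)))"
    using S finite_crit
    by (intro eventually_conj eventually_not_in_finite finite_vertex_lines finite_UN_I eventually_ball_finite
          finite_branches ballI branches_order_locally_constant[OF S(1) _ _ a(1)] fg a) auto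
  then have "\<forall>\<^sub>F x in nhds a. (\<forall>\<gamma>\<in>S. x \<notin> crit \<gamma>) \<and> \<not> vertex_at S x (f x) \<and> \<not> vertex_at S x (g x) \<and>
     (f x < g x \<longleftrightarrow> f a < g a) \<and> (g x = \<infinity> \<longleftrightarrow> g a = \<infinity>) \<and>
     (\<forall>h\<in>branches S. (h x \<le> f x \<longleftrightarrow> h a \<le> f a) \<and> (g x \<le> h x \<longleftrightarrow> g a \<le> h a))"
  proof (rule eventually_mono, goal_cases)
    case (1 x)
    have "g x = \<infinity> \<longleftrightarrow> g a = \<infinity>" using 1 top_in_branches[OF S(1,3)] by force
    moreover have "f x < g x \<longleftrightarrow> f a < g a" using 1 fg by blast
    moreover have "(\<forall>\<gamma>\<in>S. x \<notin> crit \<gamma>) \<and> \<not> vertex_at S x (f x) \<and> \<not> vertex_at S x (g x)"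
      using 1 a by (cases "x = a") auto
    ultimately show ?case using 1 by (auto simp: not_less[symmetric])
  qed
  note ev = this
  from frequently_ex[OF frequently_eventually_frequently[OF freq ev]]
  obtain x0 where "gap S f g x0" "(f x0 < g x0 \<longleftrightarrow> f a < g a) \<and> (g x0 = \<infinity> \<longleftrightarrow> g a = \<infinity>) \<and>
     (\<forall>h\<in>branches S. (h x0 \<le> f x0 \<longleftrightarrow> h a \<le> f a) \<and> (g x0 \<le> h x0 \<longleftrightarrow> g a \<le> h a))"
    by blast
  then have "f a < g a" "\<forall>h\<in>branches S. h a \<le> f a \<or> g a \<le> h a" "g a = \<infinity> \<longrightarrow> g = (\<lambda>_. \<infinity>)"
    unfolding gap_def by blast+
  note at_a = this
  from ev show ?thesis
    by (rule eventually_mono) (unfold gap_def, use at_a in blast)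
qed

text \<open>Together with its counterpart below, this recovers a cell from one of its two branches
  and any abscissa over which it lies.\<close>

lemma gap_unique_above:
  assumes "f \<in> branches S" "g \<in> branches S" "g' \<in> branches S" "gap S f g x" "gap S f g' x"
  shows "g = g'"
proof -
  have eq: "g x = g' x"
    using assms unfolding gap_def by (metis antisym leD)
  obtain \<gamma> k \<gamma>' k' where g: "g = branch \<gamma> k" "\<gamma> \<in> S" "g' = branch \<gamma>' k'" "\<gamma>' \<in> S"
    using assms by (auto simp: branches_def)
  show ?thesis
  proof (cases "g x")
    case (real y)
    have "y \<in> fibre \<gamma> x" "y \<in> fibre \<gamma>' x" using real eq g branch_in_fibre by metis+
    then have "\<gamma> = \<gamma>'" using assms(4) g real by (auto simp: vertex_at_def fibre_def gap_def)
    then show ?thesis using branch_inj real eq g by metis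
  next
    case PInf
    then have "g = (\<lambda>_. \<infinity>)" "g' = (\<lambda>_. \<infinity>)" using assms(4,5) eq unfolding gap_def by metis+
    then show ?thesis by simp
  next
    case MInf
    then show ?thesis using assms by (auto simp: gap_def)
  qed
qed

lemma gap_unique_below:
  assumes "f \<in> branches S" "f' \<in> branches S" "g \<in> branches S" "gap S f g x" "gap S f' g x"
  shows "f = f'"
proof -
  have eq: "f x = f' x"
    using assms unfolding gap_def by (metis antisym leD)
  obtain \<gamma> k \<gamma>' k' where f: "f = branch \<gamma> k" "\<gamma> \<in> S" "f' = branch \<gamma>' k'" "\<gamma>' \<in> S"
    using assms by (auto simp: branches_def)
  show ?thesis
  proof (cases "f x")
    case (real y)
    have "y \<in> fibre \<gamma> x" "y \<in> fibre \<gamma>' x" using real eq f branch_in_fibre by metis+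
    then have "\<gamma> = \<gamma>'" using assms(4) f real by (auto simp: vertex_at_def fibre_def gap_def)
    then show ?thesis using branch_inj real eq f by metis
  next
    case MInf
    then have "k = 0" "k' = 0" using f eq branch_eq_minf by metis+
    then show ?thesis using f by (simp add: branch_0)
  next
    case PInf
    then show ?thesis using assms by (auto simp: gap_def)
  qed
qed

section \<open>Cells and the curves that determine them\<close>

lemma cell_disjoint_curve:
  assumes "S \<subseteq> \<C>" "c \<in> cells S" "\<gamma> \<in> S"
  shows "\<gamma> \<inter> c = {}"
proof (rule ccontr)
  assume "\<gamma> \<inter> c \<noteq> {}"
  then obtain x' y where xy: "(x', y) \<in> \<gamma>" "(x', y) \<in> c" by auto
  obtain f g x where "c = region S f g x" using assms(2) by (auto simp: cells_def)
  then have g: "gap S f g x'" "f x' < ereal y" "ereal y < g x'" using xy(2)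
    by (auto simp: region_def gap_interval_def)
  then have "finite (fibre \<gamma> x')" using assms by (intro finite_fibre) (auto simp: gap_def)
  from on_curve_branch[OF assms(3,1) this xy(1)] obtain h where "h \<in> branches S" "h x' = ereal y" by auto
  then show False using g unfolding gap_def by (metis leD)
qed

lemma gap_mono: "gap S f g x \<Longrightarrow> S' \<subseteq> S \<Longrightarrow> gap S' f g x"
proof -
  assume g: "gap S f g x" and sub: "S' \<subseteq> S"
  have "vertex_at S' x v \<Longrightarrow> vertex_at S x v" for v using sub unfolding vertex_at_def by blast
  moreover have "branches S' \<subseteq> branches S" using sub unfolding branches_def by blast
  ultimately show ?thesis using g sub unfolding gap_def by (meson subsetD)
qed

text \<open>Each clause of \<open>gap\<close> concerns a single curve or, for a vertex, two curves.
  The branches \<open>f\<close> and \<open>g\<close> are held fixed and need not come from the pair.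
  The indices in \<open>common_subinterval\<close> can thus be taken to be pairs, which is why two
  indices cost four curves.\<close>

lemma gap_pairs: "S \<noteq> {} \<Longrightarrow> gap S f g x \<longleftrightarrow> (\<forall>p\<in>S \<times> S. gap {fst p, snd p} f g x)"
proof
  assume "S \<noteq> {}" and *: "\<forall>p\<in>S \<times> S. gap {fst p, snd p} f g x"
  then have **: "gap {\<gamma>, \<delta>} f g x" if "\<gamma> \<in> S" "\<delta> \<in> S" for \<gamma> \<delta> using that by force
  obtain \<gamma>0 where "\<gamma>0 \<in> S" using \<open>S \<noteq> {}\<close> by auto
  have nv: "\<not> vertex_at S x v" if "v = f x \<or> v = g x" for v
  proof
    assume "vertex_at S x v"
    then obtain \<gamma> \<delta> where "\<gamma> \<in> S" "\<delta> \<in> S" "vertex_at {\<gamma>, \<delta>} x v" unfolding vertex_at_def by blast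
    then show False using **[of \<gamma> \<delta>] that unfolding gap_def by blast
  qed
  have "h x \<le> f x \<or> g x \<le> h x" if h: "h \<in> branches S" for h
  proof -
    obtain \<gamma> k where "\<gamma> \<in> S" "h = branch \<gamma> k" "k \<le> Suc d" using h by (auto simp: branches_def)
    then have "h \<in> branches {\<gamma>, \<gamma>}" "gap {\<gamma>, \<gamma>} f g x" using **[of \<gamma> \<gamma>] by (auto simp: branches_def)
    then show ?thesis unfolding gap_def by blast
  qed
  moreover have "x \<notin> crit \<gamma>" if "\<gamma> \<in> S" for \<gamma>
    using **[OF that that] unfolding gap_def by blast
  moreover have "f x < g x" "g x = \<infinity> \<longrightarrow> g = (\<lambda>_. \<infinity>)"
    using **[OF \<open>\<gamma>0 \<in> S\<close> \<open>\<gamma>0 \<in> S\<close>] unfolding gap_def by blast+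
  ultimately show "gap S f g x" using nv unfolding gap_def by blast
qed (auto intro: gap_mono)

text \<open>Two curves carry the bottom and the top; one pair of curves blocks the interval on the left and
  another pair on the right.\<close>

lemma cell_determined_by_six:
  assumes "S \<subseteq> \<C>" "finite S" "c \<in> cells S"
  shows "\<exists>S'\<subseteq>S. S' \<noteq> {} \<and> card S' \<le> 6 \<and> c \<in> cells S'"
proof -
  obtain f g x where c: "c = region S f g x" "f \<in> branches S" "g \<in> branches S" "gap S f g x"
    using assms(3) by (auto simp: cells_def)
  obtain \<gamma> \<delta> k l where fg: "f = branch \<gamma> k" "g = branch \<delta> l" "\<gamma> \<in> S" "\<delta> \<in> S" "k \<le> Suc d" "l \<le> Suc d"
    using c by (auto simp: branches_def)
  have "S \<noteq> {}" using fg by auto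
  then have "finite (S \<times> S)" "S \<times> S \<noteq> {}" using assms(2) by auto
  from common_subinterval[OF this, of x "\<lambda>e w. gap {fst e, snd e} f g w"]
  obtain p q where pq: "p \<in> S \<times> S" "q \<in> S \<times> S"
    "\<forall>x'. (\<forall>w\<in>closed_segment x x'. gap {fst p, snd p} f g w \<and> gap {fst q, snd q} f g w) \<longrightarrow>
           (\<forall>w\<in>closed_segment x x'. \<forall>e\<in>S\<times>S. gap {fst e, snd e} f g w)"
    by blast
  define S' where "S' = set [\<gamma>, \<delta>, fst p, snd p, fst q, snd q]"
  have S': "S' \<subseteq> S" "S' \<noteq> {}" "{fst p, snd p} \<subseteq> S'" "{fst q, snd q} \<subseteq> S'"
    using fg pq by (auto simp: S'_def)
  have card: "card S' \<le> 6"
    unfolding S'_def by (rule order_trans[OF card_length]) simp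
  have I: "gap_interval S' f g x = gap_interval S f g x"
  proof (intro equalityI subsetI)
    fix x' assume "x' \<in> gap_interval S' f g x"
    then have "\<forall>w\<in>closed_segment x x'. gap {fst p, snd p} f g w \<and> gap {fst q, snd q} f g w"
      using gap_mono[OF _ S'(3)] gap_mono[OF _ S'(4)] by (auto simp: gap_interval_def)
    then have "\<forall>w\<in>closed_segment x x'. \<forall>e\<in>S\<times>S. gap {fst e, snd e} f g w" using pq(3) by blast
    then show "x' \<in> gap_interval S f g x"
      by (auto simp: gap_interval_def gap_pairs[OF \<open>S \<noteq> {}\<close>])
  qed (use gap_mono[OF _ S'(1)] in \<open>auto simp: gap_interval_def\<close>)
  have "c = region S' f g x" using c I by (simp add: region_def)
  moreover have "f \<in> branches S'" "g \<in> branches S'" using fg by (auto simp: branches_def S'_def)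
  ultimately have "c \<in> cells S'" using gap_mono[OF c(4) S'(1)] unfolding cells_def by blast
  then show ?thesis using S' card by blast
qed

lemma gap_interval_self: "gap S f g x \<Longrightarrow> x \<in> gap_interval S f g x"
  by (simp add: gap_interval_def)

lemma gap_interval_eq:
  assumes "w \<in> gap_interval S f g x"
  shows "gap_interval S f g w = gap_interval S f g x"
proof -
  have w: "\<forall>v\<in>closed_segment x w. gap S f g v" using assms by (simp add: gap_interval_def)
  have "closed_segment w x' \<subseteq> closed_segment x w \<union> closed_segment x x'"
    "closed_segment x x' \<subseteq> closed_segment x w \<union> closed_segment w x'" for x'
    by (auto simp: closed_segment_eq_real_ivl split: if_splits)
  with w show ?thesis unfolding gap_interval_def by blast
qed

section \<open>Left ends of cells and the number of cells\<close>

lemma gap_open: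
  assumes "S \<subseteq> \<C>" "finite S" "f \<in> branches S" "g \<in> branches S" "\<exists>\<^sub>F x in nhds a. gap S f g x"
    "\<forall>\<gamma>\<in>S. a \<notin> crit \<gamma>" "\<not> vertex_at S a (f a)" "\<not> vertex_at S a (g a)"
  shows "\<exists>e>0. \<forall>w. \<bar>w - a\<bar> < e \<longrightarrow> gap S f g w"
proof -
  have "S \<noteq> {}" using assms(3) by (auto simp: branches_def)
  then have "\<forall>\<^sub>F x in nhds a. gap S f g x" using assms by (intro eventually_gap) auto
  then show ?thesis by (simp add: eventually_nhds_metric dist_real_def)
qed

text \<open>The filter \<open>at_bot\<close> is the left end of the cells that are unbounded to the
  left; as a filter it needs no separate treatment.\<close>

definition crit_ends :: "(real \<times> real) set set \<Rightarrow> real filter set" where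
  "crit_ends S = insert at_bot (at_right ` (\<Union>\<gamma>\<in>S. crit \<gamma>))"

definition vertex_ends :: "(real \<times> real) set set \<Rightarrow> (real filter \<times> (real \<Rightarrow> ereal)) set" where
  "vertex_ends S = {(at_right a, h) | a h. h \<in> branches S \<and> vertex_at S a (h a)}"

text \<open>Cells are charged to their left ends, represented as filters: a cell that ends at neither a
  critical line nor \<open>-\<infinity>\<close> has a vertex of the arrangement on its bottom or top branch.\<close>

lemma left_end:
  assumes S: "S \<subseteq> \<C>" "finite S" and fg: "f \<in> branches S" "g \<in> branches S" and x: "gap S f g x"
  shows "\<exists>F. F \<noteq> bot \<and> (\<forall>\<^sub>F w in F. w \<in> gap_interval S f g x) \<and>
           (F \<in> crit_ends S \<or> (F, f) \<in> vertex_ends S \<or> (F, g) \<in> vertex_ends S)"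
proof -
  define I where "I = gap_interval S f g x"
  have conv: "w \<in> I" if "i \<in> I" "i \<le> w" "w \<le> x" for i w
    using that by (auto simp: I_def gap_interval_def closed_segment_eq_real_ivl split: if_splits)
  have xI: "x \<in> I" using gap_interval_self[OF x] by (simp add: I_def)
  show ?thesis
  proof (cases "bdd_below I")
    case False
    have "\<forall>w\<le>x. w \<in> I"
    proof (intro allI impI)
      fix w assume "w \<le> x"
      obtain i where "i \<in> I" "i < w" using False by (auto simp: bdd_below_def not_le)
      then show "w \<in> I" using conv[of i w] \<open>w \<le> x\<close> by simp
    qed
    then have "\<forall>\<^sub>F w in at_bot. w \<in> I" by (auto simp: eventually_at_bot_linorder)
    then show ?thesis
      by (intro exI[of _ at_bot]) (auto simp: crit_ends_def I_def trivial_limit_at_bot_linorder)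
  next
    case True
    define a where "a = Inf I"
    have right: "w \<in> I" if w: "a < w" "w \<le> x" for w
    proof -
      obtain i where "i \<in> I" "i < w" using cInf_lessD[of I w] xI w by (auto simp: a_def)
      then show ?thesis using conv[of i w] w by simp
    qed
    have "\<exists>e>0. \<forall>w. \<bar>w - x\<bar> < e \<longrightarrow> gap S f g w"
    proof (rule gap_open[OF S fg])
      show "\<exists>\<^sub>F x in nhds x. gap S f g x"
        using x by (auto simp: frequently_def dest: eventually_nhds_x_imp_x)
    qed (use x in \<open>auto simp: gap_def\<close>)
    then obtain e where e: "e > 0" "\<And>w. \<bar>w - x\<bar> < e \<Longrightarrow> gap S f g w" by auto
    \<comment> \<open>This puts \<open>a\<close> strictly to the left of \<open>x\<close>, so that
      the interval contains a right neighbourhood of \<open>a\<close>.\<close>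
    have "x - e/2 \<in> I" unfolding I_def gap_interval_def
      using e by (auto simp: closed_segment_eq_real_ivl)
    then have "a \<le> x - e/2" unfolding a_def by (intro cInf_lower True)
    then have "a < x" using e(1) by simp
    have ev: "\<forall>\<^sub>F w in at_right a. w \<in> I"
      using eventually_at_right_real[OF \<open>a < x\<close>] by eventually_elim (use right in auto)
    \<comment> \<open>Otherwise the gap would extend to the left of \<open>a\<close>, the infimum of
      its interval.\<close>
    have "a \<in> (\<Union>\<gamma>\<in>S. crit \<gamma>) \<or> vertex_at S a (f a) \<or> vertex_at S a (g a)"
    proof (rule ccontr)
      assume no: "\<not> ?thesis"
      have "\<forall>\<^sub>F w in at_right a. gap S f g w"
        using ev by eventually_elim (auto simp: I_def gap_interval_def)
      then have "\<exists>\<^sub>F w in at_right a. gap S f g w"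
        by (intro eventually_frequently) auto
      then have "\<exists>\<^sub>F w in nhds a. gap S f g w"
        unfolding frequently_def using filter_leD[OF at_within_le_nhds] by blast
      from gap_open[OF S fg this] no obtain e' where e': "e' > 0" "\<And>w. \<bar>w - a\<bar> < e' \<Longrightarrow> gap S f g w" by auto
      have "gap S f g w" if "a - e'/2 \<le> w" "w \<le> x" for w
      proof (cases "w \<le> a")
        case False
        then have "w \<in> I" using right that by simp
        then show ?thesis by (auto simp: I_def gap_interval_def)
      qed (use e' that in auto)
      then have "a - e'/2 \<in> I" using \<open>a < x\<close> e'(1)
        by (auto simp: I_def gap_interval_def closed_segment_eq_real_ivl)
      then have "a \<le> a - e'/2" unfolding a_def by (intro cInf_lower True)
      then show False using e'(1) by simp
    qed
    then have "at_right a \<in> crit_ends S \<or> (at_right a, f) \<in> vertex_ends S \<or> (at_right a, g) \<in> vertex_ends S"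
      using fg unfolding crit_ends_def vertex_ends_def by blast
    then show ?thesis using ev by (intro exI[of _ "at_right a"]) (auto simp: I_def)
  qed
qed

lemma finite_crit_ends: "S \<subseteq> \<C> \<Longrightarrow> finite S \<Longrightarrow> finite (crit_ends S)"
  and card_crit_ends: "S \<subseteq> \<C> \<Longrightarrow> finite S \<Longrightarrow> card (crit_ends S) \<le> 1 + D * card S"
proof -
  assume S: "S \<subseteq> \<C>" "finite S"
  have fin: "finite (\<Union>\<gamma>\<in>S. crit \<gamma>)" using S finite_crit by auto
  then show "finite (crit_ends S)" by (simp add: crit_ends_def)
  have "card (\<Union>\<gamma>\<in>S. crit \<gamma>) \<le> (\<Sum>\<gamma>\<in>S. card (crit \<gamma>))" using S by (intro card_UN_le)
  also have "\<dots> \<le> (\<Sum>\<gamma>\<in>S. D)" using S card_crit by (intro sum_mono) auto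
  finally have "card (\<Union>\<gamma>\<in>S. crit \<gamma>) \<le> D * card S" by (simp add: mult.commute)
  moreover have "card (crit_ends S) \<le> Suc (card (at_right ` (\<Union>\<gamma>\<in>S. crit \<gamma>)))"
    unfolding crit_ends_def by (rule card_insert_le_m1) auto
  moreover have "card (at_right ` (\<Union>\<gamma>\<in>S. crit \<gamma>)) \<le> card (\<Union>\<gamma>\<in>S. crit \<gamma>)"
    by (rule card_image_le[OF fin])
  ultimately show "card (crit_ends S) \<le> 1 + D * card S" by simp
qed

lemma finite_vertex_ends: "S \<subseteq> \<C> \<Longrightarrow> finite S \<Longrightarrow> finite (vertex_ends S)"
  and card_vertex_ends: "S \<subseteq> \<C> \<Longrightarrow> finite S \<Longrightarrow> card (vertex_ends S) \<le> card S * (card S * (r * (d + 2)))"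
proof -
  assume S: "S \<subseteq> \<C>" "finite S"
  define X where "X \<gamma> \<delta> = (if \<gamma> = \<delta> then {} else \<gamma> \<inter> \<delta>)" for \<gamma> \<delta> :: "(real \<times> real) set"
  define W where "W = (\<Union>\<gamma>\<in>S. \<Union>\<delta>\<in>S. \<Union>v\<in>X \<gamma> \<delta>. (\<lambda>k. (at_right (fst v), branch \<gamma> k)) ` {..Suc d})"
  have X: "finite (X \<gamma> \<delta>)" "card (X \<gamma> \<delta>) \<le> r" if "\<gamma> \<in> S" "\<delta> \<in> S" for \<gamma> \<delta>
  proof -
    have "\<gamma> \<in> \<C>" "\<delta> \<in> \<C>" using that S by auto
    then show "finite (X \<gamma> \<delta>)" "card (X \<gamma> \<delta>) \<le> r"
      using finite_Int[of \<gamma> \<delta>] card_Int[of \<gamma> \<delta>] by (cases "\<gamma> = \<delta>"; simp add: X_def)+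
  qed
  have sub: "vertex_ends S \<subseteq> W"
  proof
    fix p assume "p \<in> vertex_ends S"
    then obtain a h where p: "p = (at_right a, h)" "h \<in> branches S" "vertex_at S a (h a)"
      unfolding vertex_ends_def by blast
    obtain \<gamma> k where h: "h = branch \<gamma> k" "\<gamma> \<in> S" "k \<le> Suc d" using p(2) unfolding branches_def by blast
    obtain \<gamma>1 \<gamma>2 y where v: "\<gamma>1 \<in> S" "\<gamma>2 \<in> S" "\<gamma>1 \<noteq> \<gamma>2" "h a = ereal y" "(a, y) \<in> \<gamma>1" "(a, y) \<in> \<gamma>2"
      using p(3) unfolding vertex_at_def by blast
    have "(a, y) \<in> \<gamma>" using branch_in_fibre[of \<gamma> k a y] h v by (simp add: fibre_def)
    moreover obtain \<delta> where "\<delta> \<in> S" "\<delta> \<noteq> \<gamma>" "(a, y) \<in> \<delta>" using v by metis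
    ultimately have "(a, y) \<in> X \<gamma> \<delta>" by (auto simp: X_def)
    then show "p \<in> W" unfolding W_def p h
      using h \<open>\<delta> \<in> S\<close> by (intro UN_I[of \<gamma>] UN_I[of \<delta>] UN_I[of "(a, y)"] image_eqI[of _ _ k]) auto
  qed
  have finW: "finite W" unfolding W_def using S X by auto
  then show "finite (vertex_ends S)" using sub finite_subset by blast
  have "card (\<Union>v\<in>X \<gamma> \<delta>. (\<lambda>k. (at_right (fst v), branch \<gamma> k)) ` {..Suc d}) \<le> r * (d + 2)"
    if "\<gamma> \<in> S" "\<delta> \<in> S" for \<gamma> \<delta>
  proof -
    have "card (\<Union>v\<in>X \<gamma> \<delta>. (\<lambda>k. (at_right (fst v), branch \<gamma> k)) ` {..Suc d})
       \<le> (\<Sum>v\<in>X \<gamma> \<delta>. card ((\<lambda>k. (at_right (fst v), branch \<gamma> k)) ` {..Suc d}))"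
      by (rule card_UN_le[OF X(1)[OF that]])
    also have "\<dots> \<le> (\<Sum>v\<in>X \<gamma> \<delta>. d + 2)"
      by (intro sum_mono order_trans[OF card_image_le]) auto
    also have "\<dots> \<le> r * (d + 2)" using X(2)[OF that] by (simp del: mult_Suc_right)
    finally show ?thesis .
  qed
  note pair = this
  have "card W \<le> (\<Sum>\<gamma>\<in>S. \<Sum>\<delta>\<in>S. r * (d + 2))"
    unfolding W_def
    by (rule order_trans[OF card_UN_le[OF S(2)]], rule sum_mono,
        rule order_trans[OF card_UN_le[OF S(2)]], rule sum_mono, rule pair)
  then show "card (vertex_ends S) \<le> card S * (card S * (r * (d + 2)))"
    using card_mono[OF finW sub] by simp
qed

lemma card_UN_at_most_one:
  assumes "finite A" "\<And>i x y. i \<in> A \<Longrightarrow> x \<in> B i \<Longrightarrow> y \<in> B i \<Longrightarrow> x = y"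
  shows "finite (\<Union>i\<in>A. B i) \<and> card (\<Union>i\<in>A. B i) \<le> card A"
proof -
  have sub: "(\<Union>i\<in>A. B i) \<subseteq> (\<lambda>i. SOME x. x \<in> B i) ` A"
  proof
    fix x assume "x \<in> (\<Union>i\<in>A. B i)"
    then obtain i where i: "i \<in> A" "x \<in> B i" by auto
    then have "(SOME x. x \<in> B i) = x" using assms(2) by (metis someI)
    then show "x \<in> (\<lambda>i. SOME x. x \<in> B i) ` A" using i by force
  qed
  then show ?thesis
    using assms(1) by (meson card_image_le card_mono finite_imageI finite_subset order_trans)
qed

text \<open>Two cells with the same left end share an abscissa, because the filter is proper; so the
  left end and the bottom branch, or the left end and the top branch, determine a cell. Only
  linearly many left ends are critical, and each of them may go with any branch; the quadratically
  many vertex ends already carry their branch.\<close>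

lemma finite_cells: "S \<subseteq> \<C> \<Longrightarrow> finite S \<Longrightarrow> finite (cells S)"
  and card_cells: "S \<subseteq> \<C> \<Longrightarrow> finite S \<Longrightarrow> card (cells S) \<le> (d + 2) * (1 + D + 2 * r) * card S ^ 2"
proof -
  assume S: "S \<subseteq> \<C>" "finite S"
  define Lo where "Lo p = {c. \<exists>g x. c = region S (snd p) g x \<and> fst p \<noteq> bot \<and> snd p \<in> branches S \<and> g \<in> branches S \<and>
     gap S (snd p) g x \<and> (\<forall>\<^sub>F w in fst p. w \<in> gap_interval S (snd p) g x)}" for p
  define Hi where "Hi p = {c. \<exists>f x. c = region S f (snd p) x \<and> fst p \<noteq> bot \<and> f \<in> branches S \<and> snd p \<in> branches S \<and>
     gap S f (snd p) x \<and> (\<forall>\<^sub>F w in fst p. w \<in> gap_interval S f (snd p) x)}" for p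
  have common: "\<exists>w. gap S f g w \<and> gap S f' g' w \<and> gap_interval S f g w = gap_interval S f g x \<and>
       gap_interval S f' g' w = gap_interval S f' g' x'"
    if "F \<noteq> bot" "\<forall>\<^sub>F w in F. w \<in> gap_interval S f g x" "\<forall>\<^sub>F w in F. w \<in> gap_interval S f' g' x'"
    for F f g f' g' x x'
  proof -
    have "\<forall>\<^sub>F w in F. w \<in> gap_interval S f g x \<and> w \<in> gap_interval S f' g' x'"
      using that by (intro eventually_conj)
    from eventually_happens'[OF that(1) this]
    obtain w where w: "w \<in> gap_interval S f g x" "w \<in> gap_interval S f' g' x'" by blast
    have "gap S f g w" "gap S f' g' w" using w by (auto simp: gap_interval_def)
    then show ?thesis using gap_interval_eq[OF w(1)] gap_interval_eq[OF w(2)] by blast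
  qed
  have Lo1: "c = c'" if "c \<in> Lo p" "c' \<in> Lo p" for p c c'
  proof -
    from that(1) obtain g x where c: "c = region S (snd p) g x" "fst p \<noteq> bot" "snd p \<in> branches S"
      "g \<in> branches S" "\<forall>\<^sub>F w in fst p. w \<in> gap_interval S (snd p) g x"
      unfolding Lo_def by blast
    from that(2) obtain g' x' where c': "c' = region S (snd p) g' x'" "g' \<in> branches S"
      "\<forall>\<^sub>F w in fst p. w \<in> gap_interval S (snd p) g' x'"
      unfolding Lo_def by blast
    note * = c(1) c'(1) c(2,3,4) c'(2) c(5) c'(3)
    from common[OF *(3,7,8)] obtain w where w: "gap S (snd p) g w" "gap S (snd p) g' w"
      "gap_interval S (snd p) g w = gap_interval S (snd p) g x"
      "gap_interval S (snd p) g' w = gap_interval S (snd p) g' x'" by blast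
    have "g = g'" by (rule gap_unique_above[OF *(4,5,6) w(1,2)])
    then show ?thesis using w(3,4) by (simp add: *(1,2) region_def)
  qed
  have Hi1: "c = c'" if "c \<in> Hi p" "c' \<in> Hi p" for p c c'
  proof -
    from that(1) obtain g x where c: "c = region S g (snd p) x" "fst p \<noteq> bot" "snd p \<in> branches S"
      "g \<in> branches S" "\<forall>\<^sub>F w in fst p. w \<in> gap_interval S g (snd p) x"
      unfolding Hi_def by blast
    from that(2) obtain g' x' where c': "c' = region S g' (snd p) x'" "g' \<in> branches S"
      "\<forall>\<^sub>F w in fst p. w \<in> gap_interval S g' (snd p) x'"
      unfolding Hi_def by blast
    note * = c(1) c'(1) c(2,3,4) c'(2) c(5) c'(3)
    from common[OF *(3,7,8)] obtain w where w: "gap S g (snd p) w" "gap S g' (snd p) w"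
      "gap_interval S g (snd p) w = gap_interval S g (snd p) x"
      "gap_interval S g' (snd p) w = gap_interval S g' (snd p) x'" by blast
    have "g = g'" by (rule gap_unique_below[OF *(5,6,4) w(1,2)])
    then show ?thesis using w(3,4) by (simp add: *(1,2) region_def)
  qed
  let ?A = "\<Union>p\<in>crit_ends S \<times> branches S. Lo p" and ?B = "\<Union>p\<in>vertex_ends S. Lo p" and ?C = "\<Union>p\<in>vertex_ends S. Hi p"
  have sub: "cells S \<subseteq> ?A \<union> ?B \<union> ?C"
  proof
    fix c assume "c \<in> cells S"
    then obtain f g x where c: "c = region S f g x" "f \<in> branches S" "g \<in> branches S" "gap S f g x"
      unfolding cells_def by blast
    from left_end[OF S c(2-4)] obtain F where F: "F \<noteq> bot" "\<forall>\<^sub>F w in F. w \<in> gap_interval S f g x"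
      "F \<in> crit_ends S \<or> (F, f) \<in> vertex_ends S \<or> (F, g) \<in> vertex_ends S" by blast
    have "c \<in> Lo (F, f)" "c \<in> Hi (F, g)" unfolding Lo_def Hi_def using c F by auto
    then show "c \<in> ?A \<union> ?B \<union> ?C" using F(3) c(2) by auto
  qed
  have A: "finite ?A \<and> card ?A \<le> card (crit_ends S \<times> branches S)"
    using finite_crit_ends[OF S] finite_branches[OF S(2)] by (intro card_UN_at_most_one Lo1) auto
  have B: "finite ?B \<and> card ?B \<le> card (vertex_ends S)"
    using finite_vertex_ends[OF S] by (intro card_UN_at_most_one Lo1) auto
  have C: "finite ?C \<and> card ?C \<le> card (vertex_ends S)"
    using finite_vertex_ends[OF S] by (intro card_UN_at_most_one Hi1) auto
  show "finite (cells S)" using finite_subset[OF sub] A B C by blast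
  define t where "t = card S"
  have "card (cells S) \<le> card (?A \<union> ?B \<union> ?C)" using A B C by (intro card_mono sub) auto
  also have "\<dots> \<le> card ?A + card ?B + card ?C"
    by (meson add_right_mono card_Un_le order_trans)
  also have "\<dots> \<le> card (crit_ends S) * card (branches S) + card (vertex_ends S) + card (vertex_ends S)"
    using A B C by (intro add_mono) (auto simp: card_cartesian_product)
  also have "\<dots> \<le> (1 + D * t) * (t * (d + 2)) + t * (t * (r * (d + 2))) + t * (t * (r * (d + 2)))"
    using card_crit_ends[OF S] card_branches[OF S(2)] card_vertex_ends[OF S]
    unfolding t_def by (intro add_mono mult_mono) auto
  also have "\<dots> \<le> (d + 2) * (1 + D + 2 * r) * t ^ 2"
  proof -
    have "t \<le> t ^ 2" by (simp add: power2_eq_square)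
    then have "t * (d + 2) \<le> t ^ 2 * (d + 2)" by (rule mult_le_mono1)
    moreover have "(1 + D * t) * (t * (d + 2)) + t * (t * (r * (d + 2))) + t * (t * (r * (d + 2))) =
       t * (d + 2) + (d + 2) * (D + 2 * r) * t ^ 2" by (simp add: algebra_simps power2_eq_square)
    moreover have "(d + 2) * (1 + D + 2 * r) * t ^ 2 = t ^ 2 * (d + 2) + (d + 2) * (D + 2 * r) * t ^ 2"
      by (simp add: algebra_simps)
    ultimately show ?thesis by simp
  qed
  finally show "card (cells S) \<le> (d + 2) * (1 + D + 2 * r) * card S ^ 2" by (simp add: t_def)
qed

end

subsection \<open>Random samples\<close>

text \<open>Repetitions are allowed, so a set of at most \<open>b\<close> elements is always
  addressed by \<open>b\<close> positions of a tuple.\<close>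

lemma ex_surj_from_lessThan:
  assumes "finite S" "S \<noteq> {}" "card S \<le> b" "S \<subseteq> f ` A"
  shows "\<exists>e\<in>{..<b} \<rightarrow>\<^sub>E A. f ` e ` {..<b} = S"
proof -
  obtain h where h: "bij_betw h {0..<card S} S" using ex_bij_betw_nat_finite[OF assms(1)] by blast
  have "\<forall>s\<in>S. \<exists>a\<in>A. f a = s" using assms(4) by auto
  then obtain g where g: "\<And>s. s \<in> S \<Longrightarrow> g s \<in> A \<and> f (g s) = s" by metis
  define k where "k i = (if i < card S then i else 0)" for i
  define e where "e = restrict (\<lambda>i. g (h (k i))) {..<b}"
  have pos: "card S > 0" using assms by (simp add: card_gt_0_iff)
  have hk: "h (k i) \<in> S" for i using h pos by (auto simp: k_def bij_betw_def)
  have "f ` e ` {..<b} = (\<lambda>i. h (k i)) ` {..<b}"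
    unfolding image_image by (intro image_cong refl) (use g hk in \<open>auto simp: e_def\<close>)
  also have "\<dots> = S"
  proof (intro equalityI subsetI)
    fix s assume "s \<in> S"
    then obtain i where "i < card S" "s = h i"
      using bij_betw_imp_surj_on[OF h] by (metis atLeastLessThan_iff imageE)
    then show "s \<in> (\<lambda>i. h (k i)) ` {..<b}" using assms(3) by (intro image_eqI[of _ _ i]) (auto simp: k_def)
  qed (use hk in auto)
  finally show ?thesis using g hk by (intro bexI[of _ e]) (auto simp: e_def)
qed

lemma real_le_sum: "k \<le> sum n I \<Longrightarrow> real k \<le> (\<Sum>i\<in>I. real (n i))"
  by (simp flip: of_nat_sum)

lemma card_PiE_const: "finite I \<Longrightarrow> card (I \<rightarrow>\<^sub>E A) = card A ^ card I"
  by (simp add: card_PiE)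

text \<open>Clarkson's random sampling, by counting: a heavy cell is determined by at most \<open>b\<close> entries of a
  \<open>t\<close>-tuple, and all other entries must avoid the many elements of \<open>C\<close> that meet it.\<close>

lemma sparse_sample:
  fixes cells :: "'a set \<Rightarrow> 'b set" and meets :: "'a \<Rightarrow> 'b \<Rightarrow> bool" and B :: real
  assumes C: "finite C" "C \<noteq> {}"
    and det: "\<And>S c. S \<subseteq> C \<Longrightarrow> c \<in> cells S \<Longrightarrow> \<exists>S'\<subseteq>S. S' \<noteq> {} \<and> card S' \<le> b \<and> c \<in> cells S'"
    and fin: "\<And>S. S \<subseteq> C \<Longrightarrow> card S \<le> b \<Longrightarrow> finite (cells S)"
    and few: "\<And>S. S \<subseteq> C \<Longrightarrow> card S \<le> b \<Longrightarrow> card (cells S) \<le> q"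
    and avoid: "\<And>S c \<eta>. S \<subseteq> C \<Longrightarrow> c \<in> cells S \<Longrightarrow> \<eta> \<in> S \<Longrightarrow> \<not> meets \<eta> c"
    and t: "b \<le> t" "0 < t" and B: "0 \<le> B" "B \<le> card C"
    and small: "real q * real t ^ b * (1 - B / card C) ^ (t - b) < 1"
  shows "\<exists>S\<subseteq>C. S \<noteq> {} \<and> card S \<le> t \<and> (\<forall>c\<in>cells S. real (card {\<eta>\<in>C. meets \<eta> c}) \<le> B)"
proof (rule ccontr)
  assume contra: "\<not> ?thesis"
  define m where "m = card C"
  have m: "m > 0" using C by (simp add: m_def card_gt_0_iff)
  define F where "F = {..<t} \<rightarrow>\<^sub>E C"
  define heavy where "heavy c \<longleftrightarrow> B < real (card {\<eta>\<in>C. meets \<eta> c})" for c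
  define M where "M c = {\<eta>\<in>C. \<not> meets \<eta> c}" for c
  have cardM: "real (card (M c)) \<le> m - B" if "heavy c" for c
  proof -
    have "M c = C - {\<eta>\<in>C. meets \<eta> c}" by (auto simp: M_def)
    then have "card (M c) = card C - card {\<eta>\<in>C. meets \<eta> c}"
      using C by (simp add: card_Diff_subset)
    moreover have "card {\<eta>\<in>C. meets \<eta> c} \<le> card C" using C by (intro card_mono) auto
    ultimately show ?thesis using that by (simp add: heavy_def m_def of_nat_diff)
  qed
  \<comment> \<open>Tuples with the entries \<phi> at the positions \<open>A\<close> that avoid
    every element meeting \<open>c\<close>. Only the positions outside \<open>A\<close> are free,
    each with at most \<open>m - B\<close> choices if \<open>c\<close> is heavy.\<close>
  define G where "G A \<phi> c = {f\<in>F. restrict f A = \<phi> \<and> (\<forall>i<t. f i \<in> M c)}" for A \<phi> c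
  have cardG: "real (card (G A \<phi> c)) \<le> (m - B) ^ (t - card A)"
    if A: "A \<subseteq> {..<t}" and c: "heavy c" for A and \<phi> :: "nat \<Rightarrow> 'a" and c
  proof -
    have "inj_on (\<lambda>f. restrict f ({..<t} - A)) (G A \<phi> c)"
    proof (rule inj_onI)
      fix f f' assume f: "f \<in> G A \<phi> c" "f' \<in> G A \<phi> c" "restrict f ({..<t} - A) = restrict f' ({..<t} - A)"
      have "restrict f A = restrict f' A" using f(1,2) by (simp add: G_def)
      then have "f i = f' i" if "i < t" for i
        using f(3) that by (metis Diff_iff lessThan_iff restrict_apply')
      then show "f = f'" using f(1,2) by (intro PiE_ext[of f "{..<t}" "\<lambda>_. C"]) (auto simp: G_def F_def)
    qed
    moreover have "(\<lambda>f. restrict f ({..<t} - A)) ` G A \<phi> c \<subseteq> ({..<t} - A) \<rightarrow>\<^sub>E M c"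
      unfolding G_def by (intro image_subsetI) (simp add: restrict_PiE_iff)
    moreover have "finite (({..<t} - A) \<rightarrow>\<^sub>E M c)" using C by (intro finite_PiE) (auto simp: M_def)
    ultimately have "card (G A \<phi> c) \<le> card (({..<t} - A) \<rightarrow>\<^sub>E M c)" by (rule card_inj_on_le)
    also have "\<dots> = card (M c) ^ (t - card A)"
      using A finite_subset[OF A] by (simp add: card_PiE_const card_Diff_subset)
    finally have "real (card (G A \<phi> c)) \<le> real (card (M c)) ^ (t - card A)"
      by (metis of_nat_le_iff of_nat_power)
    also have "\<dots> \<le> (m - B) ^ (t - card A)" using cardM[OF c] by (intro power_mono) auto
    finally show ?thesis .
  qed
  \<comment> \<open>Tuples having a heavy cell determined by the entries at the positions
    \<open>e\<close>. If no sample is sparse, these sets cover all tuples, and a union bound over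
    positions, entries and cells contradicts the assumption \<open>small\<close>.\<close>
  define Bad where "Bad e = (\<Union>\<phi>\<in>(e ` {..<b}) \<rightarrow>\<^sub>E C. \<Union>c\<in>{c\<in>cells (\<phi> ` e ` {..<b}). heavy c}. G (e ` {..<b}) \<phi> c)" for e
  have F_Bad: "F \<subseteq> (\<Union>e\<in>{..<b} \<rightarrow>\<^sub>E {..<t}. Bad e)"
  proof
    fix f assume f: "f \<in> F"
    define S where "S = f ` {..<t}"
    have S: "S \<subseteq> C" "S \<noteq> {}" "card S \<le> t"
      using f t card_image_le[of "{..<t}" f] by (auto simp: F_def S_def)
    then obtain c where c: "c \<in> cells S" "heavy c" using contra unfolding heavy_def by (meson not_le)
    obtain S' where S': "S' \<subseteq> S" "S' \<noteq> {}" "card S' \<le> b" "c \<in> cells S'" using det[OF S(1) c(1)] by blast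
    have fin': "finite S'" using S' S C finite_subset by metis
    have sub': "S' \<subseteq> f ` {..<t}" using S'(1) by (simp add: S_def)
    obtain e where e: "e \<in> {..<b} \<rightarrow>\<^sub>E {..<t}" "f ` e ` {..<b} = S'"
      using ex_surj_from_lessThan[OF fin' S'(2,3) sub'] by (elim bexE) (rule that)
    define \<phi> where "\<phi> = restrict f (e ` {..<b})"
    have et: "e i < t" if "i < b" for i using e(1) that by auto
    have "\<phi> \<in> (e ` {..<b}) \<rightarrow>\<^sub>E C" using f et by (auto simp: \<phi>_def F_def)
    moreover have "\<phi> ` e ` {..<b} = S'" unfolding e(2)[symmetric] \<phi>_def by (rule image_cong) auto
    moreover have "f \<in> G (e ` {..<b}) \<phi> c"
      using f avoid[OF S(1) c(1)] S(1) by (auto simp: G_def \<phi>_def M_def S_def)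
    ultimately have "f \<in> Bad e" unfolding Bad_def using S'(4) c(2) by (intro UN_I[of \<phi>] UN_I[of c]) auto
    then show "f \<in> (\<Union>e\<in>{..<b} \<rightarrow>\<^sub>E {..<t}. Bad e)" using e(1) by blast
  qed
  have finG: "finite (G A \<phi> c)" for A \<phi> c
    using C by (auto simp: G_def F_def intro!: finite_subset[OF _ finite_PiE[of "{..<t}" "\<lambda>_. C"]])
  have card_e: "card (e ` {..<b}) \<le> b" for e :: "nat \<Rightarrow> nat" using card_image_le[of "{..<b}" e] by simp
  have \<phi>: "\<phi> ` e ` {..<b} \<subseteq> C" "card (\<phi> ` e ` {..<b}) \<le> b" if "\<phi> \<in> (e ` {..<b}) \<rightarrow>\<^sub>E C" for \<phi> and e :: "nat \<Rightarrow> nat"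
    using that card_e[of e] by (auto intro: order_trans[OF card_image_le])
  have finBad: "finite (Bad e)" for e
    unfolding Bad_def
  proof (intro finite_UN_I finite_PiE finG)
    fix \<phi> assume "\<phi> \<in> (e ` {..<b}) \<rightarrow>\<^sub>E C"
    from fin[OF \<phi>[OF this]] show "finite {c\<in>cells (\<phi> ` e ` {..<b}). heavy c}" by simp
  qed (use C in auto)
  have cardBad: "real (card (Bad e)) \<le> real m ^ b * (q * (m - B) ^ (t - b))"
    if e: "e \<in> {..<b} \<rightarrow>\<^sub>E {..<t}" for e
  proof -
    define A where "A = e ` {..<b}"
    have A: "A \<subseteq> {..<t}" "finite A" "card A \<le> b" using e card_e by (auto simp: A_def)
    have in1: "real (card (\<Union>c\<in>{c\<in>cells (\<phi> ` A). heavy c}. G A \<phi> c)) \<le> q * (m - B) ^ (t - card A)"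
      if p: "\<phi> \<in> A \<rightarrow>\<^sub>E C" for \<phi>
    proof -
      have fc: "finite (cells (\<phi> ` A))" "card (cells (\<phi> ` A)) \<le> q"
        using fin[OF \<phi>[OF p[unfolded A_def]]] few[OF \<phi>[OF p[unfolded A_def]]] by (simp_all add: A_def)
      then have "card (\<Union>c\<in>{c\<in>cells (\<phi> ` A). heavy c}. G A \<phi> c) \<le> (\<Sum>c\<in>{c\<in>cells (\<phi> ` A). heavy c}. card (G A \<phi> c))"
        by (intro card_UN_le) auto
      then have "real (card (\<Union>c\<in>{c\<in>cells (\<phi> ` A). heavy c}. G A \<phi> c)) \<le> (\<Sum>c\<in>{c\<in>cells (\<phi> ` A). heavy c}. real (card (G A \<phi> c)))"
        by (rule real_le_sum)
      also have "\<dots> \<le> (\<Sum>c\<in>{c\<in>cells (\<phi> ` A). heavy c}. (m - B) ^ (t - card A))"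
        by (intro sum_mono cardG A) auto
      also have "\<dots> = card {c\<in>cells (\<phi> ` A). heavy c} * (m - B) ^ (t - card A)" by simp
      also have "\<dots> \<le> q * (m - B) ^ (t - card A)"
        using fc B by (intro mult_right_mono) (auto simp: m_def intro!: order_trans[OF card_mono[OF fc(1)]])
      finally show ?thesis .
    qed
    have "card (Bad e) \<le> (\<Sum>\<phi>\<in>A \<rightarrow>\<^sub>E C. card (\<Union>c\<in>{c\<in>cells (\<phi> ` A). heavy c}. G A \<phi> c))"
      unfolding Bad_def A_def[symmetric] using A C by (intro card_UN_le finite_PiE) auto
    then have "real (card (Bad e)) \<le> (\<Sum>\<phi>\<in>A \<rightarrow>\<^sub>E C. real (card (\<Union>c\<in>{c\<in>cells (\<phi> ` A). heavy c}. G A \<phi> c)))"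
      by (rule real_le_sum)
    also have "\<dots> \<le> (\<Sum>\<phi>\<in>A \<rightarrow>\<^sub>E C. q * (m - B) ^ (t - card A))" by (intro sum_mono in1)
    also have "\<dots> = real m ^ card A * (q * (m - B) ^ (t - card A))"
      using A by (simp add: card_PiE_const m_def)
    also have "\<dots> = q * (real m ^ card A * ((m - B) ^ (b - card A) * (m - B) ^ (t - b)))"
      using A t by (simp flip: power_add)
    \<comment> \<open>Positions may coincide, so \<open>A\<close> can have fewer than
      \<open>b\<close> elements. Replacing the surplus factors \<open>m - B\<close> by
      \<open>m\<close> gives a bound independent of \<open>A\<close>.\<close>
    also have "\<dots> \<le> q * (real m ^ card A * (real m ^ (b - card A) * (m - B) ^ (t - b)))"
      using B by (intro mult_left_mono mult_right_mono power_mono) (auto simp: m_def)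
    also have "\<dots> = q * (real m ^ (card A + (b - card A)) * (m - B) ^ (t - b))" by (simp add: power_add)
    also have "\<dots> = real m ^ b * (q * (m - B) ^ (t - b))" using A by simp
    finally show ?thesis .
  qed
  have "real m ^ t = real (card F)" by (simp add: F_def card_PiE_const m_def)
  also have "\<dots> \<le> (\<Sum>e\<in>{..<b} \<rightarrow>\<^sub>E {..<t}. real (card (Bad e)))"
  proof -
    have "card F \<le> card (\<Union>e\<in>{..<b} \<rightarrow>\<^sub>E {..<t}. Bad e)"
      using finBad by (intro card_mono F_Bad finite_UN_I finite_PiE) auto
    also have "\<dots> \<le> (\<Sum>e\<in>{..<b} \<rightarrow>\<^sub>E {..<t}. card (Bad e))" by (intro card_UN_le finite_PiE) auto
    finally show ?thesis by (rule real_le_sum)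
  qed
  also have "\<dots> \<le> (\<Sum>e\<in>{..<b} \<rightarrow>\<^sub>E {..<t}. real m ^ b * (q * (m - B) ^ (t - b)))"
    by (intro sum_mono cardBad)
  also have "\<dots> = real t ^ b * (real m ^ b * (q * (m - B) ^ (t - b)))"
    by (simp add: card_PiE_const)
  also have "m - B = m * (1 - B / m)" using m by (simp add: field_simps)
  also have "real t ^ b * (real m ^ b * (q * (m * (1 - B / m)) ^ (t - b))) =
      real m ^ (b + (t - b)) * (q * real t ^ b * (1 - B / m) ^ (t - b))"
    unfolding power_add power_mult_distrib by (simp add: mult_ac)
  also have "\<dots> < real m ^ t * 1"
    unfolding le_add_diff_inverse[OF t(1)]
    using small m by (intro mult_strict_left_mono) (simp_all add: m_def[symmetric])
  finally show False by simp
qed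

context curve_family begin

text \<open>The cell is the one just to the right of \<open>z\<close>; so points on critical lines or vertically above
  and below vertices need no cells of their own.\<close>

lemma cell_of_point:
  assumes S: "S \<subseteq> C" "S \<noteq> {}" "finite C" "C \<subseteq> \<C>" and z: "z \<notin> \<Union>S"
  shows "\<exists>c\<in>cells S. \<forall>\<eta>\<in>C. z \<in> \<eta> \<longrightarrow> fst z \<notin> crit \<eta> \<longrightarrow> \<eta> \<inter> c \<noteq> {}"
proof -
  obtain x y where xy: "z = (x, y)" by (cases z)
  have SC: "S \<subseteq> \<C>" "finite S" using S finite_subset by blast+
  have "open (- \<Union>S)" using SC closed_curve by (intro open_Compl closed_Union) auto
  then obtain e where e: "e > 0" "\<And>p. dist p (x, y) < e \<Longrightarrow> p \<notin> \<Union>S"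
    using z unfolding open_dist xy by (metis ComplI ComplD)
  define \<rho> where "\<rho> = e / 2"
  have \<rho>: "\<rho> > 0" "(x', y') \<notin> \<Union>S" if "\<bar>x' - x\<bar> < \<rho>" "\<bar>y' - y\<bar> < \<rho>" for x' y'
  proof -
    have "dist (x', y') (x, y) < e"
      using sqrt_sum_squares_le_sum_abs[of "x' - x" "y' - y"] that by (auto simp: dist_Pair_Pair dist_real_def \<rho>_def)
    then show "(x', y') \<notin> \<Union>S" by (rule e)
  qed (use e in \<open>simp add: \<rho>_def\<close>)
  have \<rho>0: "\<rho> > 0" using e by (simp add: \<rho>_def)
  define C' where "C' = {\<eta>\<in>C. z \<in> \<eta> \<and> x \<notin> crit \<eta>}"
  have "\<forall>\<^sub>F x' in nhds x. \<bar>x' - x\<bar> < \<rho> \<and> (x' \<noteq> x \<longrightarrow> x' \<notin> (\<Union>\<gamma>\<in>S. crit \<gamma>)) \<and>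
     (x' \<noteq> x \<longrightarrow> x' \<notin> {x. \<exists>v. vertex_at S x v}) \<and> (\<forall>\<eta>\<in>C'. \<exists>y'. (x', y') \<in> \<eta> \<and> \<bar>y' - y\<bar> < \<rho>)"
  proof (intro eventually_conj eventually_not_in_finite finite_vertex_lines SC finite_UN_I eventually_ball_finite ballI)
    show "\<forall>\<^sub>F x' in nhds x. \<bar>x' - x\<bar> < \<rho>" using \<rho>0 by (auto simp: eventually_nhds_metric dist_real_def)
    show "finite C'" using S by (simp add: C'_def)
    fix \<eta> assume "\<eta> \<in> C'"
    then have "\<eta> \<in> \<C>" "x \<notin> crit \<eta>" "y \<in> fibre \<eta> x" using S by (auto simp: C'_def xy fibre_def)
    from regular[OF this(1), unfolded regular_off_def, THEN spec, THEN mp, OF this(2), THEN conjunct2, THEN spec, THEN mp, OF \<rho>0] this(3)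
    show "\<forall>\<^sub>F x' in nhds x. \<exists>y'. (x', y') \<in> \<eta> \<and> \<bar>y' - y\<bar> < \<rho>"
      by (elim eventually_mono) (auto simp: fibre_def bij_betw_def)
  qed (use SC finite_crit in auto)
  then have "\<forall>\<^sub>F x' in at_right x. \<bar>x' - x\<bar> < \<rho> \<and> (x' \<noteq> x \<longrightarrow> x' \<notin> (\<Union>\<gamma>\<in>S. crit \<gamma>)) \<and>
     (x' \<noteq> x \<longrightarrow> x' \<notin> {x. \<exists>v. vertex_at S x v}) \<and> (\<forall>\<eta>\<in>C'. \<exists>y'. (x', y') \<in> \<eta> \<and> \<bar>y' - y\<bar> < \<rho>)"
    by (rule filter_leD[OF at_within_le_nhds])
  then have "\<forall>\<^sub>F x' in at_right x. x < x' \<and> \<bar>x' - x\<bar> < \<rho> \<and> (x' \<noteq> x \<longrightarrow> x' \<notin> (\<Union>\<gamma>\<in>S. crit \<gamma>)) \<and>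
     (x' \<noteq> x \<longrightarrow> x' \<notin> {x. \<exists>v. vertex_at S x v}) \<and> (\<forall>\<eta>\<in>C'. \<exists>y'. (x', y') \<in> \<eta> \<and> \<bar>y' - y\<bar> < \<rho>)"
    using eventually_at_right_less[of x] by eventually_elim simp
  from eventually_happens'[OF _ this] obtain x' where x':
    "\<bar>x' - x\<bar> < \<rho>" "\<forall>\<gamma>\<in>S. x' \<notin> crit \<gamma>" "\<And>v. \<not> vertex_at S x' v"
    "\<And>\<eta>. \<eta> \<in> C' \<Longrightarrow> \<exists>y'. (x', y') \<in> \<eta> \<and> \<bar>y' - y\<bar> < \<rho>" by auto
  \<comment> \<open>No curve of \<open>S\<close> enters the square of half-width \<rho> around
    \<open>z\<close>. So the neighbouring branches keep this distance from \<open>y\<close> over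
    \<open>x'\<close>, and points closer than that lie strictly between them.\<close>
  have U: "\<bar>v - y\<bar> \<ge> \<rho>" if h: "h \<in> branches S" "h x' = ereal v" for h v
  proof (rule ccontr)
    assume "\<not> ?thesis"
    moreover obtain \<gamma> k where "\<gamma> \<in> S" "h = branch \<gamma> k" using h unfolding branches_def by blast
    ultimately show False using branch_in_fibre[of \<gamma> k x' v] \<rho>(2)[OF x'(1), of v] h(2) by (auto simp: fibre_def)
  qed
  define L where "L = {h\<in>branches S. h x' < ereal y}"
  define R where "R = {h\<in>branches S. ereal y < h x'}"
  have "finite L" "L \<noteq> {}" using finite_branches[OF SC(2)] bot_in_branches[OF S(2)] by (auto simp: L_def)
  then have "Max ((\<lambda>h. h x') ` L) \<in> (\<lambda>h. h x') ` L" "\<And>h. h \<in> L \<Longrightarrow> h x' \<le> Max ((\<lambda>h. h x') ` L)"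
    by (intro Max_in Max_ge; auto)+
  then obtain f where f: "f \<in> L" "\<And>h. h \<in> L \<Longrightarrow> h x' \<le> f x'" by auto
  have top: "(\<lambda>_. \<infinity>) \<in> R" using top_in_branches[OF SC(1) S(2)] by (auto simp: R_def)
  have "finite R" "R \<noteq> {}" using finite_branches[OF SC(2)] top by (auto simp: R_def)
  then have "Min ((\<lambda>h. h x') ` R) \<in> (\<lambda>h. h x') ` R" "\<And>h. h \<in> R \<Longrightarrow> Min ((\<lambda>h. h x') ` R) \<le> h x'"
    by (intro Min_in Min_le; auto)+
  then obtain g0 where g0: "g0 \<in> R" "\<And>h. h \<in> R \<Longrightarrow> g0 x' \<le> h x'" by auto
  \<comment> \<open>If nothing real lies above, the constant branch is taken, as the last clause of
    \<open>gap\<close> demands.\<close>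
  define g where "g = (if g0 x' = \<infinity> then (\<lambda>_. \<infinity>) else g0)"
  have g: "g \<in> R" "\<And>h. h \<in> R \<Longrightarrow> g x' \<le> h x'" "g x' = \<infinity> \<longrightarrow> g = (\<lambda>_. \<infinity>)"
    using g0 top by (auto simp: g_def)
  have "gap S f g x'"
    unfolding gap_def
  proof (intro conjI ballI)
    show "f x' < g x'" using f(1) g(1) by (auto simp: L_def R_def)
    fix h assume h: "h \<in> branches S"
    have "h x' \<noteq> ereal y" using U[OF h, of y] \<rho>0 by auto
    then consider "h \<in> L" | "h \<in> R" using h by (auto simp: L_def R_def neq_iff)
    then show "h x' \<le> f x' \<or> g x' \<le> h x'" using f(2) g(2) by cases auto
  qed (use x' g in auto)
  moreover have fg: "f \<in> branches S" "g \<in> branches S" using f(1) g(1) by (auto simp: L_def R_def)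
  ultimately have c: "region S f g x' \<in> cells S" unfolding cells_def by blast
  have "\<eta> \<inter> region S f g x' \<noteq> {}" if "\<eta> \<in> C" "z \<in> \<eta>" "fst z \<notin> crit \<eta>" for \<eta>
  proof -
    have "\<eta> \<in> C'" using that by (simp add: C'_def xy)
    from x'(4)[OF this] obtain y' where y': "(x', y') \<in> \<eta>" "\<bar>y' - y\<bar> < \<rho>" by blast
    have "f x' < ereal y'"
    proof (cases "f x'")
      case (real v)
      then show ?thesis using U[OF fg(1) real] f(1) y'(2) by (auto simp: L_def)
    qed (use f(1) in \<open>auto simp: L_def\<close>)
    moreover have "ereal y' < g x'"
    proof (cases "g x'")
      case (real v)
      then show ?thesis using U[OF fg(2) real] g(1) y'(2) by (auto simp: R_def)
    qed (use g(1) in \<open>auto simp: R_def\<close>)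
    ultimately have "(x', y') \<in> region S f g x'"
      using \<open>gap S f g x'\<close> by (simp add: region_def gap_interval_def)
    then show ?thesis using y'(1) by blast
  qed
  then show ?thesis using c by blast
qed

end

subsection \<open>Incidences\<close>

text \<open>Choosing \<open>\<theta>\<close> suitably replaces Hoelder's inequality in the Kovari--Sos--Turan argument.\<close>

lemma le_truncated_power:
  fixes x \<theta> :: real
  assumes "0 \<le> x" "0 < \<theta>" "0 < s"
  shows "x \<le> \<theta> + x ^ s / \<theta> ^ (s - 1)"
proof (cases "x \<le> \<theta>")
  case False
  obtain k where k: "s = Suc k" using assms(3) by (cases s) auto
  have "x * \<theta> ^ k \<le> x * x ^ k" using assms False by (intro mult_left_mono power_mono) auto
  then have "x \<le> x ^ s / \<theta> ^ (s - 1)" using assms(2) by (simp add: k field_simps)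
  then show ?thesis using assms(2) by simp
qed (use assms in \<open>simp add: add_increasing2\<close>)

lemma card_filter_eq_sum: "finite A \<Longrightarrow> card {x\<in>A. Q x} = (\<Sum>x\<in>A. if Q x then 1 else 0)"
  by (simp add: sum.inter_filter[symmetric])

text \<open>Kovari--Sos--Turan: pairs of a curve and an \<open>s\<close>-subset of its points are
  counted in two ways. The bound involves \<open>B\<close> instead of \<open>card E\<close>, so that
  its coefficient of \<open>card P\<close> is the same in every cell and the contributions of the
  cells can be added.\<close>

lemma incidences_no_K:
  fixes E :: "'a set set" and P :: "'a set" and B :: real
  assumes fin: "finite E" "finite P" and s: "0 < s" and B: "0 < B" "card E \<le> B"
    and few: "\<And>Q. Q \<subseteq> P \<Longrightarrow> card Q = s \<Longrightarrow> card {\<eta>\<in>E. Q \<subseteq> \<eta>} \<le> c"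
  shows "(\<Sum>\<eta>\<in>E. real (card (P \<inter> \<eta>))) \<le> B * s + (1 + real s ^ s * c) * B powr (1 - 1 / s) * card P"
proof (cases "P = {}")
  case True
  then show ?thesis using B by simp
next
  case False
  define M where "M = real (card P)"
  have M: "M > 0" using False fin by (simp add: M_def card_gt_0_iff)
  \<comment> \<open>The balancing choice: \<open>B * \<theta>\<close> and
    \<open>M ^ s / \<theta> ^ (s - 1)\<close> are then both equal to
    \<open>B powr (1 - 1 / s) * M\<close>.\<close>
  define \<theta> where "\<theta> = M * B powr (- 1 / s)"
  have \<theta>: "\<theta> > 0" using M B by (simp add: \<theta>_def)
  \<comment> \<open>The summand \<open>s\<close> covers the curves with fewer than \<open>s\<close>
    points, where the binomial coefficient vanishes.\<close>
  have pt: "real k \<le> s + \<theta> + real s ^ s / \<theta> ^ (s - 1) * (k choose s)" for k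
  proof (cases "k < s")
    case True
    then show ?thesis using \<theta> by (simp add: add_increasing2)
  next
    case False
    have "(real k / s) ^ s \<le> k choose s" using False binomial_ge_n_over_k_pow_k[of s k, where 'a = real] by simp
    then have "real k ^ s \<le> real s ^ s * (k choose s)" using s by (simp add: power_divide field_simps)
    then have "real k ^ s / \<theta> ^ (s - 1) \<le> real s ^ s / \<theta> ^ (s - 1) * (k choose s)"
      using \<theta> by (simp add: divide_right_mono)
    moreover have "real k \<le> \<theta> + real k ^ s / \<theta> ^ (s - 1)" using \<theta> s by (intro le_truncated_power) auto
    ultimately show ?thesis by simp
  qed
  have "(\<Sum>\<eta>\<in>E. card (P \<inter> \<eta>) choose s) = (\<Sum>\<eta>\<in>E. card {Q. Q \<subseteq> P \<inter> \<eta> \<and> card Q = s})"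
    by (intro sum.cong refl n_subsets[symmetric] finite_Int disjI1 fin)
  also have "\<dots> = (\<Sum>\<eta>\<in>E. \<Sum>Q | Q \<subseteq> P \<and> card Q = s. if Q \<subseteq> \<eta> then 1 else 0)"
  proof (intro sum.cong refl)
    fix \<eta>
    have "{Q. Q \<subseteq> P \<inter> \<eta> \<and> card Q = s} = {Q\<in>{Q. Q \<subseteq> P \<and> card Q = s}. Q \<subseteq> \<eta>}" by auto
    then show "card {Q. Q \<subseteq> P \<inter> \<eta> \<and> card Q = s} = (\<Sum>Q | Q \<subseteq> P \<and> card Q = s. if Q \<subseteq> \<eta> then 1 else 0)"
      using card_filter_eq_sum[of "{Q. Q \<subseteq> P \<and> card Q = s}" "\<lambda>Q. Q \<subseteq> \<eta>"] fin by simp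
  qed
  also have "\<dots> = (\<Sum>Q | Q \<subseteq> P \<and> card Q = s. \<Sum>\<eta>\<in>E. if Q \<subseteq> \<eta> then 1 else 0)"
    by (rule sum.swap)
  also have "\<dots> = (\<Sum>Q | Q \<subseteq> P \<and> card Q = s. card {\<eta>\<in>E. Q \<subseteq> \<eta>})"
    by (intro sum.cong refl card_filter_eq_sum[symmetric] fin)
  also have "\<dots> \<le> (\<Sum>Q | Q \<subseteq> P \<and> card Q = s. c)" by (intro sum_mono few) auto
  also have "\<dots> = (card P choose s) * c" using fin by (simp add: n_subsets)
  also have "\<dots> \<le> card P ^ s * c"
    by (cases "s \<le> card P") (auto simp: binomial_le_pow binomial_eq_0)
  finally have "(\<Sum>\<eta>\<in>E. card (P \<inter> \<eta>) choose s) \<le> card P ^ s * c" .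
  then have "real (\<Sum>\<eta>\<in>E. card (P \<inter> \<eta>) choose s) \<le> real (card P ^ s * c)" by (simp only: of_nat_le_iff)
  then have ch: "(\<Sum>\<eta>\<in>E. real (card (P \<inter> \<eta>) choose s)) \<le> M ^ s * c" by (simp add: M_def)
  have "(\<Sum>\<eta>\<in>E. real (card (P \<inter> \<eta>))) \<le> (\<Sum>\<eta>\<in>E. s + \<theta> + real s ^ s / \<theta> ^ (s - 1) * (card (P \<inter> \<eta>) choose s))"
    by (intro sum_mono pt)
  also have "\<dots> = card E * (s + \<theta>) + real s ^ s / \<theta> ^ (s - 1) * (\<Sum>\<eta>\<in>E. real (card (P \<inter> \<eta>) choose s))"
    by (simp add: sum.distrib sum_distrib_left)
  also have "\<dots> \<le> B * (s + \<theta>) + real s ^ s / \<theta> ^ (s - 1) * (M ^ s * c)"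
    using B \<theta> ch by (intro add_mono mult_right_mono mult_left_mono) auto
  also have "\<dots> = B * s + (B * \<theta>) + real s ^ s * c * (M ^ s / \<theta> ^ (s - 1))" by (simp add: algebra_simps)
  also have "B * \<theta> = B powr (1 - 1 / s) * M"
    using B by (simp add: \<theta>_def powr_diff powr_minus_divide)
  also have "M ^ s / \<theta> ^ (s - 1) = B powr (1 - 1 / s) * M"
  proof -
    obtain k where k: "s = Suc k" using s by (cases s) auto
    define \<beta> where "\<beta> = B powr (1 - 1 / s)"
    have "(B powr (- 1 / s)) ^ k = B powr (- (1 - 1 / s))"
      using B by (simp add: k powr_realpow[symmetric] powr_powr field_simps)
    also have "\<dots> = 1 / \<beta>" by (simp only: powr_minus \<beta>_def inverse_eq_divide)
    finally have "\<theta> ^ k = M ^ k / \<beta>"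
      by (simp add: \<theta>_def power_mult_distrib)
    moreover have "\<beta> > 0" using B by (simp add: \<beta>_def)
    ultimately show ?thesis unfolding \<beta>_def[symmetric] using M by (simp add: k)
  qed
  finally show ?thesis by (simp add: M_def algebra_simps)
qed

section \<open>Summing the incidences over the cells\<close>

lemma card_pairs_le_left:
  assumes "finite A" "\<And>z. z \<in> A \<Longrightarrow> finite {\<eta>. (z, \<eta>) \<in> I} \<and> card {\<eta>. (z, \<eta>) \<in> I} \<le> k" "fst ` I \<subseteq> A"
  shows "finite I \<and> card I \<le> card A * k"
proof -
  have I: "I = (\<Union>z\<in>A. Pair z ` {\<eta>. (z, \<eta>) \<in> I})" using assms(3) by force
  have "finite (\<Union>z\<in>A. Pair z ` {\<eta>. (z, \<eta>) \<in> I})" using assms by auto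
  moreover have "card (\<Union>z\<in>A. Pair z ` {\<eta>. (z, \<eta>) \<in> I}) \<le> (\<Sum>z\<in>A. k)"
    using assms by (intro order_trans[OF card_UN_le] sum_mono order_trans[OF card_image_le]) auto
  ultimately show ?thesis using I by simp
qed

lemma card_pairs_le_right:
  assumes "finite A" "\<And>\<eta>. \<eta> \<in> A \<Longrightarrow> finite {z. (z, \<eta>) \<in> I} \<and> card {z. (z, \<eta>) \<in> I} \<le> k" "snd ` I \<subseteq> A"
  shows "finite I \<and> card I \<le> card A * k"
proof -
  have "finite (prod.swap ` I) \<and> card (prod.swap ` I) \<le> card A * k"
    using assms by (intro card_pairs_le_left) (auto simp: image_image)
  then show ?thesis by (metis card_image finite_imageD inj_swap inj_on_subset subset_UNIV)
qed

context curve_family begin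

text \<open>Incidences outside the reach of the cells are cheap. A curve has few points on other
  sampled curves (\<open>I1\<close>) and few on critical lines that it does not contain
  (\<open>I3\<close>). A point has at most one incidence with a sampled curve that is the only one
  through it (\<open>I2\<close>), and at most one curve contains its vertical line
  (\<open>I4\<close>). The rest (\<open>I5\<close>) is counted cell by cell.\<close>

lemma incidences_sample:
  assumes C: "C \<subseteq> \<C>" "finite C" and P: "finite P" and S: "S \<subseteq> C" "S \<noteq> {}" "card S \<le> t"
    and sparse: "\<And>c. c \<in> cells S \<Longrightarrow> real (card {\<eta>\<in>C. \<eta> \<inter> c \<noteq> {}}) \<le> B"
    and B: "0 < B" and s: "0 < s"
    and few: "\<And>Q. finite Q \<Longrightarrow> card Q = s \<Longrightarrow> finite {\<gamma>\<in>\<C>. Q \<subseteq> \<gamma>} \<and> card {\<gamma>\<in>\<C>. Q \<subseteq> \<gamma>} \<le> k"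
  shows "real (card {(z, \<eta>). z \<in> P \<and> \<eta> \<in> C \<and> z \<in> \<eta>}) \<le>
    2 * card P + real (t * r + D * d) * card C + real ((d + 2) * (1 + D + 2 * r)) * real t ^ 2 * (B * s)
      + (1 + real s ^ s * k) * B powr (1 - 1 / s) * card P"
proof -
  have SC: "S \<subseteq> \<C>" "finite S" using S C finite_subset by blast+
  define I1 where "I1 = {(z, \<eta>). z \<in> P \<and> \<eta> \<in> C \<and> z \<in> \<eta> \<and> z \<in> \<Union>(S - {\<eta>})}"
  define I2 where "I2 = {(z, \<eta>). z \<in> P \<and> \<eta> \<in> S \<and> z \<in> \<eta> \<and> z \<notin> \<Union>(S - {\<eta>})}"
  define I3 where "I3 = {(z, \<eta>). z \<in> P \<and> \<eta> \<in> C \<and> z \<in> \<eta> \<and> fst z \<in> crit \<eta> \<and> finite (fibre \<eta> (fst z))}"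
  define I4 where "I4 = {(z, \<eta>). z \<in> P \<and> \<eta> \<in> C \<and> infinite (fibre \<eta> (fst z))}"
  define I5 where "I5 = {(z, \<eta>). z \<in> P \<and> \<eta> \<in> C \<and> z \<in> \<eta> \<and> z \<notin> \<Union>S \<and> fst z \<notin> crit \<eta>}"
  have cover: "{(z, \<eta>). z \<in> P \<and> \<eta> \<in> C \<and> z \<in> \<eta>} \<subseteq> I1 \<union> I2 \<union> I3 \<union> I4 \<union> I5"
    unfolding I1_def I2_def I3_def I4_def I5_def by auto
  have 1: "finite I1 \<and> card I1 \<le> card C * (t * r)"
  proof (rule card_pairs_le_right[OF C(2)])
    fix \<eta> assume \<eta>: "\<eta> \<in> C"
    have sub: "{z. (z, \<eta>) \<in> I1} \<subseteq> (\<Union>\<gamma>\<in>S - {\<eta>}. \<eta> \<inter> \<gamma>)" by (auto simp: I1_def)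
    moreover have f: "finite (\<Union>\<gamma>\<in>S - {\<eta>}. \<eta> \<inter> \<gamma>)"
      using SC \<eta> C finite_Int[of \<eta>] by (intro finite_UN_I) auto
    moreover have "card (\<Union>\<gamma>\<in>S - {\<eta>}. \<eta> \<inter> \<gamma>) \<le> (\<Sum>\<gamma>\<in>S - {\<eta>}. r)"
      using SC \<eta> C card_Int[of \<eta>] by (intro order_trans[OF card_UN_le] sum_mono) auto
    moreover have "card (S - {\<eta>}) \<le> t" using card_Diff1_le[of S \<eta>] S by linarith
    ultimately have "finite {z. (z, \<eta>) \<in> I1}" "card {z. (z, \<eta>) \<in> I1} \<le> card (S - {\<eta>}) * r" "card (S - {\<eta>}) \<le> t"
      using finite_subset[OF sub f] card_mono[OF f sub] by simp_all
    then show "finite {z. (z, \<eta>) \<in> I1} \<and> card {z. (z, \<eta>) \<in> I1} \<le> t * r"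
      using mult_le_mono1[of "card (S - {\<eta>})" t r] by linarith
  qed (auto simp: I1_def)
  have 2: "finite I2 \<and> card I2 \<le> card P * 1"
  proof (rule card_pairs_le_left[OF P])
    fix z
    have "x = y" if "x \<in> {\<eta>. (z, \<eta>) \<in> I2}" "y \<in> {\<eta>. (z, \<eta>) \<in> I2}" for x y
      using that unfolding I2_def by blast
    moreover have "finite {\<eta>. (z, \<eta>) \<in> I2}" by (rule finite_subset[OF _ SC(2)]) (auto simp: I2_def)
    ultimately show "finite {\<eta>. (z, \<eta>) \<in> I2} \<and> card {\<eta>. (z, \<eta>) \<in> I2} \<le> 1"
      using card_le_Suc0_iff_eq by (metis One_nat_def)
  qed (auto simp: I2_def)
  have 3: "finite I3 \<and> card I3 \<le> card C * (D * d)"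
  proof (rule card_pairs_le_right[OF C(2)])
    fix \<eta> assume \<eta>: "\<eta> \<in> C"
    define X where "X = {x\<in>crit \<eta>. finite (fibre \<eta> x)}"
    have e\<C>: "\<eta> \<in> \<C>" using \<eta> C by auto
    have X: "finite X" "card X \<le> D" using finite_crit[OF e\<C>] card_crit[OF e\<C>]
      by (auto simp: X_def intro: order_trans[OF card_mono])
    have sub: "{z. (z, \<eta>) \<in> I3} \<subseteq> (\<Union>x\<in>X. Pair x ` fibre \<eta> x)" by (auto simp: I3_def X_def fibre_def)
    moreover have f: "finite (\<Union>x\<in>X. Pair x ` fibre \<eta> x)" using X by (auto simp: X_def)
    moreover have "card (\<Union>x\<in>X. Pair x ` fibre \<eta> x) \<le> (\<Sum>x\<in>X. d)"
    proof (intro order_trans[OF card_UN_le] sum_mono X)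
      fix x assume "x \<in> X"
      then have "finite (fibre \<eta> x)" by (simp add: X_def)
      then show "card (Pair x ` fibre \<eta> x) \<le> d" using bounded_fibres[OF e\<C>]
        by (auto simp: bounded_fibres_def intro: order_trans[OF card_image_le])
    qed
    ultimately have "finite {z. (z, \<eta>) \<in> I3}" "card {z. (z, \<eta>) \<in> I3} \<le> card X * d"
      using finite_subset[OF sub f] card_mono[OF f sub] by simp_all
    then show "finite {z. (z, \<eta>) \<in> I3} \<and> card {z. (z, \<eta>) \<in> I3} \<le> D * d"
      using mult_le_mono1[OF X(2), of d] by linarith
  qed (auto simp: I3_def)
  have 4: "finite I4 \<and> card I4 \<le> card P * 1"
  proof (rule card_pairs_le_left[OF P])
    fix z :: "real \<times> real"
    have "x = y" if "x \<in> {\<eta>. (z, \<eta>) \<in> I4}" "y \<in> {\<eta>. (z, \<eta>) \<in> I4}" for x y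
    proof (rule ccontr)
      assume "x \<noteq> y"
      have xy: "x \<in> \<C>" "y \<in> \<C>" "infinite (fibre x (fst z))" "infinite (fibre y (fst z))"
        using that C by (auto simp: I4_def)
      then have "fibre x (fst z) = UNIV" "fibre y (fst z) = UNIV"
        using bounded_fibres[of x] bounded_fibres[of y] unfolding bounded_fibres_def by metis+
      then have "Pair (fst z) ` UNIV \<subseteq> x \<inter> y" by (auto simp: fibre_def)
      then have "finite (range (Pair (fst z) :: real \<Rightarrow> real \<times> real))" using finite_Int[OF xy(1,2) \<open>x \<noteq> y\<close>] finite_subset by blast
      then show False by (auto dest!: finite_imageD simp: inj_on_def infinite_UNIV_char_0)
    qed
    moreover have "finite {\<eta>. (z, \<eta>) \<in> I4}" by (rule finite_subset[OF _ C(2)]) (auto simp: I4_def)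
    ultimately show "finite {\<eta>. (z, \<eta>) \<in> I4} \<and> card {\<eta>. (z, \<eta>) \<in> I4} \<le> 1"
      using card_le_Suc0_iff_eq by (metis One_nat_def)
  qed (auto simp: I4_def)
  have "\<exists>c. c \<in> cells S \<and> (\<forall>\<eta>\<in>C. z \<in> \<eta> \<longrightarrow> fst z \<notin> crit \<eta> \<longrightarrow> \<eta> \<inter> c \<noteq> {})" if "z \<notin> \<Union>S" for z
    using cell_of_point[OF S(1,2) C(2,1) that] by blast
  then obtain cell where cell: "\<And>z. z \<notin> \<Union>S \<Longrightarrow> cell z \<in> cells S"
    "\<And>z \<eta>. z \<notin> \<Union>S \<Longrightarrow> \<eta> \<in> C \<Longrightarrow> z \<in> \<eta> \<Longrightarrow> fst z \<notin> crit \<eta> \<Longrightarrow> \<eta> \<inter> cell z \<noteq> {}" by metis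
  \<comment> \<open>Each point is assigned to a single cell, so these sets are disjoint. The point
    need not lie in its cell; it matters only that the curves through it which count in
    \<open>I5\<close> meet that cell.\<close>
  define Pc where "Pc c = {z\<in>P. z \<notin> \<Union>S \<and> cell z = c}" for c
  define Cc where "Cc c = {\<eta>\<in>C. \<eta> \<inter> c \<noteq> {}}" for c
  define J where "J = (\<Union>c\<in>cells S. \<Union>\<eta>\<in>Cc c. (\<lambda>z. (z, \<eta>)) ` (Pc c \<inter> \<eta>))"
  have fin: "finite (cells S)" "finite (Pc c)" "finite (Cc c)" for c
    using finite_cells[OF SC] P C by (auto simp: Pc_def Cc_def)
  have I5J: "I5 \<subseteq> J"
  proof
    fix p assume "p \<in> I5"
    then obtain z \<eta> where p: "p = (z, \<eta>)" "z \<in> P" "\<eta> \<in> C" "z \<in> \<eta>" "z \<notin> \<Union>S" "fst z \<notin> crit \<eta>"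
      unfolding I5_def by blast
    then show "p \<in> J" unfolding J_def using cell[of z]
      by (intro UN_I[of "cell z"] UN_I[of \<eta>]) (auto simp: Pc_def Cc_def)
  qed
  have finJ: "finite J" unfolding J_def using fin by auto
  have inner: "card (\<Union>\<eta>\<in>Cc c. (\<lambda>z. (z, \<eta>)) ` (Pc c \<inter> \<eta>)) \<le> (\<Sum>\<eta>\<in>Cc c. card (Pc c \<inter> \<eta>))" for c
    using fin by (intro order_trans[OF card_UN_le] sum_mono card_image_le) auto
  define A where "A = (1 + real s ^ s * k) * B powr (1 - 1 / s)"
  have "card J \<le> (\<Sum>c\<in>cells S. \<Sum>\<eta>\<in>Cc c. card (Pc c \<inter> \<eta>))"
    unfolding J_def by (intro order_trans[OF card_UN_le] sum_mono inner fin)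
  from real_le_sum[OF this]
  have "real (card J) \<le> (\<Sum>c\<in>cells S. \<Sum>\<eta>\<in>Cc c. real (card (Pc c \<inter> \<eta>)))" by simp
  also have "\<dots> \<le> (\<Sum>c\<in>cells S. B * s + A * card (Pc c))"
    unfolding A_def
  proof (intro sum_mono incidences_no_K fin s B)
    fix c Q assume "c \<in> cells S" and Q: "Q \<subseteq> Pc c" "card Q = s"
    have "finite Q" using Q(1) fin finite_subset by blast
    from few[OF this Q(2)] have "finite {\<gamma>\<in>\<C>. Q \<subseteq> \<gamma>}" "card {\<gamma>\<in>\<C>. Q \<subseteq> \<gamma>} \<le> k" by auto
    moreover have "{\<eta>\<in>Cc c. Q \<subseteq> \<eta>} \<subseteq> {\<gamma>\<in>\<C>. Q \<subseteq> \<gamma>}" using C by (auto simp: Cc_def)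
    ultimately show "card {\<eta>\<in>Cc c. Q \<subseteq> \<eta>} \<le> k" by (meson card_mono order_trans)
  qed (use sparse in \<open>simp add: Cc_def\<close>)
  also have "\<dots> = card (cells S) * (B * s) + A * (\<Sum>c\<in>cells S. card (Pc c))"
    by (simp add: sum.distrib sum_distrib_left)
  also have "(\<Sum>c\<in>cells S. card (Pc c)) = card (\<Union>c\<in>cells S. Pc c)"
    using fin by (intro card_UN_disjoint[symmetric]) (auto simp: Pc_def)
  also have "card (cells S) * (B * s) + A * card (\<Union>c\<in>cells S. Pc c)
      \<le> real ((d + 2) * (1 + D + 2 * r)) * real t ^ 2 * (B * s) + A * card P"
  proof (intro add_mono mult_right_mono mult_left_mono)
    have "card (cells S) \<le> (d + 2) * (1 + D + 2 * r) * card S ^ 2" by (rule card_cells[OF SC])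
    also have "\<dots> \<le> (d + 2) * (1 + D + 2 * r) * t ^ 2" using S by (intro mult_le_mono power_mono) auto
    finally show "real (card (cells S)) \<le> real ((d + 2) * (1 + D + 2 * r)) * real t ^ 2"
      by (metis of_nat_le_iff of_nat_mult of_nat_power)
    show "real (card (\<Union>c\<in>cells S. Pc c)) \<le> real (card P)"
      using P by (auto intro!: card_mono simp: Pc_def)
  qed (use B in \<open>auto simp: A_def\<close>)
  finally have 5: "real (card I5) \<le> real ((d + 2) * (1 + D + 2 * r)) * real t ^ 2 * (B * s) + A * card P"
    using card_mono[OF finJ I5J] by simp
  have fin5: "finite I5" using finJ I5J finite_subset by blast
  have "card {(z, \<eta>). z \<in> P \<and> \<eta> \<in> C \<and> z \<in> \<eta>} \<le> card (I1 \<union> I2 \<union> I3 \<union> I4 \<union> I5)"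
    using 1 2 3 4 fin5 by (intro card_mono cover) auto
  also have "\<dots> \<le> card I1 + card I2 + card I3 + card I4 + card I5"
    by (meson add_mono card_Un_le le_refl order_trans)
  also have "\<dots> \<le> card C * (t * r) + card P * 1 + card C * (D * d) + card P * 1 + card I5"
    using 1 2 3 4 by (intro add_mono) auto
  finally have "real (card {(z, \<eta>). z \<in> P \<and> \<eta> \<in> C \<and> z \<in> \<eta>}) \<le>
      real (card C * (t * r) + card P * 1 + card C * (D * d) + card P * 1 + card I5)" by (simp only: of_nat_le_iff)
  also have "\<dots> = 2 * card P + real (t * r + D * d) * card C + card I5" by (simp add: algebra_simps)
  finally show ?thesis using 5 by (simp add: A_def)
qed

lemma incidence_bound:
  fixes B :: real
  assumes C: "C \<subseteq> \<C>" "finite C" "C \<noteq> {}" and P: "finite P"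
    and B: "0 < B" "B \<le> card C" and s: "0 < s" and t: "6 \<le> t"
    and few: "\<And>Q. finite Q \<Longrightarrow> card Q = s \<Longrightarrow> finite {\<gamma>\<in>\<C>. Q \<subseteq> \<gamma>} \<and> card {\<gamma>\<in>\<C>. Q \<subseteq> \<gamma>} \<le> k"
    and small: "real ((d + 2) * (1 + D + 2 * r) * 36) * real t ^ 6 * (1 - B / card C) ^ (t - 6) < 1"
  shows "real (card {(z, \<eta>). z \<in> P \<and> \<eta> \<in> C \<and> z \<in> \<eta>}) \<le>
    2 * card P + real (t * r + D * d) * card C + real ((d + 2) * (1 + D + 2 * r)) * real t ^ 2 * (B * s)
      + (1 + real s ^ s * k) * B powr (1 - 1 / s) * card P"
proof -
  \<comment> \<open>Six curves determine a cell, and 36 bounds \<open>card S ^ 2\<close> for such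
    defining sets \<open>S\<close> in the count of their cells.\<close>
  have "\<exists>S\<subseteq>C. S \<noteq> {} \<and> card S \<le> t \<and> (\<forall>c\<in>cells S. real (card {\<eta>\<in>C. \<eta> \<inter> c \<noteq> {}}) \<le> B)"
  proof (rule sparse_sample[where b = 6 and q = "(d + 2) * (1 + D + 2 * r) * 36"])
    fix S c assume S: "S \<subseteq> C"
    then have SC: "S \<subseteq> \<C>" "finite S" using C finite_subset by blast+
    { assume "c \<in> cells S"
      from cell_determined_by_six[OF SC this] show "\<exists>S'\<subseteq>S. S' \<noteq> {} \<and> card S' \<le> 6 \<and> c \<in> cells S'" . }
    { assume "card S \<le> 6"
      show "finite (cells S)" by (rule finite_cells[OF SC])
      have "card S ^ 2 \<le> 6 ^ 2" using \<open>card S \<le> 6\<close> by (intro power_mono) auto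
      then have "(d + 2) * (1 + D + 2 * r) * card S ^ 2 \<le> (d + 2) * (1 + D + 2 * r) * 36"
        by (intro mult_le_mono2) simp
      then show "card (cells S) \<le> (d + 2) * (1 + D + 2 * r) * 36"
        using card_cells[OF SC] by linarith }
    { fix \<eta> assume "c \<in> cells S" "\<eta> \<in> S"
      then show "\<not> \<eta> \<inter> c \<noteq> {}" using cell_disjoint_curve[OF SC(1)] by blast }
  qed (use C B t small in auto)
  then obtain S where S: "S \<subseteq> C" "S \<noteq> {}" "card S \<le> t"
    "\<forall>c\<in>cells S. real (card {\<eta>\<in>C. \<eta> \<inter> c \<noteq> {}}) \<le> B" by blast
  show ?thesis
    by (rule incidences_sample[OF C(1,2) P S(1,2,3)], use S(4) in blast, rule B(1), rule s, rule few)
qed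

end

subsection \<open>Rich points and concurrent triples\<close>

text \<open>For summation by parts: it turns a sum of cubes of multiplicities into a sum over
  \<open>k\<close> of \<open>3 * k ^ 2\<close> times the number of points of multiplicity at least
  \<open>k\<close>.\<close>

lemma cube_le_sum: "real n ^ 3 \<le> (\<Sum>k=1..n. 3 * real k ^ 2)"
proof (induction n)
  case (Suc n)
  have "real (Suc n) ^ 3 \<le> real n ^ 3 + 3 * real (Suc n) ^ 2"
    by (simp add: power2_eq_square power3_eq_cube algebra_simps)
  then show ?case using Suc by simp
qed simp

text \<open>Discrete form of an integral. For the sixth roots y < x of consecutive integers, 1 = x^6
  - y^6 is at most 6 (x - y) x^5.\<close>

lemma sum_powr_le: "(\<Sum>k=1..n. real k powr (-5/6)) \<le> 6 * real n powr (1/6)"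
proof (induction n)
  case (Suc n)
  define x where "x = real (Suc n) powr (1/6)"
  define y where "y = real n powr (1/6)"
  have xy: "0 \<le> y" "y \<le> x" "0 < x" by (auto simp: x_def y_def intro: powr_mono2)
  have x6: "x ^ 6 = real (Suc n)" by (simp add: x_def powr_power)
  have y6: "y ^ 6 = real n" by (cases "n = 0") (simp_all add: y_def powr_power)
  have x5: "x ^ 5 = real (Suc n) powr (5/6)" by (simp add: x_def powr_power)
  have "1 = x ^ 6 - y ^ 6" by (simp add: x6 y6)
  also have "\<dots> = (x - y) * (\<Sum>i<6. y ^ (6 - Suc i) * x ^ i)" by (rule power_diff_sumr2)
  also have "\<dots> \<le> (x - y) * (\<Sum>i<6::nat. x ^ 5)"
  proof (intro mult_left_mono sum_mono)
    fix i :: nat assume "i \<in> {..<6}"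
    have "y ^ (6 - Suc i) * x ^ i \<le> x ^ (6 - Suc i) * x ^ i"
      using xy by (intro mult_right_mono power_mono) auto
    also have "\<dots> = x ^ (6 - Suc i + i)" by (simp add: power_add)
    also have "6 - Suc i + i = 5" using \<open>i \<in> {..<6}\<close> by auto
    finally show "y ^ (6 - Suc i) * x ^ i \<le> x ^ 5" .
  qed (use xy in simp)
  finally have "1 \<le> 6 * (x - y) * x ^ 5" by (simp add: algebra_simps)
  then have "1 / x ^ 5 \<le> 6 * (x - y)" using xy by (simp add: divide_le_eq)
  moreover have "real (Suc n) powr (-5/6) = 1 / x ^ 5" by (simp add: x5 powr_minus_divide)
  ultimately show ?case using Suc by (simp add: x_def y_def)
qed simp

text \<open>With B/m at least t^(-9/10), a random sample of size t avoids all curves meeting a given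
  heavy cell with probability about exp(-t^(1/10)) at most, which beats the polynomial number of
  candidate cells. An exponent strictly above -1 avoids logarithms and is the source of the sampling
  loss.\<close>

lemma ex_sample_size:
  fixes q :: real
  shows "\<exists>t0::nat. \<forall>t\<ge>t0. q * real t ^ 6 * exp (- ((real t - 6) * real t powr (-9/10))) < 1"
proof -
  have "((\<lambda>t::nat. q * real t ^ 6 * exp (- ((real t - 6) * real t powr (-9/10)))) \<longlongrightarrow> q * 0) sequentially"
    unfolding mult.assoc by (intro tendsto_mult tendsto_const) real_asymp
  then have "\<forall>\<^sub>F t in sequentially. q * real t ^ 6 * exp (- ((real t - 6) * real t powr (-9/10))) < 1"
    by (intro order_tendstoD(2)) auto
  then show ?thesis by (simp add: eventually_sequentially)
qed

context curve_family begin

text \<open>The Pach--Sharir bound has the exponent \<open>2 + 1 / (s - 1) \<le> 5/2\<close>. The sampling loss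
  raises it to \<open>17/6\<close>; all that matters below is that it is less than 3.\<close>

lemma card_rich_points:
  assumes s: "3 \<le> s"
    and few: "\<And>Q. finite Q \<Longrightarrow> card Q = s \<Longrightarrow> finite {\<gamma>\<in>\<C>. Q \<subseteq> \<gamma>} \<and> card {\<gamma>\<in>\<C>. Q \<subseteq> \<gamma>} \<le> k"
  shows "\<exists>A\<ge>1. \<forall>C P \<kappa> K. C \<subseteq> \<C> \<longrightarrow> finite C \<longrightarrow> C \<noteq> {} \<longrightarrow> finite P \<longrightarrow> K = real (card C) powr (1 - 1 / s) \<longrightarrow>
     A \<le> \<kappa> \<longrightarrow> \<kappa> \<le> K \<longrightarrow> (\<forall>z\<in>P. \<kappa> \<le> real (card {\<eta>\<in>C. z \<in> \<eta>})) \<longrightarrow>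
     real (card P) \<le> A * (card C / K) * (K / \<kappa>) powr (17/6)"
proof -
  define A1 where "A1 = 1 + real s ^ s * k"
  define c3 where "c3 = real ((d + 2) * (1 + D + 2 * r))"
  have A1: "A1 \<ge> 1" by (simp add: A1_def)
  have c3: "c3 \<ge> 1" by (simp add: c3_def algebra_simps)
  obtain t1 where t1: "\<And>t. t \<ge> t1 \<Longrightarrow> 36 * c3 * real t ^ 6 * exp (- ((real t - 6) * real t powr (-9/10))) < 1"
    using ex_sample_size[of "36 * c3"] by auto
  define \<tau> where "\<tau> = real (max t1 6)"
  have \<tau>: "\<tau> \<ge> 6" "\<tau> \<ge> real t1" by (auto simp: \<tau>_def)
  define c5 where "c5 = 4 * \<tau> * (r + D * d + 2 * c3 * s * \<tau>)"
  have c5: "c5 \<ge> 0" using \<tau> c3 by (simp add: c5_def)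
  \<comment> \<open>The summand 8 ensures \<kappa> \<ge> 8, so that \<open>2 * M\<close> is at most
    \<open>\<kappa> / 4 * M\<close>; the other summand is the constant of the final
    estimate.\<close>
  define A where "A = 8 + c5 * (4 * A1) powr (11/6)"
  have A: "A \<ge> 8" "c5 * (4 * A1) powr (11/6) \<le> A" using c5 by (simp_all add: A_def)
  show ?thesis
  proof (intro exI[of _ A] conjI allI impI)
    show "A \<ge> 1" using A by simp
    fix C :: "(real \<times> real) set set" and P and \<kappa> K :: real
    assume C: "C \<subseteq> \<C>" "finite C" "C \<noteq> {}" and P: "finite P" and K: "K = real (card C) powr (1 - 1 / s)"
      and \<kappa>: "A \<le> \<kappa>" "\<kappa> \<le> K" and rich: "\<forall>z\<in>P. \<kappa> \<le> real (card {\<eta>\<in>C. z \<in> \<eta>})"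
    define m where "m = real (card C)"
    have m: "m \<ge> 1" using C by (simp add: m_def card_gt_0_iff Suc_le_eq)
    have \<kappa>8: "\<kappa> \<ge> 8" using \<kappa> A by simp
    have K0: "K > 0" using \<kappa>8 \<kappa> by simp
    \<comment> \<open>The reciprocal of the exponent \<open>1 - 1 / s\<close>; it is at most 3/2
      because s is at least 3.\<close>
    define e where "e = s / (s - 1)"
    have e: "(1 - 1 / s) * e = 1" "1 \<le> e" "e \<le> 3/2" "e * (1 - 1 / s) = 1"
      using s by (auto simp: e_def field_simps of_nat_diff)
    \<comment> \<open>Chosen so that the incidence term \<open>A1 * B powr (1 - 1 / s) * M\<close>
      becomes \<open>\<kappa> / 4 * M\<close> and is absorbed by the lower bound
      \<open>\<kappa> * M\<close>.\<close>
    define x where "x = \<kappa> / (4 * A1)"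
    have x0: "x > 0" using \<kappa>8 A1 by (simp add: x_def)
    have xK: "x \<le> K"
    proof -
      have "x \<le> \<kappa> / 1" unfolding x_def using A1 \<kappa>8 by (intro divide_left_mono) auto
      then show ?thesis using \<kappa> by simp
    qed
    define B where "B = x powr e"
    have Ke: "K powr e = m" using m by (simp add: K m_def[symmetric] powr_powr e)
    have B: "0 < B" "B \<le> m" using x0 xK e Ke powr_mono2[of e x K] by (auto simp: B_def)
    have Bs: "B powr (1 - 1 / s) = x" using x0 by (simp add: B_def powr_powr e)
    define \<rho> where "\<rho> = m / B"
    have \<rho>: "\<rho> \<ge> 1" using B by (simp add: \<rho>_def)
    \<comment> \<open>The exponent 10/9 inverts the 9/10 of \<open>ex_sample_size\<close>, making
      \<open>B / m = 1 / \<rho>\<close> at least \<open>t powr (-9/10)\<close>; the factor \<tau>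
      makes \<open>t\<close> large enough when \<rho> is near 1.\<close>
    define t where "t = nat \<lceil>\<tau> * \<rho> powr (10/9)\<rceil>"
    have p1: "\<rho> powr (10/9) \<ge> 1" using \<rho> by (simp add: ge_one_powr_ge_zero)
    have big: "\<tau> \<le> \<tau> * \<rho> powr (10/9)" using p1 \<tau> by simp
    have tl: "\<tau> * \<rho> powr (10/9) \<le> real t" unfolding t_def by linarith
    have tu: "real t \<le> 2 * \<tau> * \<rho> powr (10/9)"
    proof -
      have "real t \<le> \<tau> * \<rho> powr (10/9) + 1" unfolding t_def using big \<tau> by linarith
      then show ?thesis using big \<tau> by linarith
    qed
    have t6: "6 \<le> t" "t1 \<le> t" using tl big \<tau> by linarith+
    have \<rho>t: "\<rho> \<le> real t powr (9/10)"
    proof -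
      have "\<rho> powr (10/9) \<le> real t" using tl \<tau> p1 mult_right_mono[of 1 \<tau> "\<rho> powr (10/9)"] by linarith
      then have "(\<rho> powr (10/9)) powr (9/10) \<le> real t powr (9/10)" by (intro powr_mono2) auto
      then show ?thesis using \<rho> by (simp add: powr_powr)
    qed
    have small: "real ((d + 2) * (1 + D + 2 * r) * 36) * real t ^ 6 * (1 - B / card C) ^ (t - 6) < 1"
    proof -
      have "1 - B / card C = 1 - 1 / \<rho>" using B by (simp add: \<rho>_def m_def)
      also have "\<dots> \<le> exp (- (1 / \<rho>))" using exp_ge_add_one_self[of "- (1 / \<rho>)"] by simp
      also have "\<dots> \<le> exp (- (real t powr (-9/10)))"
      proof -
        have "1 / (real t powr (9/10)) \<le> 1 / \<rho>" using \<rho>t \<rho> by (intro frac_le) auto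
        then show ?thesis by (simp add: powr_minus_divide)
      qed
      finally have "(1 - B / card C) ^ (t - 6) \<le> exp (- (real t powr (-9/10))) ^ (t - 6)"
        using B m by (intro power_mono) (auto simp: m_def)
      also have "\<dots> = exp (- ((real t - 6) * real t powr (-9/10)))"
        using t6 by (simp add: exp_of_nat_mult[symmetric] of_nat_diff)
      finally have "36 * c3 * real t ^ 6 * (1 - B / card C) ^ (t - 6) \<le> 36 * c3 * real t ^ 6 * exp (- ((real t - 6) * real t powr (-9/10)))"
        using c3 by (intro mult_left_mono) auto
      also have "\<dots> < 1" by (rule t1[OF t6(2)])
      finally show ?thesis by (simp add: c3_def mult_ac)
    qed
    define M where "M = real (card P)"
    have "\<kappa> * M = (\<Sum>z\<in>P. \<kappa>)" by (simp add: M_def)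
    also have "\<dots> \<le> (\<Sum>z\<in>P. real (card {\<eta>\<in>C. z \<in> \<eta>}))" using rich by (intro sum_mono) auto
    also have "\<dots> = real (card (SIGMA z:P. {\<eta>\<in>C. z \<in> \<eta>}))" using P C by (simp add: card_SigmaI)
    also have "(SIGMA z:P. {\<eta>\<in>C. z \<in> \<eta>}) = {(z, \<eta>). z \<in> P \<and> \<eta> \<in> C \<and> z \<in> \<eta>}" by auto
    also have "real (card \<dots>) \<le> 2 * card P + real (t * r + D * d) * card C + real ((d + 2) * (1 + D + 2 * r)) * real t ^ 2 * (B * s)
      + (1 + real s ^ s * k) * B powr (1 - 1 / s) * card P"
      using B s by (intro incidence_bound[OF C P _ _ _ t6(1) few small]) (auto simp: m_def)
    also have "\<dots> = 2 * M + (t * r + D * d) * m + c3 * real t ^ 2 * (B * s) + A1 * x * M"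
      by (simp add: M_def m_def c3_def A1_def Bs)
    also have "A1 * x = \<kappa> / 4" using A1 by (simp add: x_def)
    finally have "\<kappa> / 2 * M \<le> (2 - \<kappa> / 4) * M + (t * r + D * d) * m + c3 * real t ^ 2 * (B * s)"
      by (simp add: algebra_simps)
    also have "\<dots> \<le> 0 + (t * (r + D * d)) * m + c3 * s * t * (t * B)"
    proof (intro add_mono mult_right_mono)
      show "(2 - \<kappa> / 4) * M \<le> 0" using \<kappa>8 by (simp add: M_def mult_nonpos_nonneg)
      have "D * d \<le> t * (D * d)" using t6 by simp
      then have "t * r + D * d \<le> t * (r + D * d)" by (simp add: distrib_left)
      then show "real (t * r + D * d) \<le> real (t * (r + D * d))" by (simp only: of_nat_le_iff)
    qed (use m in \<open>auto simp: power2_eq_square algebra_simps\<close>)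
    \<comment> \<open>Since \<open>t\<close> is about \<rho>^(10/9) and
      \<open>B = m / \<rho>\<close>, both \<open>m\<close> and \<open>t * B\<close> are bounded by
      multiples of m \<rho>^(1/9). The remaining factor \<open>t\<close> brings the exponent to
      11/9, and e \<le> 3/2 turns this into 11/6.\<close>
    also have "\<dots> \<le> t * (r + D * d) * (m * \<rho> powr (1/9)) + c3 * s * t * (2 * \<tau> * (m * \<rho> powr (1/9)))"
    proof -
      have "\<rho> powr (1/9) \<ge> 1" using \<rho> by (simp add: ge_one_powr_ge_zero)
      then have 1: "m \<le> m * \<rho> powr (1/9)" using m by simp
      have "t * B \<le> 2 * \<tau> * \<rho> powr (10/9) * B" using tu B by (intro mult_right_mono) auto
      also have "\<rho> powr (10/9) = \<rho> * \<rho> powr (1/9)" using \<rho> by (simp add: powr_mult_base)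
      also have "2 * \<tau> * (\<rho> * \<rho> powr (1/9)) * B = 2 * \<tau> * (\<rho> * B * \<rho> powr (1/9))" by (simp add: mult_ac)
      also have "\<rho> * B = m" using B by (simp add: \<rho>_def)
      finally have 2: "t * B \<le> 2 * \<tau> * (m * \<rho> powr (1/9))" .
      show ?thesis using 1 2 c3 by (simp only: add_0) (intro add_mono mult_left_mono, auto)
    qed
    also have "\<dots> = t * ((r + D * d + 2 * c3 * s * \<tau>) * (m * \<rho> powr (1/9)))" by (simp add: algebra_simps)
    also have "\<dots> \<le> (2 * \<tau> * \<rho> powr (10/9)) * ((r + D * d + 2 * c3 * s * \<tau>) * (m * \<rho> powr (1/9)))"
      using tu c3 \<tau> m by (intro mult_right_mono) auto
    also have "\<dots> = c5 / 2 * m * (\<rho> powr (10/9) * \<rho> powr (1/9))" by (simp add: c5_def)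
    also have "\<rho> powr (10/9) * \<rho> powr (1/9) = \<rho> powr (11/9)" by (simp flip: powr_add)
    finally have M1: "\<kappa> * M \<le> c5 * m * \<rho> powr (11/9)" by simp
    have "\<rho> = (K / x) powr e" using x0 K0 by (simp add: \<rho>_def B_def powr_divide Ke)
    also have "\<dots> \<le> (K / x) powr (3/2)" using xK x0 e by (intro powr_mono) auto
    finally have "\<rho> powr (11/9) \<le> ((K / x) powr (3/2)) powr (11/9)" using \<rho> by (intro powr_mono2) auto
    also have "\<dots> = (K / x) powr (11/6)" by (simp add: powr_powr)
    also have "K / x = 4 * A1 * (K / \<kappa>)" by (simp add: x_def)
    also have "(4 * A1 * (K / \<kappa>)) powr (11/6) = (4 * A1) powr (11/6) * (K / \<kappa>) powr (11/6)"
      using A1 K0 \<kappa>8 by (subst powr_mult) auto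
    finally have \<rho>2: "\<rho> powr (11/9) \<le> (4 * A1) powr (11/6) * (K / \<kappa>) powr (11/6)" .
    have "\<kappa> * M \<le> c5 * m * ((4 * A1) powr (11/6) * (K / \<kappa>) powr (11/6))"
      using M1 \<rho>2 c5 m by (meson mult_left_mono mult_nonneg_nonneg order_trans zero_le_one)
    also have "\<dots> = (c5 * (4 * A1) powr (11/6)) * (m * (K / \<kappa>) powr (11/6))" by (simp add: mult_ac)
    also have "\<dots> \<le> A * (m * (K / \<kappa>) powr (11/6))" using A m by (intro mult_right_mono) auto
    finally have "M \<le> A * (m * (K / \<kappa>) powr (11/6)) / \<kappa>" using \<kappa>8 by (simp add: field_simps)
    also have "\<dots> = A * (m / K) * ((K / \<kappa>) * (K / \<kappa>) powr (11/6))" using K0 \<kappa>8 by (simp add: field_simps)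
    also have "(K / \<kappa>) * (K / \<kappa>) powr (11/6) = (K / \<kappa>) powr (17/6)"
      using K0 \<kappa>8 by (subst powr_mult_base) auto
    finally show "real (card P) \<le> A * (card C / K) * (K / \<kappa>) powr (17/6)" by (simp add: M_def m_def)
  qed
qed

text \<open>A point of multiplicity j carries at most j^3 triples, so by summation by parts it
  suffices to sum \<open>3 * k ^ 2 * Mk k\<close>. From \<open>A\<close> on, the bound on rich
  points leaves a sum of k^(-5/6), which is O(K^(1/6)). For the boundedly many k < A the trivial
  bound r m^2 on all vertices is enough, since m \<le> K^2.\<close>

lemma card_concurrent_triples:
  assumes s: "3 \<le> s"
    and few: "\<And>Q. finite Q \<Longrightarrow> card Q = s \<Longrightarrow> finite {\<gamma>\<in>\<C>. Q \<subseteq> \<gamma>} \<and> card {\<gamma>\<in>\<C>. Q \<subseteq> \<gamma>} \<le> k"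
  shows "\<exists>A::real. 0 < A \<and> (\<forall>C K. C \<subseteq> \<C> \<longrightarrow> finite C \<longrightarrow> C \<noteq> {} \<longrightarrow> K = real (card C) powr (1 - 1 / s) \<longrightarrow>
     (\<forall>z. real (card {\<eta>\<in>C. z \<in> \<eta>}) < K) \<longrightarrow>
     real (card {T. T \<subseteq> C \<and> card T = 3 \<and> (\<exists>z. \<forall>\<eta>\<in>T. z \<in> \<eta>)}) \<le> A * card C * K ^ 2)"
proof -
  from card_rich_points[OF s few] obtain A where A: "A \<ge> 1"
    "\<And>C P \<kappa> K. C \<subseteq> \<C> \<Longrightarrow> finite C \<Longrightarrow> C \<noteq> {} \<Longrightarrow> finite P \<Longrightarrow> K = real (card C) powr (1 - 1 / s) \<Longrightarrow>
     A \<le> \<kappa> \<Longrightarrow> \<kappa> \<le> K \<Longrightarrow> (\<forall>z\<in>P. \<kappa> \<le> real (card {\<eta>\<in>C. z \<in> \<eta>})) \<Longrightarrow>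
     real (card P) \<le> A * (card C / K) * (K / \<kappa>) powr (17/6)"
    by (simp only: imp_conjL) meson
  show ?thesis
  proof (intro exI[of _ "3 * A ^ 3 * r + 18 * A"] conjI allI impI)
    show "0 < 3 * A ^ 3 * r + 18 * A" using A(1) by (simp add: add_nonneg_pos)
    fix C :: "(real \<times> real) set set" and K :: real
    assume C: "C \<subseteq> \<C>" "finite C" "C \<noteq> {}" and K: "K = real (card C) powr (1 - 1 / s)"
      and poor: "\<forall>z. real (card {\<eta>\<in>C. z \<in> \<eta>}) < K"
    define m where "m = real (card C)"
    have m: "m \<ge> 1" using C by (simp add: m_def card_gt_0_iff Suc_le_eq)
    have K1: "K \<ge> 1" using m s unfolding K m_def[symmetric] by (intro ge_one_powr_ge_zero) auto
    have mK: "m \<le> K ^ 2"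
    proof -
      have "K ^ 2 = m powr (2 * (1 - 1 / s))" using m by (simp add: K m_def[symmetric] powr_power mult.commute)
      moreover have "m powr 1 \<le> m powr (2 * (1 - 1 / s))" using m s by (intro powr_mono) (auto simp: field_simps)
      ultimately show ?thesis using m by simp
    qed
    define deg where "deg z = card {\<eta>\<in>C. z \<in> \<eta>}" for z :: "real \<times> real"
    define V where "V = (\<Union>\<gamma>\<in>C. \<Union>\<delta>\<in>C - {\<gamma>}. \<gamma> \<inter> \<delta>)"
    have finV: "finite V" unfolding V_def using C finite_Int by (intro finite_UN_I) auto
    have "card V \<le> (\<Sum>\<gamma>\<in>C. \<Sum>\<delta>\<in>C - {\<gamma>}. r)"
      unfolding V_def using C card_Int
      by (intro order_trans[OF card_UN_le] sum_mono) auto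
    also have "\<dots> \<le> (\<Sum>\<gamma>\<in>C. card C * r)"
      using C by (intro sum_mono) (auto intro!: mult_le_mono1 card_Diff1_le)
    finally have "card V \<le> card C * card C * r" by simp
    then have "real (card V) \<le> real (card C * card C * r)" by (simp only: of_nat_le_iff)
    then have cardV: "real (card V) \<le> r * m ^ 2" by (simp add: m_def power2_eq_square mult_ac)
    define H where "H = {T. T \<subseteq> C \<and> card T = 3 \<and> (\<exists>z. \<forall>\<eta>\<in>T. z \<in> \<eta>)}"
    have H: "H \<subseteq> (\<Union>z\<in>V. {T. T \<subseteq> {\<eta>\<in>C. z \<in> \<eta>} \<and> card T = 3})"
    proof
      fix T assume "T \<in> H"
      then obtain z where z: "T \<subseteq> C" "card T = 3" "\<forall>\<eta>\<in>T. z \<in> \<eta>" by (auto simp: H_def)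
      obtain a b c where abc: "T = {a, b, c}" "a \<noteq> b" using z(2) by (auto simp: card_3_iff)
      then have "a \<in> C" "b \<in> C - {a}" "z \<in> a \<inter> b" using z(1,3) by auto
      then have "z \<in> V" unfolding V_def by blast
      then show "T \<in> (\<Union>z\<in>V. {T. T \<subseteq> {\<eta>\<in>C. z \<in> \<eta>} \<and> card T = 3})" using z by (intro UN_I[of z]) auto
    qed
    define n where "n = nat \<lfloor>K\<rfloor>"
    have degn: "deg z \<le> n" for z
    proof -
      have "real (deg z) \<le> K" using poor[rule_format, of z] by (simp add: deg_def)
      then show ?thesis unfolding n_def by linarith
    qed
    have nK: "real n \<le> K" unfolding n_def using K1 by linarith
    define Mk where "Mk k = card {z\<in>V. k \<le> deg z}" for k
    have "card H \<le> card (\<Union>z\<in>V. {T. T \<subseteq> {\<eta>\<in>C. z \<in> \<eta>} \<and> card T = 3})"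
      using finV C by (intro card_mono H) auto
    also have "\<dots> \<le> (\<Sum>z\<in>V. card {T. T \<subseteq> {\<eta>\<in>C. z \<in> \<eta>} \<and> card T = 3})" by (rule card_UN_le[OF finV])
    also have "\<dots> = (\<Sum>z\<in>V. deg z choose 3)" using C by (intro sum.cong) (auto simp: n_subsets deg_def)
    also have "\<dots> \<le> (\<Sum>z\<in>V. deg z ^ 3)"
    proof (intro sum_mono)
      fix z show "deg z choose 3 \<le> deg z ^ 3"
        by (cases "3 \<le> deg z") (auto simp: binomial_le_pow binomial_eq_0)
    qed
    finally have "real (card H) \<le> (\<Sum>z\<in>V. real (deg z ^ 3))" by (rule real_le_sum)
    also have "\<dots> = (\<Sum>z\<in>V. real (deg z) ^ 3)" by simp
    also have "\<dots> \<le> (\<Sum>z\<in>V. \<Sum>k=1..deg z. 3 * real k ^ 2)" by (intro sum_mono cube_le_sum)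
    also have "\<dots> = (\<Sum>z\<in>V. \<Sum>k=1..n. if k \<le> deg z then 3 * real k ^ 2 else 0)"
    proof (rule sum.cong[OF refl])
      fix z
      have "{1..deg z} = {k\<in>{1..n}. k \<le> deg z}" using degn[of z] by auto
      then show "(\<Sum>k=1..deg z. 3 * real k ^ 2) = (\<Sum>k=1..n. if k \<le> deg z then 3 * real k ^ 2 else 0)"
        by (simp add: sum.inter_filter[symmetric])
    qed
    also have "\<dots> = (\<Sum>k=1..n. \<Sum>z\<in>V. if k \<le> deg z then 3 * real k ^ 2 else 0)" by (rule sum.swap)
    also have "\<dots> = (\<Sum>k=1..n. 3 * real k ^ 2 * Mk k)"
      using finV by (intro sum.cong refl) (simp add: sum.inter_filter[symmetric] Mk_def)
    also have "\<dots> \<le> (\<Sum>k=1..n. (if real k < A then 3 * A ^ 2 * (r * m ^ 2) else 0) +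
        3 * A * (m / K) * K powr (17/6) * real k powr (-5/6))"
    proof (intro sum_mono)
      fix k assume k: "k \<in> {1..n}"
      have k0: "real k > 0" using k by simp
      show "3 * real k ^ 2 * Mk k \<le> (if real k < A then 3 * A ^ 2 * (r * m ^ 2) else 0) +
        3 * A * (m / K) * K powr (17/6) * real k powr (-5/6)"
      proof (cases "real k < A")
        case True
        have "Mk k \<le> card V" unfolding Mk_def using finV by (intro card_mono) auto
        then have "real (Mk k) \<le> r * m ^ 2" using cardV by linarith
        moreover have "3 * real k ^ 2 \<le> 3 * A ^ 2" using True by (intro mult_left_mono power_mono) auto
        ultimately have "3 * real k ^ 2 * Mk k \<le> 3 * A ^ 2 * (r * m ^ 2)" by (intro mult_mono) auto
        moreover have "0 \<le> 3 * A * (m / K) * K powr (17/6) * real k powr (-5/6)" using A(1) m K1 by simp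
        ultimately show ?thesis using True by simp
      next
        case False
        have "real (Mk k) \<le> A * (card C / K) * (K / real k) powr (17/6)"
          unfolding Mk_def using C K False k nK finV
          by (intro A(2)) (auto simp: deg_def)
        then have "3 * real k ^ 2 * Mk k \<le> 3 * real k ^ 2 * (A * (m / K) * (K / real k) powr (17/6))"
          unfolding m_def by (intro mult_left_mono) auto
        also have "(K / real k) powr (17/6) = K powr (17/6) * real k powr (-17/6)"
          using K1 k0 by (simp add: powr_divide powr_minus_divide)
        also have "3 * real k ^ 2 * (A * (m / K) * (K powr (17/6) * real k powr (-17/6))) =
            3 * A * (m / K) * K powr (17/6) * (real k powr 2 * real k powr (-17/6))"
          using k0 by (simp add: mult_ac)
        also have "real k powr 2 * real k powr (-17/6) = real k powr (-5/6)"
          by (subst powr_add[symmetric]) simp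
        finally show ?thesis using False by simp
      qed
    qed
    also have "\<dots> = (\<Sum>k=1..n. if real k < A then 3 * A ^ 2 * (r * m ^ 2) else 0) +
        3 * A * (m / K) * K powr (17/6) * (\<Sum>k=1..n. real k powr (-5/6))"
      by (simp add: sum.distrib sum_distrib_left)
    also have "\<dots> \<le> A * (3 * A ^ 2 * (r * (m * K ^ 2))) + 3 * A * (m / K) * K powr (17/6) * (6 * K powr (1/6))"
    proof (intro add_mono mult_left_mono)
      have "(\<Sum>k=1..n. if real k < A then 3 * A ^ 2 * (r * m ^ 2) else 0) =
          card {k\<in>{1..n}. real k < A} * (3 * A ^ 2 * (r * m ^ 2))"
        by (simp add: sum.inter_filter[symmetric])
      also have "\<dots> \<le> A * (3 * A ^ 2 * (r * (m * K ^ 2)))"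
      proof (intro mult_mono mult_left_mono)
        have "{k\<in>{1..n}. real k < A} \<subseteq> {1..nat \<lfloor>A\<rfloor>}" by (auto simp: le_nat_floor)
        then have "card {k\<in>{1..n}. real k < A} \<le> nat \<lfloor>A\<rfloor>" using card_mono[of "{1..nat \<lfloor>A\<rfloor>}"] by fastforce
        then show "real (card {k\<in>{1..n}. real k < A}) \<le> A" using A(1) by linarith
        show "m ^ 2 \<le> m * K ^ 2" using mK m by (simp add: power2_eq_square)
      qed (use A(1) m in auto)
      finally show "(\<Sum>k=1..n. if real k < A then 3 * A ^ 2 * (r * m ^ 2) else 0) \<le> A * (3 * A ^ 2 * (r * (m * K ^ 2)))" .
      have "6 * real n powr (1/6) \<le> 6 * K powr (1/6)" using nK by (intro mult_left_mono powr_mono2) auto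
      then show "(\<Sum>k=1..n. real k powr (-5/6)) \<le> 6 * K powr (1/6)" using sum_powr_le[of n] by linarith
    qed (use A(1) m K1 in auto)
    also have "\<dots> = (3 * A ^ 3 * r) * m * K ^ 2 + 18 * A * m * (K powr (17/6) * K powr (1/6) / K)"
      by (simp add: power2_eq_square power3_eq_cube field_simps)
    also have "K powr (17/6) * K powr (1/6) / K = K ^ 2"
    proof -
      have "K powr (17/6) * K powr (1/6) = K powr 3" by (subst powr_add[symmetric]) simp
      also have "\<dots> = K ^ 3" using K1 by (simp add: powr_numeral)
      finally show ?thesis using K1 by (simp add: power3_eq_cube power2_eq_square)
    qed
    finally show "real (card {T. T \<subseteq> C \<and> card T = 3 \<and> (\<exists>z. \<forall>\<eta>\<in>T. z \<in> \<eta>)}) \<le> (3 * A ^ 3 * r + 18 * A) * card C * K ^ 2"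
      by (simp add: H_def m_def algebra_simps)
  qed
qed

end

subsection \<open>Simple subarrangements\<close>

text \<open>On a monochromatic triple one colour dictates the other two, so the colouring is known
  from its restriction to all but two elements.\<close>

lemma card_constant_on_triple:
  assumes "finite C" "T \<subseteq> C" "card T = 3"
  shows "card {g \<in> C \<rightarrow>\<^sub>E {..<L::nat}. \<exists>i. \<forall>\<eta>\<in>T. g \<eta> = i} \<le> L ^ (card C - 2)"
proof -
  obtain a b c where T: "T = {a, b, c}" "a \<noteq> b" "b \<noteq> c" "a \<noteq> c"
    using assms(3) by (auto simp: card_3_iff)
  define X where "X = C - {a, b}"
  have X: "finite X" "card X = card C - 2"
    using assms T by (auto simp: X_def card_Diff_subset)
  have "inj_on (\<lambda>g. restrict g X) {g \<in> C \<rightarrow>\<^sub>E {..<L}. \<exists>i. \<forall>\<eta>\<in>T. g \<eta> = i}"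
  proof (rule inj_onI)
    fix g g' assume g: "g \<in> {g \<in> C \<rightarrow>\<^sub>E {..<L}. \<exists>i. \<forall>\<eta>\<in>T. g \<eta> = i}"
      "g' \<in> {g \<in> C \<rightarrow>\<^sub>E {..<L}. \<exists>i. \<forall>\<eta>\<in>T. g \<eta> = i}" and eq: "restrict g X = restrict g' X"
    have eqX: "g x = g' x" if "x \<in> X" for x using eq that by (metis restrict_apply')
    have "c \<in> X" using T assms by (auto simp: X_def)
    have "g a = g c" "g b = g c" "g' a = g' c" "g' b = g' c" using g T by auto
    then have "g x = g' x" if "x \<in> C" for x
      using that eqX[of x] eqX[OF \<open>c \<in> X\<close>] by (cases "x = a"; cases "x = b") (auto simp: X_def)
    then show "g = g'" using g by (intro PiE_ext[of g C "\<lambda>_. {..<L}"]) auto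
  qed
  moreover have "(\<lambda>g. restrict g X) ` {g \<in> C \<rightarrow>\<^sub>E {..<L}. \<exists>i. \<forall>\<eta>\<in>T. g \<eta> = i} \<subseteq> X \<rightarrow>\<^sub>E {..<L}"
    by (intro image_subsetI) (auto simp: restrict_PiE_iff X_def)
  ultimately have "card {g \<in> C \<rightarrow>\<^sub>E {..<L}. \<exists>i. \<forall>\<eta>\<in>T. g \<eta> = i} \<le> card (X \<rightarrow>\<^sub>E {..<L})"
    using X by (intro card_inj_on_le finite_PiE) auto
  then show ?thesis using X by (simp add: card_PiE_const)
qed

text \<open>A random colouring with \<open>L\<close> colours leaves few monochromatic triples, and some colour class
  stays large after one element of each of its triples is deleted.\<close>

lemma independent_set_of_triples:
  fixes C :: "'a set" and L :: nat
  assumes C: "finite C" and H: "\<And>T. T \<in> H \<Longrightarrow> T \<subseteq> C \<and> card T = 3" and L: "0 < L"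
    and few: "2 * card H \<le> card C * L ^ 2"
  shows "\<exists>S\<subseteq>C. (\<forall>T\<in>H. \<not> T \<subseteq> S) \<and> real (card C) / (2 * real L) \<le> real (card S)"
proof (cases "H = {}")
  case True
  have "real (card C) / (2 * real L) \<le> real (card C)" using L by (simp add: divide_le_eq mult_le_cancel_left1)
  then show ?thesis using True by auto
next
  case False
  then obtain T0 where "T0 \<in> H" by auto
  \<comment> \<open>Makes \<open>card C - 2\<close> a genuine difference of natural numbers.\<close>
  then have m3: "card C \<ge> 3" using H[of T0] card_mono[OF C, of T0] by auto
  have finH: "finite H" using C H by (intro finite_subset[of H "Pow C"]) auto
  define F where "F = C \<rightarrow>\<^sub>E {..<L}"
  have F: "finite F" "card F = L ^ card C" using C by (auto simp: F_def card_PiE_const intro!: finite_PiE)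
  define mono where "mono g = {T\<in>H. \<exists>i. \<forall>\<eta>\<in>T. g \<eta> = i}" for g :: "'a \<Rightarrow> nat"
  have "(\<Sum>g\<in>F. card (mono g)) = (\<Sum>g\<in>F. \<Sum>T\<in>H. if \<exists>i. \<forall>\<eta>\<in>T. g \<eta> = i then 1 else 0)"
    unfolding mono_def by (intro sum.cong refl card_filter_eq_sum finH)
  also have "\<dots> = (\<Sum>T\<in>H. \<Sum>g\<in>F. if \<exists>i. \<forall>\<eta>\<in>T. g \<eta> = i then 1 else 0)" by (rule sum.swap)
  also have "\<dots> = (\<Sum>T\<in>H. card {g\<in>F. \<exists>i. \<forall>\<eta>\<in>T. g \<eta> = i})"
    by (intro sum.cong refl card_filter_eq_sum[symmetric] F)
  also have "\<dots> \<le> (\<Sum>T\<in>H. L ^ (card C - 2))"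
    unfolding F_def using C H by (intro sum_mono card_constant_on_triple) auto
  finally have total: "(\<Sum>g\<in>F. card (mono g)) \<le> card H * L ^ (card C - 2)" by simp
  \<comment> \<open>Averaging over the colourings: a fixed triple is monochromatic with probability
    at most 1/L^2.\<close>
  have "\<exists>g\<in>F. card (mono g) * L ^ 2 \<le> card H"
  proof (rule ccontr)
    assume "\<not> ?thesis"
    then have "\<And>g. g \<in> F \<Longrightarrow> card H < card (mono g) * L ^ 2" by force
    moreover have "F \<noteq> {}" using F L by auto
    ultimately have "(\<Sum>g\<in>F. card H) < (\<Sum>g\<in>F. card (mono g) * L ^ 2)" using F by (intro sum_strict_mono) auto
    also have "\<dots> = (\<Sum>g\<in>F. card (mono g)) * L ^ 2" by (simp add: sum_distrib_right)
    also have "\<dots> \<le> card H * L ^ (card C - 2) * L ^ 2" by (rule mult_le_mono1[OF total])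
    also have "\<dots> = card H * L ^ (card C - 2 + 2)" by (simp only: power_add mult.assoc)
    also have "card C - 2 + 2 = card C" using m3 by simp
    also have "card H * L ^ card C = (\<Sum>g\<in>F. card H)" using F by simp
    finally show False by simp
  qed
  then obtain g where g: "g \<in> F" "card (mono g) * L ^ 2 \<le> card H" by auto
  have "(2 * card (mono g)) * L ^ 2 \<le> card C * L ^ 2"
    using g(2) few unfolding mult.assoc by linarith
  then have mono2: "2 * card (mono g) \<le> card C" using L by simp
  define X where "X i = {\<eta>\<in>C. g \<eta> = i}" for i
  define Mi where "Mi i = {T\<in>H. T \<subseteq> X i}" for i
  have finX: "finite (X i)" "finite (Mi i)" for i using C finH by (auto simp: X_def Mi_def)
  have cardX: "(\<Sum>i<L. card (X i)) = card C"
  proof -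
    have "C = (\<Union>i<L. X i)" using g(1) by (auto simp: X_def F_def)
    then have "card C = card (\<Union>i<L. X i)" by simp
    also have "\<dots> = (\<Sum>i<L. card (X i))" using finX by (intro card_UN_disjoint) (auto simp: X_def)
    finally show ?thesis by simp
  qed
  have cardM: "(\<Sum>i<L. card (Mi i)) \<le> card (mono g)"
  proof -
    have disj: "Mi i \<inter> Mi j = {}" if "i \<noteq> j" for i j
    proof -
      have False if "T \<in> Mi i" "T \<in> Mi j" for T
      proof -
        have "T \<noteq> {}" using H[of T] that by (auto simp: Mi_def)
        then show False using that \<open>i \<noteq> j\<close> by (auto simp: Mi_def X_def)
      qed
      then show ?thesis by blast
    qed
    have "(\<Sum>i<L. card (Mi i)) = card (\<Union>i<L. Mi i)" using finX disj by (intro card_UN_disjoint[symmetric]) auto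
    also have "\<dots> \<le> card (mono g)" using finH by (intro card_mono) (auto simp: mono_def Mi_def X_def)
    finally show ?thesis .
  qed
  \<comment> \<open>Averaging over the colours: class sizes minus numbers of monochromatic triples
    add up to at least half of \<open>card C\<close>.\<close>
  have "\<exists>i<L. real (card C) / (2 * real L) \<le> real (card (X i)) - real (card (Mi i))"
  proof (rule ccontr)
    assume "\<not> ?thesis"
    then have "(\<Sum>i<L. real (card (X i)) - real (card (Mi i))) < (\<Sum>i<L. real (card C) / (2 * real L))"
      using L by (intro sum_strict_mono) auto
    also have "\<dots> = real (card C) / 2" using L by simp
    finally have "real (\<Sum>i<L. card (X i)) - real (\<Sum>i<L. card (Mi i)) < real (card C) / 2"
      by (simp add: sum_subtractf)
    then have "real (card C) < 2 * real (\<Sum>i<L. card (Mi i))" unfolding cardX by simp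
    also have "\<dots> \<le> 2 * real (card (mono g))" using cardM by (simp only: of_nat_le_iff mult_le_cancel_left_pos zero_less_numeral)
    also have "\<dots> \<le> real (card C)" using mono2 by linarith
    finally show False by simp
  qed
  then obtain i where i: "real (card C) / (2 * real L) \<le> real (card (X i)) - real (card (Mi i))" by auto
  have "\<forall>T\<in>H. \<exists>x. x \<in> T"
  proof
    fix T assume "T \<in> H"
    then have "T \<noteq> {}" using H[of T] by auto
    then show "\<exists>x. x \<in> T" by auto
  qed
  then obtain h where h: "\<And>T. T \<in> H \<Longrightarrow> h T \<in> T" by metis
  define S where "S = X i - h ` Mi i"
  have "\<not> T \<subseteq> S" if "T \<in> H" for T
  proof
    assume "T \<subseteq> S"
    then have "T \<in> Mi i" using that by (auto simp: Mi_def S_def)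
    then show False using h[OF that] \<open>T \<subseteq> S\<close> by (auto simp: S_def)
  qed
  moreover have "real (card (X i)) - real (card (Mi i)) \<le> real (card S)"
  proof -
    have "card (X i) - card (h ` Mi i) \<le> card S"
      unfolding S_def using finX by (intro diff_card_le_card_Diff) auto
    moreover have "card (h ` Mi i) \<le> card (Mi i)" using finX by (intro card_image_le)
    ultimately show ?thesis by linarith
  qed
  moreover have "S \<subseteq> C" by (auto simp: S_def X_def)
  ultimately show ?thesis using i by (intro exI[of _ S]) auto
qed

section \<open>Algebraic curves as a curve family, and the conclusion\<close>

lemma total_degree_bounds:
  assumes "total_degree p \<le> d"
  shows "degree p \<le> d" "degree (coeff p j) \<le> d"
proof -
  have le: "i + j \<le> d" if "coeff (coeff p j) i \<noteq> 0" for i j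
  proof -
    have "i + j \<le> total_degree p" unfolding total_degree_def
      using that finite_total_degree_set[of p] by (intro Max_ge) auto
    then show ?thesis using assms by simp
  qed
  show "degree (coeff p j) \<le> d" for j
    using le[of j "degree (coeff p j)"] by (cases "coeff p j = 0") auto
  show "degree p \<le> d"
    using le[of "degree p" "degree (lead_coeff p)"] by (cases "p = 0") auto
qed

text \<open>The exceptional lines are the roots of the polynomial \<open>h\<close> of
  \<open>squarefree_part\<close>. Off them the curve has the same fibres as the zero set of
  \<open>u\<close>, whose roots in y are simple and so move continuously.\<close>

lemma plane_algebraic_curve_regular:
  assumes "plane_algebraic_curve d \<gamma>"
  shows "closed \<gamma> \<and> bounded_fibres d \<gamma> \<and>
    (\<exists>Z. finite Z \<and> card Z \<le> 2 * d * d + 2 * d \<and> regular_off Z \<gamma>)"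
proof -
  obtain p where p: "0 < total_degree p" "total_degree p \<le> d" "\<gamma> = {z. eval2 p z = 0}"
    using assms by (auto simp: plane_algebraic_curve_def)
  have "p \<noteq> 0" using p(1) by (auto simp: total_degree_def)
  have fib: "fibre \<gamma> x = {y. poly (spec x p) y = 0}" for x by (simp add: fibre_def p(3) poly_spec)
  have "closed \<gamma>" unfolding p(3) by (intro closed_Collect_eq continuous_intros)
  moreover have "bounded_fibres d \<gamma>"
    unfolding bounded_fibres_def
  proof
    fix x
    show "if finite (fibre \<gamma> x) then card (fibre \<gamma> x) \<le> d else fibre \<gamma> x = UNIV"
    proof (cases "spec x p = 0")
      case True
      then have "fibre \<gamma> x = UNIV" by (simp add: fib)
      then show ?thesis using infinite_UNIV_char_0[where 'a = real] by simp
    next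
      case False
      have "card (fibre \<gamma> x) \<le> degree (spec x p)" unfolding fib by (rule card_poly_roots_bound[OF False])
      also have "\<dots> \<le> d" using degree_spec_le[of x p] total_degree_bounds(1)[OF p(2)] by simp
      finally show ?thesis using poly_roots_finite[OF False] by (simp add: fib)
    qed
  qed
  moreover obtain u h where uh: "h \<noteq> 0" "degree h \<le> 2 * d * d + 2 * d"
     "\<And>x. poly h x \<noteq> 0 \<Longrightarrow> poly (lead_coeff u) x \<noteq> 0 \<and> spec x p \<noteq> 0 \<and>
        (\<forall>y. eval2 p (x, y) = 0 \<longleftrightarrow> eval2 u (x, y) = 0) \<and>
        (\<forall>y. eval2 u (x, y) = 0 \<longrightarrow> eval2 (pderiv u) (x, y) \<noteq> 0)"
    using squarefree_part[OF \<open>p \<noteq> 0\<close> total_degree_bounds[OF p(2)]] by blast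
  have "regular_off {x. poly h x = 0} \<gamma>"
    unfolding regular_off_def
  proof (intro allI impI conjI)
    fix a assume "a \<notin> {x. poly h x = 0}"
    then have ha: "poly h a \<noteq> 0" by simp
    then show "finite (fibre \<gamma> a)" using uh(3) poly_roots_finite[of "spec a p"] by (simp add: fib)
    have fu: "fibre \<gamma> x = {y. eval2 u (x, y) = 0}" if "poly h x \<noteq> 0" for x
      using uh(3)[OF that] by (simp add: fibre_def p(3))
    fix \<rho> :: real assume "\<rho> > 0"
    have 1: "\<forall>\<^sub>F x in nhds a. \<exists>f. bij_betw f {y. eval2 u (a, y) = 0} {y. eval2 u (x, y) = 0} \<and>
           (\<forall>y. eval2 u (a, y) = 0 \<longrightarrow> \<bar>f y - y\<bar> < \<rho>)"
      using uh(3)[OF ha] \<open>\<rho> > 0\<close> by (intro local_roots) auto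
    have 2: "\<forall>\<^sub>F x in nhds a. poly h x \<noteq> 0"
      by (rule tendsto_imp_eventually_ne[OF _ ha]) (auto intro!: tendsto_intros simp: tendsto_nhds_iff)
    show "\<forall>\<^sub>F x in nhds a. \<exists>f. bij_betw f (fibre \<gamma> a) (fibre \<gamma> x) \<and> (\<forall>y\<in>fibre \<gamma> a. \<bar>f y - y\<bar> < \<rho>)"
      using eventually_conj[OF 1 2] by (rule eventually_mono) (simp add: fu ha)
  qed
  moreover have "finite {x. poly h x = 0}" "card {x. poly h x = 0} \<le> 2 * d * d + 2 * d"
    using poly_roots_finite[OF uh(1)] card_poly_roots_bound[OF uh(1)] uh(2) by auto
  ultimately show ?thesis by blast
qed

theorem theorem25:
  fixes s :: nat and \<C> :: "(real \<times> real) set set"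
  assumes "s > 2"
    and "bounded_degree_family \<C>"
    and "\<exists>r. multiplicity_type \<C> r"
    and "degrees_of_freedom \<C> s"
  shows "\<exists>c\<^sub>1>0. \<exists>c\<^sub>2>0. \<forall>m. \<forall>C. C \<subseteq> \<C> \<and> finite C \<and> card C = m \<longrightarrow>
           (\<exists>S\<subseteq>C. real (card S) \<ge> c\<^sub>1 * real m powr (1 - 1 / real s) \<and> (\<exists>z. \<forall>\<gamma>\<in>S. z \<in> \<gamma>)) \<or>
           (\<exists>S\<subseteq>C. real (card S) \<ge> c\<^sub>2 * real m powr (1 / real s) \<and> simple_arrangement S)"
proof -
  obtain d where d: "\<And>\<gamma>. \<gamma> \<in> \<C> \<Longrightarrow> plane_algebraic_curve d \<gamma>"
    using assms(2) by (auto simp: bounded_degree_family_def)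
  obtain r where r: "multiplicity_type \<C> r" using assms(3) by auto
  obtain k where k: "\<And>P. finite P \<Longrightarrow> card P = s \<Longrightarrow>
      finite {\<gamma>\<in>\<C>. P \<subseteq> \<gamma>} \<and> card {\<gamma>\<in>\<C>. P \<subseteq> \<gamma>} \<le> k"
    using assms(4) by (auto simp: degrees_of_freedom_def few_curves_through_def)
  have "\<forall>\<gamma>. \<exists>Z. \<gamma> \<in> \<C> \<longrightarrow> finite Z \<and> card Z \<le> 2 * d * d + 2 * d \<and> regular_off Z \<gamma>"
    using plane_algebraic_curve_regular[OF d] by blast
  then obtain crit where crit: "\<And>\<gamma>. \<gamma> \<in> \<C> \<Longrightarrow>
      finite (crit \<gamma>) \<and> card (crit \<gamma>) \<le> 2 * d * d + 2 * d \<and> regular_off (crit \<gamma>) \<gamma>"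
    by metis
  interpret curve_family \<C> crit d "2 * d * d + 2 * d" r
    using crit plane_algebraic_curve_regular[OF d] r
    by unfold_locales (auto simp: multiplicity_type_def)
  have s3: "3 \<le> s" using assms(1) by simp
  obtain A :: real where A: "A > 0" "\<And>C K. C \<subseteq> \<C> \<Longrightarrow> finite C \<Longrightarrow> C \<noteq> {} \<Longrightarrow>
     K = real (card C) powr (1 - 1 / s) \<Longrightarrow> (\<forall>z. real (card {\<eta>\<in>C. z \<in> \<eta>}) < K) \<Longrightarrow>
     real (card {T. T \<subseteq> C \<and> card T = 3 \<and> (\<exists>z. \<forall>\<eta>\<in>T. z \<in> \<eta>)}) \<le> A * card C * K ^ 2"
    using card_concurrent_triples[OF s3 k] by meson
  \<comment> \<open>A convenient number with \<open>2 * A \<le> q ^ 2\<close>, so that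
    \<open>q * K\<close> colours meet the sparsity hypothesis of
    \<open>independent_set_of_triples\<close>.\<close>
  define q where "q = 1 + 2 * A"
  have q: "q \<ge> 1" "2 * A \<le> q ^ 2" using A(1) by (simp_all add: q_def power2_eq_square algebra_simps)
  have "(\<exists>S\<subseteq>C. real (card S) \<ge> 1 * real m powr (1 - 1 / real s) \<and> (\<exists>z. \<forall>\<gamma>\<in>S. z \<in> \<gamma>)) \<or>
        (\<exists>S\<subseteq>C. real (card S) \<ge> 1 / (4 * q) * real m powr (1 / real s) \<and> simple_arrangement S)"
    if C: "C \<subseteq> \<C>" "finite C" "card C = m" for m C
  proof (cases "C = {}")
    case True
    \<comment> \<open>Here \<open>m = 0\<close>, and \<open>0 powr _ = 0\<close>, so the empty
      subset is large enough and trivially concurrent.\<close>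
    then show ?thesis using C(3) by (intro disjI1 exI[of _ "{}"]) auto
  next
    case False
    define K where "K = real m powr (1 - 1 / s)"
    have m: "real m \<ge> 1" using False C by (auto simp: card_gt_0_iff Suc_le_eq)
    have K1: "K \<ge> 1" using m s3 unfolding K_def by (intro ge_one_powr_ge_zero) auto
    show ?thesis
    proof (cases "\<exists>z. K \<le> real (card {\<eta>\<in>C. z \<in> \<eta>})")
      case True
      then obtain z where "K \<le> real (card {\<eta>\<in>C. z \<in> \<eta>})" by blast
      then show ?thesis by (intro disjI1 exI[of _ "{\<eta>\<in>C. z \<in> \<eta>}"] conjI exI[of _ z]) (auto simp: K_def)
    next
      case poor: False
      define H where "H = {T. T \<subseteq> C \<and> card T = 3 \<and> (\<exists>z. \<forall>\<eta>\<in>T. z \<in> \<eta>)}"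
      have cardH: "real (card H) \<le> A * m * K ^ 2"
        using A(2)[OF C(1,2) False, of K] poor by (simp add: H_def K_def C(3) not_le)
      define L where "L = nat \<lceil>q * K\<rceil>"
      have qK: "1 \<le> q * K" using q K1 mult_mono[of 1 q 1 K] by simp
      have L: "q * K \<le> real L" "real L \<le> 2 * q * K" "0 < L" using qK unfolding L_def by linarith+
      have "real (2 * card H) \<le> 2 * A * (m * K ^ 2)" using cardH by simp
      also have "\<dots> \<le> q ^ 2 * (m * K ^ 2)" using q(2) by (intro mult_right_mono) auto
      also have "\<dots> = m * (q * K) ^ 2" by (simp add: power_mult_distrib mult_ac)
      also have "\<dots> \<le> m * real L ^ 2" using L(1) qK by (intro mult_left_mono power_mono) auto
      finally have "real (2 * card H) \<le> real (card C * L ^ 2)" by (simp add: C(3))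
      then have "2 * card H \<le> card C * L ^ 2" by (simp only: of_nat_le_iff)
      then obtain S where S: "S \<subseteq> C" "\<forall>T\<in>H. \<not> T \<subseteq> S" "real (card C) / (2 * real L) \<le> real (card S)"
        using independent_set_of_triples[OF C(2) _ L(3), of H] by (auto simp: H_def)
      \<comment> \<open>Since \<open>m / K\<close> is \<open>m powr (1 / s)\<close>, the bound
        m/(2L) has the required order; one factor 2 in \<open>4 * q\<close> comes from it, the other
        from rounding \<open>q * K\<close> up to \<open>L\<close>.\<close>
      have "1 / (4 * q) * real m powr (1 / s) = real m / (2 * (2 * q * K))"
      proof -
        have "real m powr (1 / s) * K = real m" using m by (simp add: K_def flip: powr_add)
        then show ?thesis using q K1 by (simp add: field_simps)
      qed
      also have "\<dots> \<le> real m / (2 * real L)" using L by (intro frac_le) (simp_all add: mult_ac)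
      also have "\<dots> \<le> card S" using S(3) C(3) by simp
      finally have "1 / (4 * q) * real m powr (1 / s) \<le> card S" .
      moreover have "simple_arrangement S"
        unfolding simple_arrangement_def
      proof (intro allI conjI)
        fix z
        show fin: "finite {\<gamma>\<in>S. z \<in> \<gamma>}" using finite_subset[OF S(1) C(2)] by simp
        show "card {\<gamma>\<in>S. z \<in> \<gamma>} \<le> 2"
        proof (rule ccontr)
          assume "\<not> ?thesis"
          then obtain T where T: "T \<subseteq> {\<gamma>\<in>S. z \<in> \<gamma>}" "card T = 3"
            using obtain_subset_with_card_n[of 3 "{\<gamma>\<in>S. z \<in> \<gamma>}"] by force
          then have "T \<subseteq> S" "T \<subseteq> C" "\<forall>\<eta>\<in>T. z \<in> \<eta>" using S(1) by auto
          then have "T \<in> H" using T(2) unfolding H_def by blast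
          then show False using S(2) \<open>T \<subseteq> S\<close> by blast
        qed
      qed
      ultimately show ?thesis using S(1) by blast
    qed
  qed
  moreover have "0 < 1 / (4 * q)" using q by simp
  ultimately show ?thesis using zero_less_one by blast
qed

end
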